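(* (In ZFC.) For every valuation domain $R$ of cardinality $\aleph_1$ and every type $J/R$, if $\Gamma(J/R)=1$, then there is a non-standard uniserial $R$-module of type $J/R$.
   Context: A valuation domain is an integral domain whose ideals are linearly ordered; $Q$ its quotient field. A module is uniserial if its submodules are linearly ordered; a uniserial $R$-module is standard if isomorphic to $J'/A$ for $R$-submodules $A\subseteq J'$ of $Q$, non-standard otherwise. For uniserial $U$ and $0\neq a\in U$, $\mathrm{Ann}(a)=\{r:ra=0\}$, $D(a)=\bigcup\{r^{-1}R:a\in rU\}$; $U$ has type $J/A$ if $J/A\cong D(a)/\mathrm{Ann}(a)$. A type $J/R$ is given by an $R$-submodule $J$ of $Q$ with $R\subseteq J$; write $J=\bigcup_{\sigma<\omega_1} r_\sigma^{-1}R$ with nonzero $r_\sigma\in R$, $r_\tau\mid r_\sigma$ for $\tau<\sigma$. A cub is a closed unbounded subset of $\omega_1$; $D(\omega_1)$ is ${\cal P}(\omega_1)$ modulo $S_1\sim S_2$ iff $S_1\cap C=S_2\cap C$ for some cub $C$, a Boolean algebra whose $0$ is the class of sets disjoint from a cub and whose $1$ is the class of sets containing a cub. $\Gamma(J/R)$ is the class of $S=\{\delta<\omega_1\text{ limit}: R/\bigcap_{\sigma<\delta}r_\sigma R\text{ is not complete}\}$, where $R/\bigcap_{\sigma<\delta}r_\sigma R$ carries the metrizable linear topology with basis of neighbourhoods of $0$ given by the images of $r_\sigma R$, $\sigma<\delta$. This is independent of the choice of the $r_\sigma$. *)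

theory Defs
  imports Main "HOL-Computational_Algebra.Fraction_Field"
begin

definition is_ideal :: "'a::comm_ring_1 set \<Rightarrow> bool" where
  "is_ideal I \<longleftrightarrow> 0 \<in> I \<and> (\<forall>x\<in>I. \<forall>y\<in>I. x + y \<in> I) \<and> (\<forall>r. \<forall>x\<in>I. r * x \<in> I)"

text \<open>The whole type 'a (an integral domain) is the ring R.\<close>
definition valuation_domain :: "'a::idom itself \<Rightarrow> bool" where
  "valuation_domain _ \<longleftrightarrow>
     (\<forall>I J :: 'a set. is_ideal I \<longrightarrow> is_ideal J \<longrightarrow> I \<subseteq> J \<or> J \<subseteq> I)"

definition emb :: "'a::idom \<Rightarrow> 'a fract" where
  "emb x = Fract x 1"

definition submodQ :: "'a::idom fract set \<Rightarrow> bool" where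
  "submodQ A \<longleftrightarrow> 0 \<in> A \<and> (\<forall>x\<in>A. \<forall>y\<in>A. x + y \<in> A) \<and> (\<forall>r. \<forall>x\<in>A. emb r * x \<in> A)"

definition cos :: "'a::idom fract set \<Rightarrow> 'a fract \<Rightarrow> 'a fract set" where
  "cos A x = {x + a | a. a \<in> A}"

definition qcar :: "'a::idom fract set \<Rightarrow> 'a fract set \<Rightarrow> 'a fract set set" where
  "qcar J A = cos A ` J"

definition qadd :: "'a::idom fract set \<Rightarrow> 'a fract set \<Rightarrow> 'a fract set" where
  "qadd X Y = {x + y | x y. x \<in> X \<and> y \<in> Y}"

definition qsmul :: "'a::idom fract set \<Rightarrow> 'a \<Rightarrow> 'a fract set \<Rightarrow> 'a fract set" where
  "qsmul A r X = {emb r * x + a | x a. x \<in> X \<and> a \<in> A}"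

definition rmodule ::
  "'m set \<Rightarrow> ('m \<Rightarrow> 'm \<Rightarrow> 'm) \<Rightarrow> 'm \<Rightarrow> ('a::comm_ring_1 \<Rightarrow> 'm \<Rightarrow> 'm) \<Rightarrow> bool" where
  "rmodule U add z smul \<longleftrightarrow>
     z \<in> U \<and>
     (\<forall>u\<in>U. \<forall>v\<in>U. add u v \<in> U) \<and>
     (\<forall>r. \<forall>u\<in>U. smul r u \<in> U) \<and>
     (\<forall>u\<in>U. \<forall>v\<in>U. \<forall>w\<in>U. add (add u v) w = add u (add v w)) \<and>
     (\<forall>u\<in>U. \<forall>v\<in>U. add u v = add v u) \<and>
     (\<forall>u\<in>U. add z u = u) \<and>
     (\<forall>u\<in>U. \<exists>v\<in>U. add u v = z) \<and>
     (\<forall>r. \<forall>u\<in>U. \<forall>v\<in>U. smul r (add u v) = add (smul r u) (smul r v)) \<and>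
     (\<forall>r s. \<forall>u\<in>U. smul (r + s) u = add (smul r u) (smul s u)) \<and>
     (\<forall>r s. \<forall>u\<in>U. smul (r * s) u = smul r (smul s u)) \<and>
     (\<forall>u\<in>U. smul 1 u = u)"

definition submodule ::
  "'m set \<Rightarrow> 'm set \<Rightarrow> ('m \<Rightarrow> 'm \<Rightarrow> 'm) \<Rightarrow> 'm \<Rightarrow> ('a::comm_ring_1 \<Rightarrow> 'm \<Rightarrow> 'm) \<Rightarrow> bool" where
  "submodule V U add z smul \<longleftrightarrow>
     V \<subseteq> U \<and> z \<in> V \<and> (\<forall>u\<in>V. \<forall>v\<in>V. add u v \<in> V) \<and> (\<forall>r. \<forall>u\<in>V. smul r u \<in> V)"

definition uniserial ::
  "'m set \<Rightarrow> ('m \<Rightarrow> 'm \<Rightarrow> 'm) \<Rightarrow> 'm \<Rightarrow> ('a::comm_ring_1 \<Rightarrow> 'm \<Rightarrow> 'm) \<Rightarrow> bool" where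
  "uniserial U add z smul \<longleftrightarrow>
     (\<forall>V W. submodule V U add z smul \<longrightarrow> submodule W U add z smul \<longrightarrow> V \<subseteq> W \<or> W \<subseteq> V)"

definition miso ::
  "'m set \<Rightarrow> ('m \<Rightarrow> 'm \<Rightarrow> 'm) \<Rightarrow> ('a::comm_ring_1 \<Rightarrow> 'm \<Rightarrow> 'm) \<Rightarrow>
   'n set \<Rightarrow> ('n \<Rightarrow> 'n \<Rightarrow> 'n) \<Rightarrow> ('a \<Rightarrow> 'n \<Rightarrow> 'n) \<Rightarrow> bool" where
  "miso U1 add1 smul1 U2 add2 smul2 \<longleftrightarrow>
     (\<exists>\<phi>. bij_betw \<phi> U1 U2 \<and>
          (\<forall>u\<in>U1. \<forall>v\<in>U1. \<phi> (add1 u v) = add2 (\<phi> u) (\<phi> v)) \<and>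
          (\<forall>r. \<forall>u\<in>U1. \<phi> (smul1 r u) = smul2 r (\<phi> u)))"

definition iso_to_quot ::
  "'m set \<Rightarrow> ('m \<Rightarrow> 'm \<Rightarrow> 'm) \<Rightarrow> ('a::idom \<Rightarrow> 'm \<Rightarrow> 'm) \<Rightarrow> 'a fract set \<Rightarrow> 'a fract set \<Rightarrow> bool" where
  "iso_to_quot U add smul J A \<longleftrightarrow> miso U add smul (qcar J A) qadd (qsmul A)"

definition standard ::
  "'m set \<Rightarrow> ('m \<Rightarrow> 'm \<Rightarrow> 'm) \<Rightarrow> 'm \<Rightarrow> ('a::idom \<Rightarrow> 'm \<Rightarrow> 'm) \<Rightarrow> bool" where
  "standard U add z smul \<longleftrightarrow>
     (\<exists>J A. submodQ A \<and> submodQ J \<and> A \<subseteq> J \<and> iso_to_quot U add smul J A)"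

definition Ann :: "('a::idom \<Rightarrow> 'm \<Rightarrow> 'm) \<Rightarrow> 'm \<Rightarrow> 'm \<Rightarrow> 'a set" where
  "Ann smul z a = {r. smul r a = z}"

definition Dset :: "'m set \<Rightarrow> ('a::idom \<Rightarrow> 'm \<Rightarrow> 'm) \<Rightarrow> 'm \<Rightarrow> 'a fract set" where
  "Dset U smul a = (\<Union>r \<in> {r. r \<noteq> 0 \<and> a \<in> smul r ` U}. {Fract x r | x. True})"

definition has_type ::
  "'m set \<Rightarrow> ('m \<Rightarrow> 'm \<Rightarrow> 'm) \<Rightarrow> 'm \<Rightarrow> ('a::idom \<Rightarrow> 'm \<Rightarrow> 'm) \<Rightarrow> 'a fract set \<Rightarrow> 'a fract set \<Rightarrow> bool" where
  "has_type U add z smul J A \<longleftrightarrow>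
     (\<exists>a\<in>U. a \<noteq> z \<and>
        iso_to_quot (qcar J A) qadd (qsmul A) (Dset U smul a) (emb ` Ann smul z a))"

abbreviation omega1 :: "(nat set \<times> nat set) set" where
  "omega1 \<equiv> cardSuc natLeq"

definition olt :: "nat set \<Rightarrow> nat set \<Rightarrow> bool" where
  "olt s t \<longleftrightarrow> (s, t) \<in> omega1 \<and> s \<noteq> t"

definition is_limit :: "nat set \<Rightarrow> bool" where
  "is_limit d \<longleftrightarrow> d \<in> Field omega1 \<and> (\<exists>s. olt s d) \<and> (\<forall>s. olt s d \<longrightarrow> (\<exists>t. olt s t \<and> olt t d))"

definition cub :: "nat set set \<Rightarrow> bool" where
  "cub C \<longleftrightarrow> C \<subseteq> Field omega1 \<and>
     (\<forall>s\<in>Field omega1. \<exists>t\<in>C. olt s t) \<and>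
     (\<forall>d. is_limit d \<longrightarrow> (\<forall>s. olt s d \<longrightarrow> (\<exists>t\<in>C. olt s t \<and> olt t d)) \<longrightarrow> d \<in> C)"

definition rep_of :: "'a::idom fract set \<Rightarrow> (nat set \<Rightarrow> 'a) \<Rightarrow> bool" where
  "rep_of J r \<longleftrightarrow>
     (\<forall>s\<in>Field omega1. r s \<noteq> 0) \<and>
     (\<forall>s t. t \<in> Field omega1 \<longrightarrow> s \<in> Field omega1 \<longrightarrow> olt t s \<longrightarrow> r t dvd r s) \<and>
     J = (\<Union>s\<in>Field omega1. {Fract x (r s) | x. True})"

text \<open>Completeness of R / (\<Inter>_{\<sigma><\<delta>} r_\<sigma> R) in the (metrizable) linear topology with
  basic neighbourhoods of 0 the images of r_\<sigma> R, \<sigma> < \<delta>: every Cauchy sequence converges.\<close>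
definition quot_complete :: "(nat set \<Rightarrow> 'a::idom) \<Rightarrow> nat set \<Rightarrow> bool" where
  "quot_complete r d \<longleftrightarrow>
     (\<forall>x :: nat \<Rightarrow> 'a.
        (\<forall>s. olt s d \<longrightarrow> (\<exists>N. \<forall>m\<ge>N. \<forall>n\<ge>N. r s dvd (x m - x n))) \<longrightarrow>
        (\<exists>y. \<forall>s. olt s d \<longrightarrow> (\<exists>N. \<forall>n\<ge>N. r s dvd (x n - y))))"

definition Gamma_set :: "(nat set \<Rightarrow> 'a::idom) \<Rightarrow> nat set set" where
  "Gamma_set r = {d. is_limit d \<and> \<not> quot_complete r d}"

text \<open>Gamma(J/R) = 1 in D(omega_1): the set S contains a cub (S independent of the representation).\<close>
definition Gamma_is_one :: "'a::idom fract set \<Rightarrow> bool" where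
  "Gamma_is_one J \<longleftrightarrow> (\<exists>r. rep_of J r \<and> (\<exists>C. cub C \<and> C \<subseteq> Gamma_set r))"

end

theory Submission
  imports Defs "HOL-Library.Countable_Set"
begin

text \<open>Write \<open>J\<close> as the union of the \<open>(r \<sigma>)\<^sup>-\<^sup>1 R\<close>. A family of units \<open>e \<sigma> \<tau>\<close> (\<open>\<tau> \<le> \<sigma>\<close>) with
  \<open>e \<rho> \<tau> \<equiv> e \<rho> \<sigma> * e \<sigma> \<tau>\<close> modulo \<open>r \<tau>\<close> twists the transition maps between the cyclic modules
  \<open>R / r \<tau> R\<close>; the direct limit is uniserial of type \<open>J/R\<close>, and it is standard only if some units
  \<open>c \<tau>\<close> satisfy \<open>c \<tau> \<equiv> c \<sigma> * e \<sigma> \<tau>\<close> modulo \<open>r \<tau>\<close>. So a cocycle without such a trivialization is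
  needed, and there are three ways to get one.

  If \<open>2 ^ \<aleph>\<^sub>0 = \<aleph>\<^sub>1\<close>, incompleteness at each \<open>\<delta>\<close> in a cub gives two extensions of the cocycle to
  \<open>\<delta>\<close> such that a trivialization below \<open>\<delta>\<close> extends to at most one of them; the Devlin--Shelah weak
  diamond argument then yields a nontrivial cocycle. If \<open>2 ^ \<aleph>\<^sub>0 > \<aleph>\<^sub>1\<close> and the quotients
  \<open>r \<tau> R / r \<sigma> R\<close> are uncountable for suitable \<open>\<sigma> > \<tau>\<close>, then at each limit \<open>\<delta>\<close> there are continuum
  many extensions, one of which is not a unit multiple of anything representable in the \<open>\<delta>\<close>-th stage
  of a filtration of \<open>R\<close> by countable sets. If finally these quotients are eventually countable, a
  cocycle is built as a special Aronszajn tree is.\<close>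

section \<open>The ordinal \<open>\<omega>\<^sub>1\<close> as a well-ordered type\<close>

text \<open>The weak diamond needs 2 ^ \<aleph>0 < 2 ^ \<aleph>1, which ZFC does not prove outright
  but which follows by Cantor from 2 ^ \<aleph>0 = \<aleph>1; hence the case split, decided by
  whether \<open>nat set\<close> injects into R. As \<Gamma> = 1 gives incompleteness on a whole
  cub, the coding argument can run along that cub itself. Without such an injection two subsets of
  the naturals must receive the same unit, and this pigeonhole replaces guessing; it has to dodge a
  countable set of ring elements, so it needs uncountable quotients. With countable quotients only
  finitely many classes can be dodged at each level, and this is why the tree construction handles
  finite sets of translates. These two cases take from incompleteness that the chain of ideals never
  stabilises and reaches nonunits; they replace \<open>r\<close> by a cofinal subsequence, which
  leaves J unchanged but makes every step of the chain large. The conclusion asks for a module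
  carried by \<open>'a\<close> itself, so the elements of the limit are coded as ring elements
  through an injection of \<open>om1 \<times> 'a\<close>.\<close>

typedef om1 = "Field omega1"
proof -
  have "infinite (Field omega1)"
    using cardSuc_finite[OF natLeq_Card_order] by (simp add: Field_natLeq)
  then show ?thesis by (metis finite.emptyI ex_in_conv)
qed

lemma omega1_Well_order: "Well_order omega1"
  using cardSuc_Card_order[OF natLeq_Card_order] card_order_on_well_order_on by blast

instantiation om1 :: wellorder
begin

definition less_eq_om1 :: "om1 \<Rightarrow> om1 \<Rightarrow> bool" where
  "a \<le> b \<longleftrightarrow> (Rep_om1 a, Rep_om1 b) \<in> omega1"

definition less_om1 :: "om1 \<Rightarrow> om1 \<Rightarrow> bool" where
  "a < b \<longleftrightarrow> olt (Rep_om1 a) (Rep_om1 b)"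

instance
proof -
  note wo = omega1_Well_order[unfolded well_order_on_def linear_order_on_def partial_order_on_def
      preorder_on_def refl_on_def antisym_def trans_def total_on_def]
  have less: "a < b \<longleftrightarrow> a \<le> b \<and> a \<noteq> b" for a b :: om1
    by (auto simp: less_om1_def less_eq_om1_def olt_def Rep_om1_inject)
  have ref: "a \<le> a" for a :: om1
    using wo Rep_om1[of a] by (auto simp: less_eq_om1_def)
  have tr: "a \<le> b \<Longrightarrow> b \<le> c \<Longrightarrow> a \<le> c" for a b c :: om1
    using wo unfolding less_eq_om1_def by blast
  have as: "a \<le> b \<Longrightarrow> b \<le> a \<Longrightarrow> a = b" for a b :: om1
    using wo unfolding less_eq_om1_def Rep_om1_inject[symmetric] by blast
  have tot: "a \<le> b \<or> b \<le> a" for a b :: om1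
    using wo Rep_om1[of a] Rep_om1[of b] ref unfolding less_eq_om1_def
    by (metis Rep_om1_inject)
  have "wf {(a, b :: om1). a < b}"
  proof (rule wf_subset)
    show "wf (inv_image (omega1 - Id) Rep_om1)"
      using omega1_Well_order by (auto simp: well_order_on_def)
    show "{(a, b). a < b} \<subseteq> inv_image (omega1 - Id) Rep_om1"
      by (auto simp: less_om1_def olt_def)
  qed
  note wf = this
  have ind: "P a" if step: "\<And>x. (\<And>y. y < x \<Longrightarrow> P y) \<Longrightarrow> P x" for P and a :: om1
    using wf by (induct a rule: wf_induct_rule) (rule step, simp)
  show "OFCLASS(om1, wellorder_class)"
  proof
    fix a b c :: om1
    show "a < b \<longleftrightarrow> a \<le> b \<and> \<not> b \<le> a" using less as ref by blast
    show "a \<le> a" by (rule ref)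
    show "a \<le> b \<Longrightarrow> b \<le> c \<Longrightarrow> a \<le> c" by (rule tr)
    show "a \<le> b \<Longrightarrow> b \<le> a \<Longrightarrow> a = b" by (rule as)
    show "a \<le> b \<or> b \<le> a" by (rule tot)
    show "P a" if step: "\<And>x. (\<And>y. y < x \<Longrightarrow> P y) \<Longrightarrow> P x" for P
      by (rule ind) (rule step)
  qed
qed

end

lemma om1_bij: "bij_betw Rep_om1 UNIV (Field omega1)"
  unfolding bij_betw_def using type_definition.Rep_range[OF type_definition_om1]
  by (auto simp: inj_on_def Rep_om1_inject)

lemma omega1_card: "(card_of (Field omega1), omega1) \<in> ordIso"
  by (rule card_of_Field_ordIso) (rule cardSuc_Card_order[OF natLeq_Card_order])

lemma om1_card: "(card_of (UNIV :: om1 set), omega1) \<in> ordIso"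
  using om1_bij omega1_card card_of_ordIso ordIso_transitive by blast

lemma uncountable_om1: "uncountable (UNIV :: om1 set)"
proof
  assume "countable (UNIV :: om1 set)"
  then have "(card_of (UNIV :: om1 set), natLeq) \<in> ordLeq"
    unfolding countable_def using card_of_ordLeqI card_of_nat ordLeq_ordIso_trans by (metis UNIV_I)
  then have "(omega1, natLeq) \<in> ordLeq"
    using om1_card ordIso_ordLeq_trans ordIso_symmetric by blast
  then show False
    using cardSuc_greater[OF natLeq_Card_order] not_ordLess_ordLeq by blast
qed

text \<open>A proper initial segment of a cardinal is strictly smaller than it, and below the
  successor of \<open>natLeq\<close> this means at most \<open>natLeq\<close>.\<close>

lemma countable_lessThan_om1: "countable {..<a :: om1}"
proof -
  have "(card_of (underS omega1 (Rep_om1 a)), omega1) \<in> ordLess"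
    by (rule card_of_underS) (auto simp: cardSuc_Card_order[OF natLeq_Card_order] Rep_om1)
  then have "(card_of (underS omega1 (Rep_om1 a)), natLeq) \<in> ordLeq"
    by (rule iffD1[OF cardSuc_ordLeq_ordLess[OF natLeq_Card_order card_of_Card_order]])
  then have "(card_of (underS omega1 (Rep_om1 a)), card_of (UNIV :: nat set)) \<in> ordLeq"
    using card_of_nat ordIso_symmetric ordLeq_ordIso_trans by blast
  then have "countable (underS omega1 (Rep_om1 a))"
    unfolding card_of_ordLeq[symmetric] countable_def by blast
  moreover have "Rep_om1 ` {..<a} \<subseteq> underS omega1 (Rep_om1 a)"
    by (auto simp: less_om1_def olt_def underS_def)
  ultimately have "countable (Rep_om1 ` {..<a})"
    by (rule countable_subset[rotated])
  then show ?thesis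
    by (rule countable_image_inj_on) (simp add: inj_on_def Rep_om1_inject)
qed

text \<open>Regularity of \<omega>1: an unbounded countable set would cover the uncountable type by
  countably many countable segments.\<close>

lemma countable_bounded_om1:
  assumes "countable A"
  shows "\<exists>b :: om1. \<forall>a\<in>A. a < b"
proof (rule ccontr)
  assume "\<not> ?thesis"
  then have "\<forall>b. \<exists>a\<in>A. b \<le> a" by (meson not_less)
  then have "UNIV \<subseteq> (\<Union>a\<in>A. {..<a} \<union> {a})" by (auto simp: le_less)
  moreover have "countable (\<Union>a\<in>A. {..<a} \<union> {a})"
    using assms countable_lessThan_om1 by (auto intro: countable_Un)
  ultimately show False using uncountable_om1 countable_subset by blast
qed

lemma gt_ex_om1: "\<exists>b. (a :: om1) < b"
  using countable_bounded_om1[of "{a}"] by auto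

text \<open>Masking with \<open>undefined\<close> makes the argument of \<open>\<Phi>\<close> depend
  on \<open>E\<close> below \<delta> only, so that two recursions with equal initial parts can be
  compared.\<close>

lemma wfrec_om1:
  fixes \<Phi> :: "om1 \<Rightarrow> (om1 \<Rightarrow> 'b) \<Rightarrow> 'b"
  obtains E where "\<And>\<delta>. E \<delta> = \<Phi> \<delta> (\<lambda>\<sigma>. if \<sigma> < \<delta> then E \<sigma> else undefined)"
proof
  fix \<delta>
  have "wf {(x, y :: om1). x < y}" by (rule wf)
  from wfrec[OF this, of "\<lambda>E \<delta>. \<Phi> \<delta> E" \<delta>]
  show "wfrec {(x, y). x < y} (\<lambda>E \<delta>. \<Phi> \<delta> E) \<delta>
      = \<Phi> \<delta> (\<lambda>\<sigma>. if \<sigma> < \<delta> then wfrec {(x, y). x < y} (\<lambda>E \<delta>. \<Phi> \<delta> E) \<sigma> else undefined)"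
    by (simp add: cut_def)
qed

definition limit_om1 :: "om1 \<Rightarrow> bool" where
  "limit_om1 \<delta> \<longleftrightarrow> (\<exists>\<sigma>. \<sigma> < \<delta>) \<and> (\<forall>\<sigma><\<delta>. \<exists>\<tau>. \<sigma> < \<tau> \<and> \<tau> < \<delta>)"

lemma om1_cases:
  fixes \<delta> :: om1
  obtains (least) "\<And>\<sigma>. \<not> \<sigma> < \<delta>"
    | (succ) \<beta> where "\<beta> < \<delta>" "\<And>\<sigma>. \<sigma> < \<delta> \<longleftrightarrow> \<sigma> \<le> \<beta>"
    | (limit) "limit_om1 \<delta>"
proof (cases "\<exists>\<beta><\<delta>. \<forall>\<tau>. \<beta> < \<tau> \<longrightarrow> \<not> \<tau> < \<delta>")
  case True
  then obtain \<beta> where b: "\<beta> < \<delta>" "\<And>\<tau>. \<beta> < \<tau> \<Longrightarrow> \<not> \<tau> < \<delta>" by blast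
  have "\<sigma> < \<delta> \<longleftrightarrow> \<sigma> \<le> \<beta>" for \<sigma> using b by (meson le_less_trans not_less)
  then show ?thesis using succ b by blast
next
  case False
  then show ?thesis using least limit unfolding limit_om1_def by blast
qed

definition ladder :: "om1 \<Rightarrow> (nat \<Rightarrow> om1) \<Rightarrow> bool" where
  "ladder \<delta> d \<longleftrightarrow> strict_mono d \<and> (\<forall>n. d n < \<delta>) \<and> (\<forall>\<sigma><\<delta>. \<exists>n. \<sigma> < d n)"

lemma ladderD:
  assumes "ladder \<delta> d"
  shows "d n < \<delta>" "\<sigma> < \<delta> \<Longrightarrow> \<exists>n. \<sigma> < d n" "d n \<le> d m \<longleftrightarrow> n \<le> m" "d n < d m \<longleftrightarrow> n < m"
  using assms by (auto simp: ladder_def strict_mono_less_eq strict_mono_less)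

text \<open>An enumeration of the countable segment below \<delta> is overtaken one element at a
  time, which makes the sequence cofinal.\<close>

lemma ladder_exists:
  assumes "limit_om1 \<delta>"
  shows "\<exists>d. ladder \<delta> d"
proof -
  have ne: "{..<\<delta>} \<noteq> {}" using assms by (auto simp: limit_om1_def)
  define q where "q = from_nat_into {..<\<delta>}"
  have q: "range q = {..<\<delta>}"
    unfolding q_def by (rule range_from_nat_into[OF ne countable_lessThan_om1])
  have step: "\<exists>y. y < \<delta> \<and> x < y \<and> q n < y" if "x < \<delta>" for x n
  proof -
    have "max x (q n) < \<delta>" using that q by auto
    then show ?thesis using assms unfolding limit_om1_def by (metis max_less_iff_conj)
  qed
  obtain d where d: "\<And>n. d n < \<delta> \<and> d n < d (Suc n) \<and> q n < d (Suc n)"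
    using dependent_nat_choice[of "\<lambda>_ x. x < \<delta>" "\<lambda>n x y. x < y \<and> q n < y"] ne step by blast
  show ?thesis unfolding ladder_def
  proof (rule exI[of _ d], intro conjI allI impI)
    show "strict_mono d" by (simp add: strict_mono_Suc_iff d)
    show "d n < \<delta>" for n using d by blast
    show "\<exists>n. \<sigma> < d n" if "\<sigma> < \<delta>" for \<sigma> 
    proof -
      have "\<sigma> \<in> range q" using that q by simp
      then show ?thesis using d by blast
    qed
  qed
qed

text \<open>Closing off \<omega> times: each step exceeds the countably many values of
  \<open>h\<close> met so far, and the supremum of the steps is a closure point.\<close>

lemma limit_om1_closure:
  fixes h :: "om1 \<Rightarrow> om1"
  shows "\<exists>\<delta>. limit_om1 \<delta> \<and> (\<forall>\<tau><\<delta>. h \<tau> < \<delta>)"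
proof -
  have step: "\<exists>y. x < y \<and> (\<forall>\<tau>\<le>x. h \<tau> < y)" for x
  proof -
    have "countable (insert x (h ` ({..<x} \<union> {x})))"
      using countable_lessThan_om1 by (intro countable_insert countable_image countable_Un) auto
    from countable_bounded_om1[OF this] show ?thesis by (auto simp: le_less)
  qed
  obtain d where d: "\<And>n. d n < d (Suc n) \<and> (\<forall>\<tau>\<le>d n. h \<tau> < d (Suc n))"
    using dependent_nat_choice[of "\<lambda>_ _. True" "\<lambda>_ x y. x < y \<and> (\<forall>\<tau>\<le>x. h \<tau> < y)"] step
    by blast
  define \<delta> where "\<delta> = (LEAST b. \<forall>n. d n < b)"
  have "\<exists>b. \<forall>n. d n < b" using countable_bounded_om1[of "range d"] by auto
  then have ub: "d n < \<delta>" for n unfolding \<delta>_def by (rule LeastI2_ex) auto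
  have cof: "\<exists>n. \<sigma> \<le> d n" if "\<sigma> < \<delta>" for \<sigma>
    using not_less_Least[OF that[unfolded \<delta>_def]] by (auto simp: not_less)
  have "limit_om1 \<delta>" unfolding limit_om1_def using ub cof d by (meson order.strict_trans1)
  moreover have "h \<tau> < \<delta>" if "\<tau> < \<delta>" for \<tau>
    using cof[OF that] d ub by (meson order.strict_trans)
  ultimately show ?thesis by blast
qed

section \<open>Cocycles of units and their direct limits\<close>

lemma emb_simps [simp]:
  "emb 0 = 0" "emb 1 = 1" "emb (x + y) = emb x + emb y" "emb (x - y) = emb x - emb y"
  "emb (- x) = - emb x" "emb (x * y) = emb x * emb y"
  by (simp_all add: emb_def Zero_fract_def One_fract_def)

lemma emb_eq_iff [simp]: "emb x = emb y \<longleftrightarrow> x = y"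
  by (simp add: emb_def eq_fract)

lemma emb_eq_0_iff [simp]: "emb x = 0 \<longleftrightarrow> x = 0"
  using emb_eq_iff[of x 0] by simp

lemma Fract_eq_emb_divide: "Fraction_Field.Fract x y = emb x / emb y"
  by (cases "y = 0") (simp_all add: emb_def eq_fract fract_collapse)

lemma fract_eq_emb_divide: "\<exists>a b. b \<noteq> 0 \<and> q = emb a / emb b"
  by (cases q) (auto simp: Fract_eq_emb_divide)

lemma emb_divide_in_range_iff:
  assumes "y \<noteq> 0"
  shows "emb x / emb y \<in> range emb \<longleftrightarrow> y dvd x"
proof -
  have "emb x / emb y = emb z \<longleftrightarrow> x = y * z" for z
  proof -
    have "emb x / emb y = emb z \<longleftrightarrow> emb x = emb (y * z)"
      using assms by (simp add: divide_eq_eq mult.commute)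
    then show ?thesis by (simp only: emb_eq_iff)
  qed
  then show ?thesis by (auto simp: dvd_def image_iff)
qed

abbreviation invertible :: "'a::comm_ring_1 \<Rightarrow> bool" where
  "invertible u \<equiv> u dvd 1"

lemma invertible_mult_dvd_iff:
  fixes u :: "'a::idom"
  assumes "invertible u"
  shows "a dvd u * b \<longleftrightarrow> a dvd b" "a dvd b * u \<longleftrightarrow> a dvd b" "u * a dvd b \<longleftrightarrow> a dvd b"
proof -
  obtain v where v: "u * v = 1" using assms by (auto simp: dvd_def)
  have b: "v * (u * c) = c" for c
    using v by (simp add: mult.assoc[symmetric] mult.commute[of v u])
  show 1: "a dvd u * b \<longleftrightarrow> a dvd b"
    using dvd_mult[of a "u * b" v] b[of b] by auto
  then show "a dvd b * u \<longleftrightarrow> a dvd b" by (simp add: mult.commute)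
  show "u * a dvd b \<longleftrightarrow> a dvd b"
  proof
    assume "u * a dvd b" then show "a dvd b" by (rule dvd_mult_right)
  next
    assume "a dvd b"
    then have "u * a dvd u * (v * b)" by (intro mult_dvd_mono) auto
    moreover have "u * (v * b) = b" using v by (simp add: mult.assoc[symmetric])
    ultimately show "u * a dvd b" by simp
  qed
qed

locale valuation_chain =
  fixes r :: "om1 \<Rightarrow> 'a::idom"
  assumes dvd_total: "\<And>a b :: 'a. a dvd b \<or> b dvd a"
    and r_nonzero [simp]: "r \<sigma> \<noteq> 0"
    and r_dvd: "\<tau> \<le> \<sigma> \<Longrightarrow> r \<tau> dvd r \<sigma>"
begin

text \<open>R is local: of \<open>x\<close> and \<open>1 + x\<close> one divides the other, hence
  also their difference 1.\<close>

lemma unit_1_plus: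
  assumes "\<not> invertible (x :: 'a)"
  shows "invertible (1 + x)"
  using dvd_total[of x "1 + x"]
proof
  assume "x dvd 1 + x"
  then have "x dvd 1" using dvd_add_left_iff[of x x 1] by simp
  then show ?thesis using assms by simp
next
  assume "1 + x dvd x"
  then show ?thesis using dvd_add_left_iff[of "1 + x" x 1] by simp
qed

lemma unit_cong:
  assumes "\<not> invertible (a :: 'a)" "invertible x" "a dvd y - x"
  shows "invertible y"
proof -
  obtain v where v: "1 = x * v" using assms(2) by (auto simp: dvd_def)
  have "a dvd v * (y - x)" using assms(3) by simp
  then have "\<not> invertible (v * (y - x))" using assms(1) dvd_trans by blast
  then have "invertible (1 + v * (y - x))" by (rule unit_1_plus)
  also have "1 + v * (y - x) = v * y" using v by (simp add: algebra_simps)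
  finally show ?thesis by (rule dvd_mult_right)
qed

definition cocycle :: "(om1 \<Rightarrow> om1 \<Rightarrow> 'a) \<Rightarrow> bool" where
  "cocycle e \<longleftrightarrow> (\<forall>\<sigma>. e \<sigma> \<sigma> = 1) \<and> (\<forall>\<sigma> \<tau>. \<tau> \<le> \<sigma> \<longrightarrow> invertible (e \<sigma> \<tau>)) \<and>
     (\<forall>\<rho> \<sigma> \<tau>. \<tau> \<le> \<sigma> \<longrightarrow> \<sigma> \<le> \<rho> \<longrightarrow> r \<tau> dvd e \<rho> \<tau> - e \<rho> \<sigma> * e \<sigma> \<tau>)"

definition trivializes :: "(om1 \<Rightarrow> 'a) \<Rightarrow> (om1 \<Rightarrow> om1 \<Rightarrow> 'a) \<Rightarrow> bool" where
  "trivializes c e \<longleftrightarrow> (\<forall>\<sigma>. invertible (c \<sigma>)) \<and> (\<forall>\<sigma> \<tau>. \<tau> \<le> \<sigma> \<longrightarrow> r \<tau> dvd c \<tau> - c \<sigma> * e \<sigma> \<tau>)"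

text \<open>The module attached to a cocycle is the direct limit of the cyclic modules \<open>R / r \<tau> R\<close>, with
  transition map \<open>x \<mapsto> x * e \<sigma> \<tau> * (r \<sigma> / r \<tau>)\<close> from stage \<open>\<tau>\<close> to stage \<open>\<sigma>\<close>; \<open>B \<tau> x\<close> is the image of
  \<open>x\<close> at stage \<open>\<tau>\<close>. It is realised by threads in \<open>Q\<close> modulo threads that are eventually in \<open>R\<close>.\<close>

lemma limit_module_exists:
  assumes e: "cocycle e" and inj: "inj (\<kappa> :: om1 \<times> 'a \<Rightarrow> 'a)"
  shows "\<exists>(B :: om1 \<Rightarrow> 'a \<Rightarrow> 'a) add smul.
     (\<forall>\<tau> x y. B \<tau> x = B \<tau> y \<longleftrightarrow> r \<tau> dvd x - y) \<and>
     (\<forall>\<tau> \<sigma> k x. \<tau> \<le> \<sigma> \<longrightarrow> r \<sigma> = r \<tau> * k \<longrightarrow> B \<tau> x = B \<sigma> (x * e \<sigma> \<tau> * k)) \<and>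
     (\<forall>\<tau> x y. add (B \<tau> x) (B \<tau> y) = B \<tau> (x + y)) \<and>
     (\<forall>\<tau> s x. smul s (B \<tau> x) = B \<tau> (s * x))"
proof -
  \<comment> \<open>The thread of \<open>x\<close> at stage \<tau> is the fraction
    \<open>x / r \<tau>\<close>, twisted at coordinate \<sigma> by \<open>e \<sigma> \<tau>\<close>.
    Coordinates below \<tau> carry junk, which \<open>eqv\<close> ignores because it looks at late
    coordinates only.\<close>
  define th :: "om1 \<times> 'a \<Rightarrow> om1 \<Rightarrow> 'a fract" where
    "th p \<sigma> = emb (e \<sigma> (fst p)) * (emb (snd p) / emb (r (fst p)))" for p \<sigma>
  define eqv :: "(om1 \<Rightarrow> 'a fract) \<Rightarrow> (om1 \<Rightarrow> 'a fract) \<Rightarrow> bool" where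
    "eqv F G \<longleftrightarrow> (\<exists>\<sigma>0. \<forall>\<sigma>\<ge>\<sigma>0. F \<sigma> - G \<sigma> \<in> range emb)" for F G
  have eqv_refl: "eqv F F" for F
    unfolding eqv_def by (auto simp: image_iff intro: exI[of _ 0])
  have eqv_sym: "eqv G F" if "eqv F G" for F G
  proof -
    have "G \<sigma> - F \<sigma> \<in> range emb" if h: "F \<sigma> - G \<sigma> \<in> range emb" for \<sigma>
    proof -
      obtain x where "F \<sigma> - G \<sigma> = emb x" using h by auto
      then have "G \<sigma> - F \<sigma> = emb (- x)" by (simp add: algebra_simps)
      then show ?thesis by blast
    qed
    then show ?thesis using \<open>eqv F G\<close> unfolding eqv_def by blast
  qed
  have eqv_add: "eqv (\<lambda>\<sigma>. F \<sigma> + F' \<sigma>) (\<lambda>\<sigma>. G \<sigma> + G' \<sigma>)" if "eqv F G" "eqv F' G'" for F G F' G'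
  proof -
    from that obtain a b where
      a: "\<And>\<sigma>. a \<le> \<sigma> \<Longrightarrow> F \<sigma> - G \<sigma> \<in> range emb" and b: "\<And>\<sigma>. b \<le> \<sigma> \<Longrightarrow> F' \<sigma> - G' \<sigma> \<in> range emb"
      unfolding eqv_def by blast
    have "F \<sigma> + F' \<sigma> - (G \<sigma> + G' \<sigma>) \<in> range emb" if "max a b \<le> \<sigma>" for \<sigma>
    proof -
      obtain x y where "F \<sigma> - G \<sigma> = emb x" "F' \<sigma> - G' \<sigma> = emb y"
        using a[of \<sigma>] b[of \<sigma>] \<open>max a b \<le> \<sigma>\<close> by auto
      then have "F \<sigma> + F' \<sigma> - (G \<sigma> + G' \<sigma>) = emb (x + y)" by (simp add: algebra_simps)
      then show ?thesis by blast
    qed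
    then show ?thesis unfolding eqv_def by blast
  qed
  have eqv_smul: "eqv (\<lambda>\<sigma>. emb s * F \<sigma>) (\<lambda>\<sigma>. emb s * G \<sigma>)" if "eqv F G" for F G s
  proof -
    have "emb s * F \<sigma> - emb s * G \<sigma> \<in> range emb" if h: "F \<sigma> - G \<sigma> \<in> range emb" for \<sigma>
    proof -
      obtain x where "F \<sigma> - G \<sigma> = emb x" using h by auto
      then have "emb s * F \<sigma> - emb s * G \<sigma> = emb (s * x)" by (simp add: right_diff_distrib[symmetric])
      then show ?thesis by blast
    qed
    then show ?thesis using \<open>eqv F G\<close> unfolding eqv_def by blast
  qed
  have eqv_trans: "eqv F H" if "eqv F G" "eqv G H" for F G H
  proof -
    have "eqv (\<lambda>\<sigma>. F \<sigma> + G \<sigma>) (\<lambda>\<sigma>. G \<sigma> + H \<sigma>)" using that by (rule eqv_add)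
    then show ?thesis unfolding eqv_def by (simp add: algebra_simps)
  qed
  \<comment> \<open>The class of a thread is named by the \<kappa>-code of one chosen representing
    pair; this is what puts the limit on the type \<open>'a\<close>.\<close>
  define \<phi> where "\<phi> F = \<kappa> (SOME p. eqv F (th p))" for F
  have \<phi>_eq: "\<phi> F = \<phi> G" if "eqv F G" for F G
  proof -
    have "(\<lambda>p. eqv F (th p)) = (\<lambda>p. eqv G (th p))"
      using that eqv_trans eqv_sym by blast
    then show ?thesis by (simp add: \<phi>_def)
  qed
  have \<phi>_th: "eqv F (th p)" if "\<phi> F = \<phi> (th p)" "eqv F (th q)" for F p q
  proof -
    let ?a = "SOME q. eqv F (th q)" and ?b = "SOME q. eqv (th p) (th q)"
    have "?a = ?b" using that(1) inj by (simp add: \<phi>_def inj_eq)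
    moreover have "eqv F (th ?a)" using that(2) by (rule someI)
    moreover have "eqv (th p) (th ?b)" using eqv_refl by (rule someI)
    ultimately show ?thesis using eqv_trans[of F "th ?a" "th p"] eqv_sym[of "th p" "th ?b"] by simp
  qed
  define B where "B \<tau> x = \<phi> (th (\<tau>, x))" for \<tau> x
  define \<psi> where "\<psi> u = th (SOME p. u = \<phi> (th p))" for u
  have \<psi>: "eqv (\<psi> (B \<tau> x)) (th (\<tau>, x))" for \<tau> x
  proof -
    have "B \<tau> x = \<phi> (\<psi> (B \<tau> x))" unfolding \<psi>_def by (rule someI[of _ "(\<tau>, x)"]) (simp add: B_def)
    then have "\<phi> (\<psi> (B \<tau> x)) = \<phi> (th (\<tau>, x))" by (simp add: B_def)
    moreover have "eqv (\<psi> (B \<tau> x)) (th (SOME p. B \<tau> x = \<phi> (th p)))"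
      unfolding \<psi>_def by (rule eqv_refl)
    ultimately show ?thesis by (rule \<phi>_th)
  qed
  have "B \<tau> x = B \<tau> y \<longleftrightarrow> r \<tau> dvd x - y" for \<tau> x y
  proof -
    have "B \<tau> x = B \<tau> y \<longleftrightarrow> eqv (th (\<tau>, x)) (th (\<tau>, y))"
      unfolding B_def using \<phi>_eq \<phi>_th eqv_refl by blast
    also have "\<dots> \<longleftrightarrow> r \<tau> dvd x - y"
    proof -
      \<comment> \<open>The twist \<open>e \<sigma> \<tau>\<close> is a unit, so membership in R
        does not depend on the coordinate \<sigma>.\<close>
      have *: "th (\<tau>, x) \<sigma> - th (\<tau>, y) \<sigma> \<in> range emb \<longleftrightarrow> r \<tau> dvd x - y" if "\<tau> \<le> \<sigma>" for \<sigma>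
      proof -
        have "th (\<tau>, x) \<sigma> - th (\<tau>, y) \<sigma> = emb (e \<sigma> \<tau> * (x - y)) / emb (r \<tau>)"
          by (simp add: th_def algebra_simps diff_divide_distrib)
        moreover have "invertible (e \<sigma> \<tau>)" using e that by (simp add: cocycle_def)
        ultimately show ?thesis
          by (simp only: emb_divide_in_range_iff r_nonzero not_False_eq_True invertible_mult_dvd_iff)
      qed
      show ?thesis unfolding eqv_def
      proof
        assume "\<exists>\<sigma>0. \<forall>\<sigma>\<ge>\<sigma>0. th (\<tau>, x) \<sigma> - th (\<tau>, y) \<sigma> \<in> range emb"
        then obtain \<sigma>0 where "\<forall>\<sigma>\<ge>\<sigma>0. th (\<tau>, x) \<sigma> - th (\<tau>, y) \<sigma> \<in> range emb" by blast
        then show "r \<tau> dvd x - y" using *[of "max \<tau> \<sigma>0"] by simp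
      qed (use * in blast)
    qed
    finally show ?thesis .
  qed
  moreover have "B \<tau> x = B \<sigma> (x * e \<sigma> \<tau> * k)" if "\<tau> \<le> \<sigma>" "r \<sigma> = r \<tau> * k" for \<tau> \<sigma> k x
    unfolding B_def
  proof (rule \<phi>_eq)
    have "th (\<tau>, x) \<rho> - th (\<sigma>, x * e \<sigma> \<tau> * k) \<rho> \<in> range emb" if "\<sigma> \<le> \<rho>" for \<rho>
    proof -
      have k: "k \<noteq> 0" using \<open>r \<sigma> = r \<tau> * k\<close> r_nonzero[of \<sigma>] by auto
      \<comment> \<open>After cancelling \<open>k\<close> only the cocycle defect over
        \<open>r \<tau>\<close> is left, and the cocycle condition says that this is
        integral.\<close>
      have "th (\<tau>, x) \<rho> - th (\<sigma>, x * e \<sigma> \<tau> * k) \<rho>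
          = emb (x * (e \<rho> \<tau> - e \<rho> \<sigma> * e \<sigma> \<tau>)) / emb (r \<tau>)"
        using k by (simp add: th_def \<open>r \<sigma> = r \<tau> * k\<close> algebra_simps diff_divide_distrib)
      moreover have "r \<tau> dvd e \<rho> \<tau> - e \<rho> \<sigma> * e \<sigma> \<tau>"
        using e \<open>\<tau> \<le> \<sigma>\<close> that by (simp add: cocycle_def)
      ultimately show ?thesis
        by (simp only: emb_divide_in_range_iff r_nonzero not_False_eq_True dvd_mult)
    qed
    then show "eqv (th (\<tau>, x)) (th (\<sigma>, x * e \<sigma> \<tau> * k))" unfolding eqv_def by blast
  qed
  moreover have "\<phi> (\<lambda>\<sigma>. \<psi> (B \<tau> x) \<sigma> + \<psi> (B \<tau> y) \<sigma>) = B \<tau> (x + y)" for \<tau> x y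
  proof -
    have "th (\<tau>, x + y) = (\<lambda>\<sigma>. th (\<tau>, x) \<sigma> + th (\<tau>, y) \<sigma>)"
      by (rule ext) (simp add: th_def algebra_simps add_divide_distrib)
    then show ?thesis using \<phi>_eq[OF eqv_add[OF \<psi> \<psi>], of \<tau> x \<tau> y] by (simp add: B_def)
  qed
  moreover have "\<phi> (\<lambda>\<sigma>. emb s * \<psi> (B \<tau> x) \<sigma>) = B \<tau> (s * x)" for \<tau> s x
  proof -
    have "th (\<tau>, s * x) = (\<lambda>\<sigma>. emb s * th (\<tau>, x) \<sigma>)"
      by (rule ext) (simp add: th_def algebra_simps)
    then show ?thesis using \<phi>_eq[OF eqv_smul[OF \<psi>], of s \<tau> x] by (simp add: B_def)
  qed
  ultimately show ?thesis
    by (intro exI[of _ B] exI[of _ "\<lambda>u v. \<phi> (\<lambda>\<sigma>. \<psi> u \<sigma> + \<psi> v \<sigma>)"]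
        exI[of _ "\<lambda>s u. \<phi> (\<lambda>\<sigma>. emb s * \<psi> u \<sigma>)"]) simp
qed

end

section \<open>Cosets in Q, and the module theory of the direct limit\<close>

lemma cos_eq_iff:
  assumes "submodQ A"
  shows "cos A p = cos A q \<longleftrightarrow> p - q \<in> A"
proof
  assume "cos A p = cos A q"
  moreover have "p \<in> cos A p" using assms by (force simp: cos_def submodQ_def)
  ultimately have "p \<in> cos A q" by simp
  then show "p - q \<in> A" by (auto simp: cos_def)
next
  assume pq: "p - q \<in> A"
  have "emb (- 1) * (p - q) \<in> A" using assms pq unfolding submodQ_def by blast
  then have qp: "q - p \<in> A" by simp
  have "cos A x \<subseteq> cos A y" if "x - y \<in> A" for x y
  proof
    fix z assume "z \<in> cos A x"
    then obtain a where "a \<in> A" "z = x + a" by (auto simp: cos_def)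
    then have "z = y + ((x - y) + a)" "(x - y) + a \<in> A"
      using that assms by (auto simp: submodQ_def)
    then show "z \<in> cos A y" unfolding cos_def by blast
  qed
  then show "cos A p = cos A q" using pq qp by blast
qed

lemma qsmul_cos:
  assumes "submodQ A"
  shows "qsmul A s (cos A q) = cos A (emb s * q)"
proof (rule set_eqI, rule iffI)
  fix z assume "z \<in> qsmul A s (cos A q)"
  then obtain a b where ab: "a \<in> A" "b \<in> A" "z = emb s * (q + a) + b"
    by (auto simp: qsmul_def cos_def)
  then have "z = emb s * q + (emb s * a + b)" by (simp add: algebra_simps)
  moreover have "emb s * a + b \<in> A" using ab assms by (simp add: submodQ_def)
  ultimately show "z \<in> cos A (emb s * q)" unfolding cos_def by blast
next
  fix z assume "z \<in> cos A (emb s * q)"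
  then obtain a where a: "a \<in> A" "z = emb s * q + a" by (auto simp: cos_def)
  moreover have "q = q + 0" "0 \<in> A" using assms by (auto simp: submodQ_def)
  then have "q \<in> cos A q" unfolding cos_def by blast
  ultimately show "z \<in> qsmul A s (cos A q)" unfolding qsmul_def by blast
qed

text \<open>All that is retained of the construction is how to compute with the images
  \<open>B \<tau> x\<close>. The stage \<theta> has a nonzero cyclic module, so
  \<open>B \<theta> 1\<close> can witness the type.\<close>

locale limit_module = valuation_chain r for r :: "om1 \<Rightarrow> 'a::idom" +
  fixes e :: "om1 \<Rightarrow> om1 \<Rightarrow> 'a" and B :: "om1 \<Rightarrow> 'a \<Rightarrow> 'm"
    and add :: "'m \<Rightarrow> 'm \<Rightarrow> 'm" and smul :: "'a \<Rightarrow> 'm \<Rightarrow> 'm" and \<theta> :: om1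
  assumes e: "cocycle e"
    and B_eq_iff: "B \<tau> x = B \<tau> y \<longleftrightarrow> r \<tau> dvd x - y"
    and B_raise: "\<tau> \<le> \<sigma> \<Longrightarrow> r \<sigma> = r \<tau> * k \<Longrightarrow> B \<tau> x = B \<sigma> (x * e \<sigma> \<tau> * k)"
    and add_B: "add (B \<tau> x) (B \<tau> y) = B \<tau> (x + y)"
    and smul_B: "smul s (B \<tau> x) = B \<tau> (s * x)"
    and nonunit: "\<not> invertible (r \<theta>)"
begin

definition U :: "'m set" where
  "U = {B \<tau> x | \<tau> x. True}"

definition zero :: 'm where
  "zero = B \<theta> 0"

lemma B_in_U [simp]: "B \<tau> x \<in> U"
  by (auto simp: U_def)

lemma U_stage: "u \<in> U \<Longrightarrow> \<exists>\<tau>. \<forall>\<sigma>\<ge>\<tau>. \<exists>x. u = B \<sigma> x"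
proof -
  assume "u \<in> U"
  then obtain \<tau> x where u: "u = B \<tau> x" by (auto simp: U_def)
  have "\<exists>x. u = B \<sigma> x" if le: "\<tau> \<le> \<sigma>" for \<sigma>
  proof -
    obtain k where "r \<sigma> = r \<tau> * k" using r_dvd[OF le] by (auto simp: dvd_def)
    then show ?thesis using B_raise[OF le] u by blast
  qed
  then show ?thesis by blast
qed

text \<open>Turns a question about finitely many elements of the limit into a computation in a
  single \<open>R / r \<tau> R\<close>; \<rho> pushes that stage as far up as desired.\<close>

lemma common_stage:
  assumes "u \<in> U" "v \<in> U" "w \<in> U"
  obtains \<tau> x y z where "\<rho> \<le> \<tau>" "u = B \<tau> x" "v = B \<tau> y" "w = B \<tau> z"
proof -
  obtain a b c where "\<And>\<sigma>. a \<le> \<sigma> \<Longrightarrow> \<exists>x. u = B \<sigma> x" "\<And>\<sigma>. b \<le> \<sigma> \<Longrightarrow> \<exists>x. v = B \<sigma> x"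
    "\<And>\<sigma>. c \<le> \<sigma> \<Longrightarrow> \<exists>x. w = B \<sigma> x"
    using U_stage assms by meson
  moreover define \<tau> where "\<tau> = max \<rho> (max a (max b c))"
  ultimately have "\<exists>x. u = B \<tau> x" "\<exists>x. v = B \<tau> x" "\<exists>x. w = B \<tau> x" "\<rho> \<le> \<tau>"
    by (auto simp: le_max_iff_disj)
  then show ?thesis using that by blast
qed

lemma zero_B: "zero = B \<tau> 0"
proof -
  have "B \<alpha> 0 = B \<beta> 0" if le: "\<alpha> \<le> \<beta>" for \<alpha> \<beta>
  proof -
    obtain k where "r \<beta> = r \<alpha> * k" using r_dvd[OF le] by (auto simp: dvd_def)
    then show ?thesis using B_raise[OF le, of k 0] by simp
  qed
  then show ?thesis unfolding zero_def by (metis linear)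
qed

lemma rmodule_U: "rmodule U add zero smul"
  unfolding rmodule_def
proof (intro conjI ballI allI)
  show "zero \<in> U" by (simp add: zero_def)
next
  fix u v w assume uvw: "u \<in> U" "v \<in> U" "w \<in> U"
  then obtain \<tau> x y z where [simp]: "u = B \<tau> x" "v = B \<tau> y" "w = B \<tau> z"
    by (rule common_stage)
  show "add u v \<in> U" "add (add u v) w = add u (add v w)" "add u v = add v u"
    by (simp_all add: add_B ac_simps)
  show "smul s u \<in> U" "smul s (add u v) = add (smul s u) (smul s v)" for s
    by (simp_all add: add_B smul_B algebra_simps)
  show "smul (s + t) u = add (smul s u) (smul t u)" "smul (s * t) u = smul s (smul t u)" for s t
    by (simp_all add: add_B smul_B algebra_simps)
  show "smul 1 u = u" "add zero u = u"
    by (simp_all add: add_B smul_B zero_B[of \<tau>])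
  have "add u (B \<tau> (- x)) = zero" by (simp add: add_B zero_B[of \<tau>])
  then show "\<exists>v\<in>U. add u v = zero" using B_in_U by blast
qed

text \<open>At a common stage two elements have representatives in R, one of which divides the
  other; so one element is a scalar multiple of the other.\<close>

lemma uniserial_U: "uniserial U add zero smul"
  unfolding uniserial_def
proof (intro allI impI, rule ccontr)
  fix V W assume V: "submodule V U add zero smul" and W: "submodule W U add zero smul"
    and "\<not> (V \<subseteq> W \<or> W \<subseteq> V)"
  then obtain v w where vw: "v \<in> V" "v \<notin> W" "w \<in> W" "w \<notin> V" by blast
  then have "v \<in> U" "w \<in> U" using V W by (auto simp: submodule_def)
  from common_stage[OF this this(2)]
  obtain \<tau> x y where xy: "v = B \<tau> x" "w = B \<tau> y" by blast
  have "(\<exists>s. w = smul s v) \<or> (\<exists>s. v = smul s w)"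
    using dvd_total[of x y] by (auto simp: xy smul_B dvd_def mult.commute)
  then show False using V W vw unfolding submodule_def by blast
qed

abbreviation a\<^sub>0 :: 'm where "a\<^sub>0 \<equiv> B \<theta> 1"

lemma Ann_a0: "Ann smul zero a\<^sub>0 = {s. r \<theta> dvd s}"
  by (auto simp: Ann_def zero_def smul_B B_eq_iff)

text \<open>Raised to stage \<sigma>, the generator becomes a unit times
  \<open>r \<sigma> / r \<theta>\<close>. The twist therefore does not influence which scalars
  divide it, and the type is that of the untwisted module.\<close>

lemma a0_divisible_iff: "(\<exists>u\<in>U. a\<^sub>0 = smul s u) \<longleftrightarrow> (\<exists>\<sigma>. r \<theta> * s dvd r \<sigma>)"
proof
  assume "\<exists>u\<in>U. a\<^sub>0 = smul s u"
  then obtain u where u: "u \<in> U" "a\<^sub>0 = smul s u" by blast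
  from common_stage[OF u(1) u(1) u(1), of \<theta>] u(2)
  obtain \<sigma> y where \<sigma>: "\<theta> \<le> \<sigma>" and y: "a\<^sub>0 = smul s (B \<sigma> y)" by blast
  obtain k where k: "r \<sigma> = r \<theta> * k" using r_dvd[OF \<sigma>] by (auto simp: dvd_def)
  have "B \<sigma> (e \<sigma> \<theta> * k) = B \<sigma> (s * y)" using y B_raise[OF \<sigma> k, of 1] by (simp add: smul_B)
  then obtain m where "e \<sigma> \<theta> * k - s * y = r \<theta> * k * m" by (auto simp: B_eq_iff k dvd_def)
  then have "(e \<sigma> \<theta> - r \<theta> * m) * k = s * y" by (simp add: algebra_simps)
  \<comment> \<open>The equation holds only modulo \<open>r \<sigma>\<close>; as
    \<open>r \<theta>\<close> is a nonunit, the error term cannot spoil the unit.\<close>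
  moreover have "invertible (e \<sigma> \<theta> - r \<theta> * m)"
  proof (rule unit_cong[OF nonunit])
    show "invertible (e \<sigma> \<theta>)" using e \<sigma> by (simp add: cocycle_def)
  qed simp
  ultimately have "s dvd k" 
    using invertible_mult_dvd_iff(1)[of "e \<sigma> \<theta> - r \<theta> * m" s k] dvd_triv_left[of s y] by simp
  then have "r \<theta> * s dvd r \<sigma>" unfolding k by (intro mult_dvd_mono) auto
  then show "\<exists>\<sigma>. r \<theta> * s dvd r \<sigma>" ..
next
  assume "\<exists>\<sigma>. r \<theta> * s dvd r \<sigma>"
  then obtain \<rho> where \<rho>: "r \<theta> * s dvd r \<rho>" by blast
  define \<sigma> where "\<sigma> = max \<theta> \<rho>"
  have "r \<theta> * s dvd r \<sigma>" using \<rho> r_dvd[of \<rho> \<sigma>] dvd_trans by (auto simp: \<sigma>_def)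
  then obtain m where m: "r \<sigma> = r \<theta> * (s * m)" by (auto simp: dvd_def mult.assoc)
  have "a\<^sub>0 = smul s (B \<sigma> (e \<sigma> \<theta> * m))"
    using B_raise[OF _ m, of 1] by (simp add: \<sigma>_def smul_B algebra_simps)
  then show "\<exists>u\<in>U. a\<^sub>0 = smul s u" using B_in_U by blast
qed

lemma Dset_a0:
  assumes J: "J = (\<Union>\<sigma>. {emb x / emb (r \<sigma>) | x. True})"
  shows "Dset U smul a\<^sub>0 = (\<lambda>q. emb (r \<theta>) * q) ` J"
proof -
  have 1: "Dset U smul a\<^sub>0 = {emb x / emb s | x s. s \<noteq> 0 \<and> (\<exists>\<sigma>. r \<theta> * s dvd r \<sigma>)}"
    unfolding a0_divisible_iff[symmetric] Dset_def by (auto simp: Fract_eq_emb_divide image_iff)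
  show ?thesis unfolding 1 J
  proof (intro equalityI subsetI)
    fix q assume "q \<in> {emb x / emb s | x s. s \<noteq> 0 \<and> (\<exists>\<sigma>. r \<theta> * s dvd r \<sigma>)}"
    then obtain x s \<sigma> m where q: "q = emb x / emb s" "s \<noteq> 0" and m: "r \<sigma> = r \<theta> * s * m"
      by (auto simp: dvd_def)
    have "m \<noteq> 0" using m r_nonzero[of \<sigma>] by auto
    then have "q = emb (r \<theta>) * (emb (x * m) / emb (r \<sigma>))"
      using q by (simp add: m)
    then show "q \<in> (\<lambda>q. emb (r \<theta>) * q) ` (\<Union>\<sigma>. {emb x / emb (r \<sigma>) | x. True})" by blast
  next
    fix q assume "q \<in> (\<lambda>q. emb (r \<theta>) * q) ` (\<Union>\<sigma>. {emb x / emb (r \<sigma>) | x. True})"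
    then obtain x \<rho> where q: "q = emb (r \<theta>) * (emb x / emb (r \<rho>))" by blast
    define \<sigma> where "\<sigma> = max \<theta> \<rho>"
    obtain k where k: "r \<sigma> = r \<rho> * k" using r_dvd[of \<rho> \<sigma>] by (auto simp: \<sigma>_def dvd_def)
    obtain s where s: "r \<sigma> = r \<theta> * s" using r_dvd[of \<theta> \<sigma>] by (auto simp: \<sigma>_def dvd_def)
    have nz: "k \<noteq> 0" "s \<noteq> 0" using k s r_nonzero[of \<sigma>] by auto
    have "q = emb (r \<theta>) * (emb (x * k) / emb (r \<sigma>))" using q k nz by simp
    also have "\<dots> = emb (x * k) / emb s" using nz by (simp add: s)
    finally have calculation: "q = emb (x * k) / emb s" .
    show "q \<in> {emb x / emb s | x s. s \<noteq> 0 \<and> (\<exists>\<sigma>. r \<theta> * s dvd r \<sigma>)}"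
    proof -
      have "r \<theta> * s dvd r \<sigma>" by (simp add: s)
      then show ?thesis using nz(2) calculation by blast
    qed
  qed
qed

text \<open>The annihilator of \<open>a\<^sub>0\<close> is \<open>r \<theta> R\<close> and its D-set
  is \<open>r \<theta> J\<close>, so multiplication by \<open>r \<theta>\<close> is the isomorphism
  from J/R.\<close>

lemma has_type_U:
  assumes J: "J = (\<Union>\<sigma>. {emb x / emb (r \<sigma>) | x. True})"
  shows "has_type U add zero smul J (range emb)"
proof -
  let ?t = "emb (r \<theta>)"
  let ?\<phi> = "image (\<lambda>q. ?t * q)"
  have inj: "inj (\<lambda>q. ?t * q)" by (simp add: inj_on_def)
  have Ann: "emb ` Ann smul zero a\<^sub>0 = ?\<phi> (range emb)"
  proof -
    have "Ann smul zero a\<^sub>0 = range (\<lambda>x. r \<theta> * x)" by (auto simp: Ann_a0 dvd_def)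
    then show ?thesis by (simp add: image_image)
  qed
  have cos: "?\<phi> (cos (range emb) q) = cos (?\<phi> (range emb)) (?t * q)" for q
  proof -
    have cos_image: "cos A x = (+) x ` A" for A :: "'a fract set" and x by (auto simp: cos_def)
    show ?thesis unfolding cos_image by (simp add: image_image distrib_left)
  qed
  have "?\<phi> ` qcar J (range emb) = qcar (Dset U smul a\<^sub>0) (emb ` Ann smul zero a\<^sub>0)"
    unfolding qcar_def Dset_a0[OF J] Ann by (simp add: image_image cos)
  moreover have "inj ?\<phi>" using inj_image_eq_iff[OF inj] by (auto simp: inj_on_def)
  ultimately have "bij_betw ?\<phi> (qcar J (range emb)) (qcar (Dset U smul a\<^sub>0) (emb ` Ann smul zero a\<^sub>0))"
    unfolding bij_betw_def using inj_on_subset[OF _ subset_UNIV] by blast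
  moreover have "?\<phi> (qadd X Y) = qadd (?\<phi> X) (?\<phi> Y)" for X Y
  proof -
    have qadd_image: "qadd X Y = (\<Union>x\<in>X. \<Union>y\<in>Y. {x + y})" for X Y :: "'a fract set"
      by (auto simp: qadd_def)
    show ?thesis unfolding qadd_image by (simp add: image_UN distrib_left)
  qed
  moreover have "?\<phi> (qsmul (range emb) s X) = qsmul (emb ` Ann smul zero a\<^sub>0) s (?\<phi> X)" for s X
    unfolding Ann
  proof (intro equalityI subsetI)
    fix y assume "y \<in> ?\<phi> (qsmul (range emb) s X)"
    then obtain x a where "x \<in> X" "y = ?t * (emb s * x + emb a)" by (auto simp: qsmul_def)
    then have "y = emb s * (?t * x) + ?t * emb a" "x \<in> X" by (simp_all add: algebra_simps)
    then show "y \<in> qsmul (?\<phi> (range emb)) s (?\<phi> X)" unfolding qsmul_def by blast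
  next
    fix y assume "y \<in> qsmul (?\<phi> (range emb)) s (?\<phi> X)"
    then obtain x a where "x \<in> X" "y = emb s * (?t * x) + ?t * emb a" by (auto simp: qsmul_def)
    then have "y = ?t * (emb s * x + emb a)" "x \<in> X" by (simp_all add: algebra_simps)
    then show "y \<in> ?\<phi> (qsmul (range emb) s X)" unfolding qsmul_def by blast
  qed
  ultimately have "iso_to_quot (qcar J (range emb)) qadd (qsmul (range emb)) (Dset U smul a\<^sub>0)
      (emb ` Ann smul zero a\<^sub>0)"
    unfolding iso_to_quot_def miso_def by blast
  moreover have "a\<^sub>0 \<noteq> zero" using nonunit by (simp add: zero_def B_eq_iff)
  ultimately show ?thesis unfolding has_type_def using B_in_U by blast
qed

text \<open>Q is itself uniserial over R, by cross-multiplication.\<close>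

lemma fract_total: "(\<exists>y. p = emb y * q) \<or> (\<exists>y. (q :: 'a fract) = emb y * p)"
proof -
  obtain a b c d where p: "b \<noteq> 0" "p = emb a / emb b" and q: "d \<noteq> 0" "q = emb c / emb d"
    using fract_eq_emb_divide[of p] fract_eq_emb_divide[of q] by blast
  have *: "emb u / emb v = emb y * (emb w / emb x)" if "u * x = w * v * y" "v \<noteq> 0" "x \<noteq> 0"
    for u v w x y :: 'a
  proof -
    have "emb (u * x) = emb (w * v * y)" using that by simp
    then show ?thesis using that(2,3) by (simp add: frac_eq_eq mult_ac)
  qed
  show ?thesis using dvd_total[of "c * b" "a * d"] unfolding dvd_def p(2) q(2)
    using * p(1) q(1) by blast
qed

text \<open>An isomorphism onto J'/A sends the generator \<open>B \<sigma> 1\<close> to a coset of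
  some \<open>q \<sigma>\<close>. Comparing annihilators shows that A is generated by
  \<open>p \<sigma> = r \<sigma> * q \<sigma>\<close> for every \<sigma> above \<theta>; hence these
  generators differ by units \<open>c \<sigma>\<close>, and the transition maps turn into the
  trivializing congruences.\<close>

lemma standard_trivializes:
  assumes "standard U add zero smul"
  shows "\<exists>c. trivializes c e"
proof -
  obtain J' A \<psi> where A: "submodQ A" and bij: "bij_betw \<psi> U (qcar J' A)"
    and \<psi>_smul: "\<And>s u. u \<in> U \<Longrightarrow> \<psi> (smul s u) = qsmul A s (\<psi> u)"
    using assms unfolding standard_def iso_to_quot_def miso_def by blast
  have "\<exists>q. \<psi> (B \<sigma> 1) = cos A q" for \<sigma>
    using bij_betw_apply[OF bij B_in_U, of \<sigma> 1] by (auto simp: qcar_def)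
  then obtain q where q: "\<And>\<sigma>. \<psi> (B \<sigma> 1) = cos A (q \<sigma>)" by metis
  have \<psi>B: "\<psi> (B \<sigma> s) = cos A (emb s * q \<sigma>)" for \<sigma> s
    using \<psi>_smul[OF B_in_U, of s \<sigma> 1] by (simp add: smul_B q qsmul_cos[OF A])
  have inj: "\<psi> u = \<psi> v \<longleftrightarrow> u = v" if "u \<in> U" "v \<in> U" for u v
    using bij that by (auto simp: bij_betw_def inj_on_def)
  have in_A: "emb s * q \<sigma> \<in> A \<longleftrightarrow> r \<sigma> dvd s" for s \<sigma>
    using inj[OF B_in_U B_in_U, of \<sigma> s \<sigma> 0] A by (simp add: \<psi>B cos_eq_iff B_eq_iff)
  have trans: "q \<tau> - emb (e \<sigma> \<tau> * k) * q \<sigma> \<in> A" if "\<tau> \<le> \<sigma>" "r \<sigma> = r \<tau> * k" for \<tau> \<sigma> k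
  proof -
    have "B \<tau> 1 = B \<sigma> (e \<sigma> \<tau> * k)" using B_raise[OF that, of 1] by simp
    then have "cos A (q \<tau>) = cos A (emb (e \<sigma> \<tau> * k) * q \<sigma>)" by (metis \<psi>B q)
    then show ?thesis by (simp only: cos_eq_iff[OF A])
  qed
  define p where "p \<sigma> = emb (r \<sigma>) * q \<sigma>" for \<sigma>
  have pA: "p \<sigma> \<in> A" for \<sigma> unfolding p_def by (simp add: in_A)
  \<comment> \<open>since \<open>q \<sigma> \<notin> A\<close>, the submodule \<open>A\<close> lies inside \<open>R q \<sigma>\<close>, hence equals \<open>R (r \<sigma> q \<sigma>)\<close>\<close>
  have A_gen: "\<exists>y. a = emb y * p \<sigma>" if "a \<in> A" "\<theta> \<le> \<sigma>" for a \<sigma>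
  proof -
    have nu: "\<not> invertible (r \<sigma>)" using nonunit r_dvd[OF that(2)] dvd_trans by blast
    have "q \<sigma> \<noteq> emb y * a" for y
    proof
      assume "q \<sigma> = emb y * a"
      then have "emb 1 * q \<sigma> \<in> A" using that A by (simp add: submodQ_def)
      then show False using nu by (simp only: in_A)
    qed
    then obtain y where y: "a = emb y * q \<sigma>" using fract_total by blast
    then have "r \<sigma> dvd y" using that in_A by simp
    then show ?thesis using y by (auto simp: dvd_def p_def)
  qed
  have p_nz: "p \<theta> \<noteq> 0"
  proof
    assume "p \<theta> = 0"
    then have "emb 1 * q \<theta> \<in> A" using A by (simp add: p_def submodQ_def)
    then show False using nonunit by (simp only: in_A)
  qed
  have "\<exists>y. \<theta> \<le> \<sigma> \<longrightarrow> p \<sigma> = emb y * p \<theta>" for \<sigma> using A_gen[OF pA, of \<theta>] by blast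
  then obtain c where c: "\<And>\<sigma>. \<theta> \<le> \<sigma> \<Longrightarrow> p \<sigma> = emb (c \<sigma>) * p \<theta>" by metis
  have c_unit: "invertible (c \<sigma>)" if \<sigma>: "\<theta> \<le> \<sigma>" for \<sigma>
  proof -
    obtain y where "p \<theta> = emb y * p \<sigma>" using A_gen[OF pA \<sigma>] by blast
    then have "emb (y * c \<sigma>) * p \<theta> = emb 1 * p \<theta>" using c[OF \<sigma>] by (simp add: mult.assoc)
    then have "y * c \<sigma> = 1" using p_nz by (simp only: mult_cancel_right emb_eq_iff simp_thms)
    then show ?thesis by (metis dvd_triv_right)
  qed
  have c_dvd: "r \<tau> dvd c \<tau> - c \<sigma> * e \<sigma> \<tau>" if \<tau>: "\<theta> \<le> \<tau>" and \<sigma>: "\<tau> \<le> \<sigma>" for \<sigma> \<tau>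
  proof -
    obtain k where k: "r \<sigma> = r \<tau> * k" using r_dvd[OF \<sigma>] by (auto simp: dvd_def)
    obtain y where y: "q \<tau> - emb (e \<sigma> \<tau> * k) * q \<sigma> = emb y * p \<theta>"
      using A_gen[OF trans[OF \<sigma> k]] by blast
    \<comment> \<open>Multiplying by \<open>r \<tau>\<close> supplies the factor that completes
      \<open>k\<close> to \<open>r \<sigma>\<close>; the error becomes a multiple of
      \<open>r \<tau> * p \<theta>\<close>.\<close>
    have "emb (r \<tau>) * (q \<tau> - emb (e \<sigma> \<tau> * k) * q \<sigma>) = p \<tau> - emb (e \<sigma> \<tau>) * p \<sigma>"
      by (simp add: p_def k algebra_simps)
    then have "p \<tau> - emb (e \<sigma> \<tau>) * p \<sigma> = emb (r \<tau> * y) * p \<theta>" 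
      unfolding y by (simp add: mult.assoc)
    then have "emb (c \<tau> - c \<sigma> * e \<sigma> \<tau>) * p \<theta> = emb (r \<tau> * y) * p \<theta>"
      using c[OF \<tau>] c[of \<sigma>] \<tau> \<sigma> by (simp add: algebra_simps)
    then have "c \<tau> - c \<sigma> * e \<sigma> \<tau> = r \<tau> * y"
      using p_nz by (simp only: mult_cancel_right emb_eq_iff simp_thms)
    then show ?thesis by simp
  qed
  \<comment> \<open>Below \<theta> the unit is pulled back from \<theta>, as a trivialization is
    determined downwards modulo \<open>r \<tau>\<close>.\<close>
  define c' where "c' \<tau> = (if \<theta> \<le> \<tau> then c \<tau> else c \<theta> * e \<theta> \<tau>)" for \<tau>
  have "invertible (c' \<sigma>)" for \<sigma>
    using c_unit e by (auto simp: c'_def cocycle_def invertible_mult_dvd_iff(3))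
  moreover have "r \<tau> dvd c' \<tau> - c' \<sigma> * e \<sigma> \<tau>" if \<sigma>: "\<tau> \<le> \<sigma>" for \<sigma> \<tau>
  proof -
    consider "\<theta> \<le> \<tau>" | "\<tau> < \<theta>" "\<theta> \<le> \<sigma>" | "\<tau> < \<theta>" "\<sigma> < \<theta>" by fastforce
    then show ?thesis
    proof cases
      case 1
      then show ?thesis using c_dvd \<sigma> by (simp add: c'_def)
    next
      case 2
      have "r \<tau> dvd r \<theta>" using 2 by (simp add: r_dvd)
      then have "r \<tau> dvd c \<theta> - c \<sigma> * e \<sigma> \<theta>" using c_dvd[OF order_refl 2(2)] dvd_trans by blast
      moreover have "r \<tau> dvd e \<sigma> \<tau> - e \<sigma> \<theta> * e \<theta> \<tau>" using e 2 by (simp add: cocycle_def)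
      ultimately have "r \<tau> dvd (c \<theta> - c \<sigma> * e \<sigma> \<theta>) * e \<theta> \<tau> - c \<sigma> * (e \<sigma> \<tau> - e \<sigma> \<theta> * e \<theta> \<tau>)"
        by (rule dvd_diff[OF dvd_mult2 dvd_mult])
      then show ?thesis using 2 by (simp add: c'_def algebra_simps)
    next
      case 3
      have "r \<tau> dvd c \<theta> * (e \<theta> \<tau> - e \<theta> \<sigma> * e \<sigma> \<tau>)"
        using e 3 \<sigma> by (intro dvd_mult) (simp add: cocycle_def)
      then show ?thesis using 3 by (simp add: c'_def algebra_simps)
    qed
  qed
  ultimately show ?thesis unfolding trivializes_def by blast
qed

end

theorem (in valuation_chain) nonstandard_uniserial_of_cocycle:
  assumes "cocycle e" "\<nexists>c. trivializes c e" "\<not> invertible (r \<theta>)"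
    and "inj (\<kappa> :: om1 \<times> 'a \<Rightarrow> 'a)"
    and "J = (\<Union>\<sigma>. {emb x / emb (r \<sigma>) | x. True})"
  shows "\<exists>(U :: 'a set) add z (smul :: 'a \<Rightarrow> 'a \<Rightarrow> 'a).
           rmodule U add z smul \<and> uniserial U add z smul \<and>
           \<not> standard U add z smul \<and> has_type U add z smul J (range emb)"
proof -
  obtain B :: "om1 \<Rightarrow> 'a \<Rightarrow> 'a" and add and smul :: "'a \<Rightarrow> 'a \<Rightarrow> 'a" where B:
    "\<forall>\<tau> x y. B \<tau> x = B \<tau> y \<longleftrightarrow> r \<tau> dvd x - y"
    "\<forall>\<tau> \<sigma> k x. \<tau> \<le> \<sigma> \<longrightarrow> r \<sigma> = r \<tau> * k \<longrightarrow> B \<tau> x = B \<sigma> (x * e \<sigma> \<tau> * k)"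
    "\<forall>\<tau> x y. add (B \<tau> x) (B \<tau> y) = B \<tau> (x + y)"
    "\<forall>\<tau> s x. smul s (B \<tau> x) = B \<tau> (s * x)"
    using limit_module_exists[OF assms(1,4)] by (elim exE conjE)
  interpret limit_module r e B add smul \<theta>
  proof (intro limit_module.intro limit_module_axioms.intro valuation_chain_axioms)
    show "B \<tau> x = B \<sigma> (x * e \<sigma> \<tau> * k)" if "\<tau> \<le> \<sigma>" "r \<sigma> = r \<tau> * k" for \<tau> \<sigma> k x
      using B(2) that by blast
  qed (use assms(1,3) B in simp_all)
  show ?thesis
    using rmodule_U uniserial_U has_type_U[OF assms(5)] standard_trivializes assms(2) by blast
qed

section \<open>Extending cocycles\<close>

definition eqm :: "'a::comm_ring_1 \<Rightarrow> 'a \<Rightarrow> 'a \<Rightarrow> bool" where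
  "eqm a x y \<longleftrightarrow> a dvd x - y"

lemma eqm_refl [simp]: "eqm a x x"
  by (simp add: eqm_def)

lemma eqm_sym: "eqm a x y \<Longrightarrow> eqm a y x"
  unfolding eqm_def by (metis dvd_minus_iff minus_diff_eq)

lemma eqm_trans: "eqm a x y \<Longrightarrow> eqm a y z \<Longrightarrow> eqm a x z"
  unfolding eqm_def using dvd_add[of a "x - y" "y - z"] by simp

lemma eqm_mult: "eqm a x y \<Longrightarrow> eqm a x' y' \<Longrightarrow> eqm a (x * x') (y * y')"
proof -
  assume "eqm a x y" "eqm a x' y'"
  then have "a dvd (x - y) * x' + y * (x' - y')"
    unfolding eqm_def by (intro dvd_add dvd_mult2 dvd_mult)
  then show ?thesis by (simp add: eqm_def algebra_simps)
qed

lemma eqm_mono: "a dvd b \<Longrightarrow> eqm b x y \<Longrightarrow> eqm a x y"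
  unfolding eqm_def using dvd_trans by blast

lemma eqm_cancel:
  fixes u :: "'a::idom"
  assumes "invertible u"
  shows "eqm a (u * x) (u * y) \<longleftrightarrow> eqm a x y"
  unfolding eqm_def right_diff_distrib[symmetric] by (rule invertible_mult_dvd_iff(1)[OF assms])

lemma invertible_mult: "invertible x \<Longrightarrow> invertible y \<Longrightarrow> invertible (x * y :: 'a::comm_ring_1)"
  using mult_dvd_mono[of x 1 y 1] by simp

section \<open>Building a cocycle row by row\<close>

context valuation_chain
begin

text \<open>This is the part of the cocycle condition that binds \<open>e \<delta>\<close> to
  earlier rows, and it is also the trivialization condition cut off at \<delta>. Isolating it
  permits recursion on \<delta>.\<close>

definition is_row :: "om1 \<Rightarrow> (om1 \<Rightarrow> om1 \<Rightarrow> 'a) \<Rightarrow> (om1 \<Rightarrow> 'a) \<Rightarrow> bool" where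
  "is_row \<delta> e b \<longleftrightarrow> (\<forall>\<tau><\<delta>. invertible (b \<tau>)) \<and>
     (\<forall>\<sigma> \<tau>. \<tau> \<le> \<sigma> \<longrightarrow> \<sigma> < \<delta> \<longrightarrow> eqm (r \<tau>) (b \<tau>) (b \<sigma> * e \<sigma> \<tau>))"

definition cocycle_below :: "om1 \<Rightarrow> (om1 \<Rightarrow> om1 \<Rightarrow> 'a) \<Rightarrow> bool" where
  "cocycle_below \<delta> e \<longleftrightarrow> (\<forall>\<sigma><\<delta>. e \<sigma> \<sigma> = 1 \<and> is_row \<sigma> e (e \<sigma>))"

lemma is_row_cong: "(\<And>\<sigma>. \<sigma> < \<delta> \<Longrightarrow> e \<sigma> = e' \<sigma>) \<Longrightarrow> is_row \<delta> e b \<longleftrightarrow> is_row \<delta> e' b"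
  unfolding is_row_def by auto

lemma is_row_cong_row: "(\<And>\<sigma>. \<sigma> < \<delta> \<Longrightarrow> b \<sigma> = b' \<sigma>) \<Longrightarrow> is_row \<delta> e b \<longleftrightarrow> is_row \<delta> e b'"
  unfolding is_row_def by (metis le_less_trans)

lemma cocycle_below_cong:
  assumes "\<And>\<sigma>. \<sigma> < \<delta> \<Longrightarrow> e \<sigma> = e' \<sigma>"
  shows "cocycle_below \<delta> e \<longleftrightarrow> cocycle_below \<delta> e'"
proof -
  have "is_row \<sigma> e (e \<sigma>) \<longleftrightarrow> is_row \<sigma> e' (e' \<sigma>)" if "\<sigma> < \<delta>" for \<sigma>
    using is_row_cong[of \<sigma> e e'] assms that by (metis order.strict_trans)
  then show ?thesis unfolding cocycle_below_def using assms by auto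
qed

lemma cocycle_belowD:
  assumes "cocycle_below \<delta> e"
  shows "\<sigma> < \<delta> \<Longrightarrow> e \<sigma> \<sigma> = 1"
    and "\<tau> \<le> \<sigma> \<Longrightarrow> \<sigma> < \<delta> \<Longrightarrow> invertible (e \<sigma> \<tau>)"
    and "\<tau> \<le> \<sigma> \<Longrightarrow> \<sigma> \<le> \<rho> \<Longrightarrow> \<rho> < \<delta> \<Longrightarrow> eqm (r \<tau>) (e \<rho> \<tau>) (e \<rho> \<sigma> * e \<sigma> \<tau>)"
proof -
  show 1: "\<sigma> < \<delta> \<Longrightarrow> e \<sigma> \<sigma> = 1" for \<sigma> using assms by (auto simp: cocycle_below_def)
  show "\<tau> \<le> \<sigma> \<Longrightarrow> \<sigma> < \<delta> \<Longrightarrow> invertible (e \<sigma> \<tau>)"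
    using assms 1 unfolding cocycle_below_def is_row_def by (cases "\<tau> = \<sigma>") auto
  show "\<tau> \<le> \<sigma> \<Longrightarrow> \<sigma> \<le> \<rho> \<Longrightarrow> \<rho> < \<delta> \<Longrightarrow> eqm (r \<tau>) (e \<rho> \<tau>) (e \<rho> \<sigma> * e \<sigma> \<tau>)"
    using assms 1 unfolding cocycle_below_def is_row_def by (cases "\<sigma> = \<rho>") auto
qed

lemma cocycleI:
  assumes "\<And>\<delta>. cocycle_below \<delta> e"
  shows "cocycle e"
proof -
  note D = cocycle_belowD[OF assms]
  have *: "\<exists>\<delta>. \<rho> < \<delta>" for \<rho> :: om1 by (rule gt_ex_om1)
  show ?thesis unfolding cocycle_def eqm_def[symmetric] using * D by blast
qed

lemma trivializesD: "trivializes c e \<Longrightarrow> \<tau> \<le> \<sigma> \<Longrightarrow> eqm (r \<tau>) (c \<tau>) (c \<sigma> * e \<sigma> \<tau>)"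
  unfolding trivializes_def eqm_def by blast

text \<open>A row at a limit amounts to coherent units on a ladder: for any rung above \<tau> the
  value \<open>u n * e (d n) \<tau>\<close> is the same modulo \<open>r \<tau>\<close>. The exact
  equality in the last clause lets membership in a multiplicatively closed set pass to the row,
  which a congruence alone would not.\<close>

lemma is_row_glue:
  assumes e: "cocycle_below \<delta> e" and lad: "ladder \<delta> d"
    and u: "\<And>n. invertible (u n)" "\<And>n. eqm (r (d n)) (u n) (u (Suc n) * e (d (Suc n)) (d n))"
  shows "\<exists>b. is_row \<delta> e b \<and> (\<forall>n \<tau>. \<tau> \<le> d n \<longrightarrow> eqm (r \<tau>) (b \<tau>) (u n * e (d n) \<tau>)) \<and>
    (\<forall>\<tau><\<delta>. \<exists>n. \<tau> \<le> d n \<and> b \<tau> = u n * e (d n) \<tau>)"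
proof -
  note D = cocycle_belowD[OF e]
  note d = ladderD[OF lad]
  have dm: "d n \<le> d m" if "n \<le> m" for n m using d(3) that by simp
  have coh: "eqm (r (d n)) (u n) (u m * e (d m) (d n))" if "n \<le> m" for n m
    using that
  proof (induction m rule: dec_induct)
    case base
    then show ?case by (simp add: D(1) d(1))
  next
    case (step m)
    have 1: "eqm (r (d n)) (u m) (u (Suc m) * e (d (Suc m)) (d m))"
      using eqm_mono[OF r_dvd[OF dm] u(2)] step by blast
    have 2: "eqm (r (d n)) (e (d (Suc m)) (d n)) (e (d (Suc m)) (d m) * e (d m) (d n))"
      using D(3) dm d(1) step by simp
    from eqm_mult[OF 1 eqm_refl[of _ "e (d m) (d n)"]]
    have "eqm (r (d n)) (u m * e (d m) (d n)) (u (Suc m) * (e (d (Suc m)) (d m) * e (d m) (d n)))"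
      by (simp add: mult.assoc)
    moreover have "eqm (r (d n)) (u (Suc m) * (e (d (Suc m)) (d m) * e (d m) (d n)))
        (u (Suc m) * e (d (Suc m)) (d n))"
      by (rule eqm_mult[OF eqm_refl eqm_sym[OF 2]])
    ultimately show ?case using step.IH eqm_trans by blast
  qed
  have coh': "eqm (r \<tau>) (u n * e (d n) \<tau>) (u m * e (d m) \<tau>)" if "\<tau> \<le> d n" "n \<le> m" for n m \<tau>
  proof -
    have "eqm (r \<tau>) (u n * e (d n) \<tau>) ((u m * e (d m) (d n)) * e (d n) \<tau>)"
      by (rule eqm_mult[OF eqm_mono[OF r_dvd[OF that(1)] coh[OF that(2)]] eqm_refl])
    moreover have "eqm (r \<tau>) (u m * (e (d m) (d n) * e (d n) \<tau>)) (u m * e (d m) \<tau>)"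
      by (rule eqm_mult[OF eqm_refl eqm_sym]) (simp add: D(3) that dm d(1))
    ultimately show ?thesis using eqm_trans by (simp add: mult.assoc)
  qed
  define N where "N \<tau> = (LEAST n. \<tau> \<le> d n)" for \<tau>
  have N: "\<tau> \<le> d (N \<tau>)" if "\<tau> < \<delta>" for \<tau>
    unfolding N_def using d(2)[OF that] by (metis LeastI_ex less_imp_le)
  have N_le: "N \<tau> \<le> n" if "\<tau> \<le> d n" for \<tau> n unfolding N_def using that by (rule Least_le)
  define b where "b \<tau> = u (N \<tau>) * e (d (N \<tau>)) \<tau>" for \<tau>
  have b: "eqm (r \<tau>) (b \<tau>) (u n * e (d n) \<tau>)" if "\<tau> \<le> d n" for n \<tau>
    unfolding b_def using coh' N N_le that d(1) by (meson le_less_trans)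
  have "is_row \<delta> e b"
    unfolding is_row_def
  proof (intro conjI allI impI)
    fix \<tau> assume "\<tau> < \<delta>"
    then show "invertible (b \<tau>)" unfolding b_def by (intro invertible_mult u D(2) N d)
  next
    fix \<sigma> \<tau> assume st: "\<tau> \<le> \<sigma>" "\<sigma> < \<delta>"
    let ?n = "N \<sigma>"
    have "\<tau> \<le> d ?n" using st N by (meson order_trans)
    then have "eqm (r \<tau>) (b \<tau>) (u ?n * e (d ?n) \<tau>)" by (rule b)
    moreover have "eqm (r \<tau>) (u ?n * e (d ?n) \<tau>) (u ?n * (e (d ?n) \<sigma> * e \<sigma> \<tau>))"
      by (rule eqm_mult[OF eqm_refl]) (simp add: D(3) st N d(1))
    ultimately show "eqm (r \<tau>) (b \<tau>) (b \<sigma> * e \<sigma> \<tau>)"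
      using eqm_trans unfolding b_def[of \<sigma>] by (simp add: mult.assoc)
  qed
  moreover have "\<exists>n. \<tau> \<le> d n \<and> b \<tau> = u n * e (d n) \<tau>" if "\<tau> < \<delta>" for \<tau>
    using N[OF that] b_def by blast
  ultimately show ?thesis using b by (intro exI[of _ b] conjI) blast+
qed

lemma is_row_succ:
  assumes e: "cocycle_below \<delta> e" and \<beta>: "\<beta> < \<delta>" "\<And>\<sigma>. \<sigma> < \<delta> \<longleftrightarrow> \<sigma> \<le> \<beta>"
  shows "is_row \<delta> e (e \<beta>)"
  unfolding is_row_def using cocycle_belowD[OF e] \<beta> by auto

text \<open>No obstruction arises at a countable limit: along a ladder each next unit is found by
  dividing by the unit \<open>e (d (Suc n)) (d n)\<close>. A successor stage copies its
  predecessor's row.\<close>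

lemma is_row_exists:
  assumes e: "cocycle_below \<delta> e"
  shows "\<exists>b. is_row \<delta> e b"
proof (cases \<delta> rule: om1_cases)
  case least
  then show ?thesis by (auto simp: is_row_def)
next
  case (succ \<beta>)
  then show ?thesis using is_row_succ[OF e] by blast
next
  case limit
  then obtain d where lad: "ladder \<delta> d" using ladder_exists by blast
  note d = ladderD[OF lad]
  note D = cocycle_belowD[OF e]
  have step: "\<exists>y. invertible y \<and> eqm (r (d n)) x (y * e (d (Suc n)) (d n))" if x: "invertible x" for x n
  proof -
    have "invertible (e (d (Suc n)) (d n))"
      using D(2) d by simp
    then obtain v where v: "e (d (Suc n)) (d n) * v = 1" by (metis dvdE)
    have "x = (x * v) * e (d (Suc n)) (d n)" using v by (simp add: mult.assoc mult.commute)
    moreover have "invertible v" by (metis v dvd_triv_right)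
    then have "invertible (x * v)" using x by (rule invertible_mult[rotated])
    ultimately show ?thesis by (metis eqm_refl)
  qed
  have "\<exists>u. \<forall>n. invertible (u n) \<and> eqm (r (d n)) (u n) (u (Suc n) * e (d (Suc n)) (d n))"
    by (rule dependent_nat_choice) (use step one_dvd[of 1] in blast)+
  then obtain u where "\<And>n. invertible (u n)" "\<And>n. eqm (r (d n)) (u n) (u (Suc n) * e (d (Suc n)) (d n))"
    by blast
  from is_row_glue[OF e lad this] show ?thesis by (elim exE conjE) (rule exI)
qed

text \<open>A unit of the inverse limit of the rings \<open>R / r \<tau> R\<close>, \<tau> <
  \<delta>, given by representatives. Such nets act on the rows at \<delta>.\<close>

definition unit_net :: "om1 \<Rightarrow> (om1 \<Rightarrow> 'a) \<Rightarrow> bool" where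
  "unit_net \<delta> w \<longleftrightarrow> (\<forall>\<tau><\<delta>. invertible (w \<tau>)) \<and> (\<forall>\<sigma> \<tau>. \<tau> \<le> \<sigma> \<longrightarrow> \<sigma> < \<delta> \<longrightarrow> eqm (r \<tau>) (w \<tau>) (w \<sigma>))"

lemma is_row_twist:
  assumes "is_row \<delta> e b" "unit_net \<delta> w"
  shows "is_row \<delta> e (\<lambda>\<tau>. b \<tau> * w \<tau>)"
  unfolding is_row_def
proof (intro conjI allI impI)
  fix \<tau> assume "\<tau> < \<delta>"
  then show "invertible (b \<tau> * w \<tau>)"
    using assms by (intro invertible_mult) (auto simp: is_row_def unit_net_def)
next
  fix \<sigma> \<tau> assume "\<tau> \<le> \<sigma>" "\<sigma> < \<delta>"
  then have "eqm (r \<tau>) (b \<tau> * w \<tau>) ((b \<sigma> * e \<sigma> \<tau>) * w \<sigma>)"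
    using assms by (intro eqm_mult) (auto simp: is_row_def unit_net_def)
  then show "eqm (r \<tau>) (b \<tau> * w \<tau>) (b \<sigma> * w \<sigma> * e \<sigma> \<tau>)" by (simp add: mult_ac)
qed

text \<open>The bit \<open>g \<delta>\<close> decides whether the row at
  \<open>\<delta> \<in> C\<close> is twisted by \<open>w \<delta>\<close>. If opposite bits had
  trivializations agreeing below \<delta>, the quotient of their values at \<delta> would be a limit
  of \<open>w \<delta>\<close> in R.\<close>

lemma twisted_cocycles_exist:
  assumes "\<forall>\<delta>\<in>C. unit_net \<delta> (w \<delta>)"
    and "\<forall>\<delta>\<in>C. \<forall>u. \<exists>\<tau><\<delta>. \<not> eqm (r \<tau>) u (w \<delta> \<tau>)"
  shows "\<exists>E. (\<forall>g :: om1 \<Rightarrow> bool. cocycle (E g)) \<and>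
    (\<forall>g g' c c' \<delta>. \<delta> \<in> C \<longrightarrow> (\<forall>\<sigma><\<delta>. g \<sigma> = g' \<sigma> \<and> c \<sigma> = c' \<sigma>) \<longrightarrow>
      trivializes c (E g) \<longrightarrow> trivializes c' (E g') \<longrightarrow> g \<delta> = g' \<delta>)"
proof -
  note w = assms(1)[rule_format] and no_limit = assms(2)[rule_format]
  define row where "row \<delta> e = (SOME b. is_row \<delta> e b)" for \<delta> and e :: "om1 \<Rightarrow> om1 \<Rightarrow> 'a"
  define \<Phi> where "\<Phi> g \<delta> e =
      (\<lambda>\<tau>. if \<tau> = \<delta> then 1 else if g \<delta> \<and> \<delta> \<in> C then row \<delta> e \<tau> * w \<delta> \<tau> else row \<delta> e \<tau>)"
    for g :: "om1 \<Rightarrow> bool" and \<delta> e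
  define cut where "cut E \<delta> = (\<lambda>\<sigma>. if \<sigma> < \<delta> then E \<sigma> else undefined)"
    for E :: "om1 \<Rightarrow> om1 \<Rightarrow> 'a" and \<delta>
  have "\<exists>E. \<forall>\<delta>. E \<delta> = \<Phi> g \<delta> (cut E \<delta>)" for g
    unfolding cut_def by (rule wfrec_om1[of "\<Phi> g"]) blast
  then obtain E where E: "\<And>g \<delta>. E g \<delta> = \<Phi> g \<delta> (cut (E g) \<delta>)" by metis
  have cut: "\<sigma> < \<delta> \<Longrightarrow> cut E \<delta> \<sigma> = E \<sigma>" for E \<sigma> \<delta> by (simp add: cut_def)
  have row: "is_row \<delta> (E g) (row \<delta> (cut (E g) \<delta>))" if "cocycle_below \<delta> (E g)" for \<delta> g
  proof -
    have "cocycle_below \<delta> (cut (E g) \<delta>)"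
      using that cocycle_below_cong[of \<delta> "cut (E g) \<delta>" "E g"] cut by blast
    then have "is_row \<delta> (cut (E g) \<delta>) (row \<delta> (cut (E g) \<delta>))"
      unfolding row_def by (rule someI_ex[OF is_row_exists])
    then show ?thesis using is_row_cong[of \<delta> "cut (E g) \<delta>" "E g"] cut by blast
  qed
  have below: "cocycle_below \<delta> (E g)" for g \<delta>
  proof (induction \<delta> rule: less_induct)
    case (less \<delta>)
    show ?case unfolding cocycle_below_def
    proof (intro allI impI conjI)
      fix \<sigma> assume "\<sigma> < \<delta>"
      show "E g \<sigma> \<sigma> = 1" by (subst E) (simp add: \<Phi>_def)
      let ?b = "row \<sigma> (cut (E g) \<sigma>)"
      have b: "is_row \<sigma> (E g) ?b" using row less \<open>\<sigma> < \<delta>\<close> by blast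
      have eq: "E g \<sigma> \<tau> = (if g \<sigma> \<and> \<sigma> \<in> C then ?b \<tau> * w \<sigma> \<tau> else ?b \<tau>)" if "\<tau> < \<sigma>" for \<tau>
        by (subst E) (use that in \<open>auto simp: \<Phi>_def\<close>)
      have "is_row \<sigma> (E g) (\<lambda>\<tau>. if g \<sigma> \<and> \<sigma> \<in> C then ?b \<tau> * w \<sigma> \<tau> else ?b \<tau>)"
        using is_row_twist[OF b w] b by (cases "g \<sigma> \<and> \<sigma> \<in> C") auto
      then show "is_row \<sigma> (E g) (E g \<sigma>)" 
        by (rule iffD1[OF is_row_cong_row, rotated]) (simp add: eq)
    qed
  qed
  \<comment> \<open>Row \<delta> uses the bits up to \<delta> only; so two choices that first differ
    at \<delta> twist one and the same row there.\<close>
  have agree: "E g \<delta> = E g' \<delta>" if "\<forall>\<sigma>\<le>\<delta>. g \<sigma> = g' \<sigma>" for g g' \<delta>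
    using that
  proof (induction \<delta> rule: less_induct)
    case (less \<delta>)
    have "cut (E g) \<delta> = cut (E g') \<delta>" unfolding cut_def using less by fastforce
    moreover have "g \<delta> = g' \<delta>" using less.prems by simp
    ultimately have "\<Phi> g \<delta> (cut (E g) \<delta>) = \<Phi> g' \<delta> (cut (E g') \<delta>)"
      unfolding \<Phi>_def by (intro ext) auto
    then show ?case by (simp only: E[symmetric])
  qed
  have key: False if \<delta>: "\<delta> \<in> C" and gc: "\<forall>\<sigma><\<delta>. g \<sigma> = g' \<sigma> \<and> c \<sigma> = c' \<sigma>" and g: "\<not> g \<delta>" "g' \<delta>"
    and c: "trivializes c (E g)" and c': "trivializes c' (E g')" for g g' c c' \<delta>
  proof -
    let ?b = "row \<delta> (cut (E g) \<delta>)"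
    have "E g \<sigma> = E g' \<sigma>" if "\<sigma> < \<delta>" for \<sigma>
      using gc that by (intro agree) (auto dest: le_less_trans)
    then have cut_eq: "cut (E g) \<delta> = cut (E g') \<delta>" unfolding cut_def by auto
    \<comment> \<open>With this inverse, \<open>c \<delta> * v\<close> is the forbidden
      limit.\<close>
    obtain v where v: "c' \<delta> * v = 1" using c' unfolding trivializes_def by (metis dvdE)
    have "eqm (r \<tau>) (c \<delta> * v) (w \<delta> \<tau>)" if "\<tau> < \<delta>" for \<tau>
    proof -
      have "E g \<delta> \<tau> = ?b \<tau>" by (subst E) (use that g in \<open>auto simp: \<Phi>_def\<close>)
      then have 1: "eqm (r \<tau>) (c \<tau>) (c \<delta> * ?b \<tau>)"
        using trivializesD[OF c, of \<tau> \<delta>] that by simp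
      have "E g' \<delta> \<tau> = ?b \<tau> * w \<delta> \<tau>"
        by (subst E) (use that g \<delta> cut_eq in \<open>auto simp: \<Phi>_def\<close>)
      then have 2: "eqm (r \<tau>) (c \<tau>) (c' \<delta> * (?b \<tau> * w \<delta> \<tau>))"
        using trivializesD[OF c', of \<tau> \<delta>] that gc by simp
      have "eqm (r \<tau>) (?b \<tau> * c \<delta>) (?b \<tau> * (c' \<delta> * w \<delta> \<tau>))"
        using eqm_trans[OF eqm_sym[OF 1] 2] by (simp add: mult_ac)
      then have "eqm (r \<tau>) (c \<delta>) (c' \<delta> * w \<delta> \<tau>)"
        using eqm_cancel row[OF below] that unfolding is_row_def by blast
      from eqm_mult[OF this eqm_refl[of _ v]]
      have "eqm (r \<tau>) (c \<delta> * v) (w \<delta> \<tau> * (c' \<delta> * v))" by (simp add: mult_ac)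
      then show ?thesis using v by simp
    qed
    then show False using no_limit[OF \<delta>] by blast
  qed
  have "g \<delta> = g' \<delta>" if "\<delta> \<in> C" "\<forall>\<sigma><\<delta>. g \<sigma> = g' \<sigma> \<and> c \<sigma> = c' \<sigma>"
    "trivializes c (E g)" "trivializes c' (E g')" for g g' c c' \<delta>
    using key[of \<delta> g g' c c'] key[of \<delta> g' g c' c] that by auto
  then show ?thesis using below cocycleI by blast
qed

end

section \<open>The continuum embeds into \<open>R\<close>: weak diamond\<close>

definition club_om1 :: "om1 set \<Rightarrow> bool" where
  "club_om1 C \<longleftrightarrow> (\<forall>\<sigma>. \<exists>\<tau>\<in>C. \<sigma> < \<tau>) \<and>
     (\<forall>\<delta>. limit_om1 \<delta> \<longrightarrow> (\<forall>\<sigma><\<delta>. \<exists>\<tau>\<in>C. \<sigma> < \<tau> \<and> \<tau> < \<delta>) \<longrightarrow> \<delta> \<in> C)"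

text \<open>The supremum of the part of C up to \<beta> is either its maximum or a limit of elements
  of C, hence in C by closure.\<close>

lemma club_om1_last_below:
  assumes C: "club_om1 C" and \<alpha>: "\<alpha> \<in> C" "\<alpha> \<le> \<beta>"
  shows "\<exists>\<delta>\<in>C. \<delta> \<le> \<beta> \<and> (\<forall>\<gamma>\<in>C. \<delta> < \<gamma> \<longrightarrow> \<beta> < \<gamma>)"
proof -
  define \<delta> where "\<delta> = (LEAST x. \<forall>y\<in>C. y \<le> \<beta> \<longrightarrow> y \<le> x)"
  have ub: "\<forall>y\<in>C. y \<le> \<beta> \<longrightarrow> y \<le> \<delta>"
    unfolding \<delta>_def by (rule LeastI[of _ \<beta>]) simp
  have le: "\<delta> \<le> \<beta>" unfolding \<delta>_def by (rule Least_le) simp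
  have cof: "\<exists>y\<in>C. y \<le> \<beta> \<and> \<sigma> < y" if "\<sigma> < \<delta>" for \<sigma>
    using not_less_Least[OF that[unfolded \<delta>_def]] by (auto simp: not_le)
  have "\<delta> \<in> C"
  proof (rule ccontr)
    assume nC: "\<delta> \<notin> C"
    have cof': "\<exists>y\<in>C. \<sigma> < y \<and> y < \<delta>" if "\<sigma> < \<delta>" for \<sigma>
      using cof[OF that] ub nC by (metis le_less)
    have "\<alpha> < \<delta>" using \<alpha> ub nC by (metis le_less)
    then have "limit_om1 \<delta>" unfolding limit_om1_def using cof' by blast
    then show False using C nC cof' unfolding club_om1_def by blast
  qed
  moreover have "\<beta> < \<gamma>" if "\<gamma> \<in> C" "\<delta> < \<gamma>" for \<gamma>
    using ub that by (metis not_less)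
  ultimately show ?thesis using le by blast
qed

text \<open>The restriction of \<open>f\<close> to a countable segment packed into a single set of
  naturals, through an enumeration of that segment.\<close>

definition code_below :: "om1 \<Rightarrow> (om1 \<Rightarrow> nat set) \<Rightarrow> nat set" where
  "code_below \<gamma> f = {prod_encode (to_nat_on {..<\<gamma>} \<alpha>, m) | \<alpha> m. \<alpha> < \<gamma> \<and> m \<in> f \<alpha>}"

lemma code_below_inject:
  assumes "code_below \<gamma> f = code_below \<gamma> f'" "\<alpha> < \<gamma>"
  shows "f \<alpha> = f' \<alpha>"
proof -
  have inj: "inj_on (to_nat_on {..<\<gamma>}) {..<\<gamma>}"
    by (rule inj_on_to_nat_on[OF countable_lessThan_om1])
  have *: "m \<in> f \<alpha> \<longleftrightarrow> prod_encode (to_nat_on {..<\<gamma>} \<alpha>, m) \<in> code_below \<gamma> f" for f m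
    unfolding code_below_def using inj assms(2) by (auto dest: inj_onD)
  show ?thesis using *[of _ f] *[of _ f'] assms(1) by auto
qed

text \<open>The Devlin--Shelah argument: if each \<open>g\<close> had a \<open>c g\<close> such that \<open>g\<close> and \<open>c g\<close> below
  \<open>\<delta> \<in> C\<close> determine \<open>g \<delta>\<close>, then \<open>2 ^ \<aleph>\<^sub>1 \<le> 2 ^ \<aleph>\<^sub>0\<close>. The map \<open>\<Phi>\<close> below is built so that \<open>\<Phi> f\<close> below
  \<open>\<delta>\<close> determines \<open>f\<close> up to the next element of \<open>C\<close>; hence all the iterates \<open>\<Phi> ^^ n\<close> of \<open>f\<close> on the
  countable segment below the least element of \<open>C\<close> determine \<open>f\<close>.\<close>

lemma determined_imp_few_functions:
  fixes c :: "(om1 \<Rightarrow> bool) \<Rightarrow> om1 \<Rightarrow> 'a" and j :: "'a \<Rightarrow> nat set"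
  assumes C: "club_om1 C" and j: "inj j"
    and det: "\<forall>g g'. \<forall>\<delta>\<in>C. (\<forall>\<sigma><\<delta>. g \<sigma> = g' \<sigma> \<and> c g \<sigma> = c g' \<sigma>) \<longrightarrow> g \<delta> = g' \<delta>"
  shows "\<exists>\<Psi> :: (om1 \<Rightarrow> nat set) \<Rightarrow> nat set. inj \<Psi>"
proof -
  define nxt where "nxt \<delta> = (LEAST \<gamma>. \<gamma> \<in> C \<and> \<delta> < \<gamma>)" for \<delta>
  have nxt: "nxt \<delta> \<in> C \<and> \<delta> < nxt \<delta>" for \<delta>
    unfolding nxt_def by (rule LeastI_ex) (use C in \<open>auto simp: club_om1_def\<close>)
  define h where "h f \<delta> = code_below (nxt \<delta>) f" for f \<delta>
  \<comment> \<open>Tag 0 keeps the code \<open>h f \<alpha>\<close>; tag \<open>Suc k\<close> keeps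
    the value at \<alpha> of \<open>c\<close> for the function reading off the k-th bit of
    \<open>h f\<close>. Agreement of \<open>\<Phi> f\<close> and \<open>\<Phi> f'\<close> below
    \<delta> is thus the premise of \<open>det\<close> for all bits at once, and the bits at
    \<delta> decode \<open>f\<close> up to \<open>nxt \<delta>\<close>.\<close>
  define \<Phi> where "\<Phi> f \<alpha> = {prod_encode (0, m) | m. m \<in> h f \<alpha>} \<union>
      {prod_encode (Suc k, m) | k m. m \<in> j (c (\<lambda>\<delta>. k \<in> h f \<delta>) \<alpha>)}" for f \<alpha>
  have \<Phi>: "h f \<alpha> = h f' \<alpha> \<and> (\<forall>k. c (\<lambda>\<delta>. k \<in> h f \<delta>) \<alpha> = c (\<lambda>\<delta>. k \<in> h f' \<delta>) \<alpha>)"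
    if eq: "\<Phi> f \<alpha> = \<Phi> f' \<alpha>" for f f' \<alpha>
  proof -
    have 1: "m \<in> h f \<alpha> \<longleftrightarrow> prod_encode (0, m) \<in> \<Phi> f \<alpha>" for f m by (auto simp: \<Phi>_def)
    have 2: "m \<in> j (c (\<lambda>\<delta>. k \<in> h f \<delta>) \<alpha>) \<longleftrightarrow> prod_encode (Suc k, m) \<in> \<Phi> f \<alpha>" for f k m
      by (auto simp: \<Phi>_def)
    have "h f \<alpha> = h f' \<alpha>" using 1[of _ f] 1[of _ f'] eq by auto
    moreover have "j (c (\<lambda>\<delta>. k \<in> h f \<delta>) \<alpha>) = j (c (\<lambda>\<delta>. k \<in> h f' \<delta>) \<alpha>)" for k
      using 2[of _ k f] 2[of _ k f'] eq by auto
    then have "c (\<lambda>\<delta>. k \<in> h f \<delta>) \<alpha> = c (\<lambda>\<delta>. k \<in> h f' \<delta>) \<alpha>" for k by (rule injD[OF j])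
    ultimately show ?thesis by blast
  qed
  have step: "f \<beta> = f' \<beta>" if \<delta>: "\<delta> \<in> C" and eq: "\<forall>\<sigma><\<delta>. \<Phi> f \<sigma> = \<Phi> f' \<sigma>" and \<beta>: "\<beta> < nxt \<delta>"
    for f f' \<delta> \<beta>
  proof -
    have "(k \<in> h f \<delta>) = (k \<in> h f' \<delta>)" for k
      
      using det[rule_format, of \<delta> "\<lambda>\<delta>. k \<in> h f \<delta>" "\<lambda>\<delta>. k \<in> h f' \<delta>"] \<Phi> eq \<delta> by blast
    then have "h f \<delta> = h f' \<delta>" by blast
    then show ?thesis using code_below_inject \<beta> unfolding h_def by blast
  qed
  define \<delta>0 where "\<delta>0 = (LEAST \<delta>. \<delta> \<in> C)"
  have \<delta>0: "\<delta>0 \<in> C" unfolding \<delta>0_def by (rule LeastI_ex) (use C in \<open>auto simp: club_om1_def\<close>)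
  define \<Psi> where "\<Psi> f = {prod_encode (n, m) | n m. m \<in> code_below \<delta>0 ((\<Phi> ^^ n) f)}" for f
  have "inj \<Psi>"
  proof (rule injI)
    fix f f' assume eq: "\<Psi> f = \<Psi> f'"
    have *: "m \<in> code_below \<delta>0 ((\<Phi> ^^ n) f) \<longleftrightarrow> prod_encode (n, m) \<in> \<Psi> f" for f n m
      by (auto simp: \<Psi>_def)
    have "code_below \<delta>0 ((\<Phi> ^^ n) f) = code_below \<delta>0 ((\<Phi> ^^ n) f')" for n
      using *[of _ n f] *[of _ n f'] eq by auto
    then have init: "(\<Phi> ^^ n) f \<beta> = (\<Phi> ^^ n) f' \<beta>" if "\<beta> < \<delta>0" for n \<beta>
      using code_below_inject that by blast
    \<comment> \<open>All iterates are treated together, because recovering the n-th iterate at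
      \<beta> uses the next iterate below \<delta>.\<close>
    have all: "\<forall>n. (\<Phi> ^^ n) f \<beta> = (\<Phi> ^^ n) f' \<beta>" for \<beta>
    proof (induction \<beta> rule: less_induct)
      case (less \<beta>)
      show ?case
      proof (cases "\<beta> < \<delta>0")
        case True
        then show ?thesis using init by blast
      next
        case False
        then obtain \<delta> where \<delta>: "\<delta> \<in> C" "\<delta> \<le> \<beta>" "\<forall>\<gamma>\<in>C. \<delta> < \<gamma> \<longrightarrow> \<beta> < \<gamma>"
          using club_om1_last_below[OF C \<delta>0] by (metis not_less)
        have "\<beta> < nxt \<delta>" using \<delta>(3) nxt by blast
        moreover have "\<forall>\<sigma><\<delta>. \<Phi> ((\<Phi> ^^ n) f) \<sigma> = \<Phi> ((\<Phi> ^^ n) f') \<sigma>" for n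
        proof (intro allI impI)
          fix \<sigma> assume "\<sigma> < \<delta>"
          then have "(\<Phi> ^^ Suc n) f \<sigma> = (\<Phi> ^^ Suc n) f' \<sigma>"
            using less \<delta>(2) by (meson less_le_trans)
          then show "\<Phi> ((\<Phi> ^^ n) f) \<sigma> = \<Phi> ((\<Phi> ^^ n) f') \<sigma>" by simp
        qed
        ultimately show ?thesis using step[OF \<delta>(1)] by blast
      qed
    qed
    show "f = f'"
    proof
      fix \<beta>
      show "f \<beta> = f' \<beta>" using all[of \<beta>] by (metis funpow_0)
    qed
  qed
  then show ?thesis by blast
qed

lemma no_inj_Pow: "\<not> inj (F :: 'a set \<Rightarrow> 'a)"
proof
  assume "inj F"
  then have "range (inv F) = Pow UNIV" by (simp add: inj_imp_surj_inv)
  then show False using Cantors_theorem by metis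
qed

text \<open>If every cocycle were trivial, a choice of trivializations would satisfy the
  determination hypothesis. Then the functions from \<open>om1\<close> to \<open>nat set\<close>
  inject into \<open>nat set\<close> and further into R; taking characteristic functions along
  \<open>i\<close>, the power set of R would inject into R.\<close>

lemma (in valuation_chain) nontrivial_cocycle_CH:
  assumes C: "club_om1 C"
    and w: "\<forall>\<delta>\<in>C. unit_net \<delta> (w \<delta>)"
    and no_limit: "\<forall>\<delta>\<in>C. \<forall>u. \<exists>\<tau><\<delta>. \<not> eqm (r \<tau>) u (w \<delta> \<tau>)"
    and i: "inj (i :: 'a \<Rightarrow> om1)" and l: "inj (l :: nat set \<Rightarrow> 'a)"
  shows "\<exists>e. cocycle e \<and> (\<nexists>c. trivializes c e)"
proof (rule ccontr)
  assume triv: "\<not> ?thesis"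
  obtain E where E: "\<forall>g :: om1 \<Rightarrow> bool. cocycle (E g)"
    and det: "\<forall>g g' c c' \<delta>. \<delta> \<in> C \<longrightarrow> (\<forall>\<sigma><\<delta>. g \<sigma> = g' \<sigma> \<and> c \<sigma> = c' \<sigma>) \<longrightarrow>
      trivializes c (E g) \<longrightarrow> trivializes c' (E g') \<longrightarrow> g \<delta> = g' \<delta>"
    using twisted_cocycles_exist[OF w no_limit] by (elim exE conjE)
  have "\<forall>g. \<exists>c. trivializes c (E g)" using triv E by blast
  then obtain c where c: "\<And>g. trivializes (c g) (E g)" by metis
  \<comment> \<open>The ordinals of \<open>omega1\<close> are represented by sets of naturals, so
    \<open>i\<close> already codes ring elements as such sets.\<close>
  have j: "inj (\<lambda>x. Rep_om1 (i x))"
    using i by (simp add: inj_on_def Rep_om1_inject)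
  have "\<forall>g g'. \<forall>\<delta>\<in>C. (\<forall>\<sigma><\<delta>. g \<sigma> = g' \<sigma> \<and> c g \<sigma> = c g' \<sigma>) \<longrightarrow> g \<delta> = g' \<delta>"
    using det c by blast
  from determined_imp_few_functions[OF C j this]
  obtain \<Psi> :: "(om1 \<Rightarrow> nat set) \<Rightarrow> nat set" where \<Psi>: "inj \<Psi>" by blast
  define F where "F A = l (\<Psi> (\<lambda>\<alpha>. if \<alpha> \<in> i ` A then {0} else {}))" for A
  have "inj F"
  proof (rule injI)
    fix A A' assume "F A = F A'"
    then have eq: "(\<lambda>\<alpha>. if \<alpha> \<in> i ` A then {0 :: nat} else {}) = (\<lambda>\<alpha>. if \<alpha> \<in> i ` A' then {0} else {})"
      using l \<Psi> unfolding F_def by (metis (no_types, lifting) injD)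
    have "\<alpha> \<in> i ` A \<longleftrightarrow> \<alpha> \<in> i ` A'" for \<alpha> using fun_cong[OF eq, of \<alpha>] by (auto split: if_splits)
    then have "i ` A = i ` A'" by blast
    then show "A = A'" using i by (simp add: inj_image_eq_iff)
  qed
  then show False using no_inj_Pow by blast
qed

section \<open>Uncountable quotients below the continuum\<close>

lemma invertible_prod:
  fixes f :: "nat \<Rightarrow> 'a::comm_ring_1"
  shows "(\<And>k. invertible (f k)) \<Longrightarrow> invertible (\<Prod>k<n. f k)"
  by (induction n) (auto intro: invertible_mult)

context valuation_chain
begin

text \<open>\<open>P\<close> must be insensitive to values outside the part below \<delta>, since
  the recursion overwrites the diagonal entry by 1.\<close>

lemma cocycle_recursion:
  assumes cong: "\<And>\<delta> b b'. (\<And>\<tau>. \<tau> < \<delta> \<Longrightarrow> b \<tau> = b' \<tau>) \<Longrightarrow> P \<delta> b = P \<delta> b'"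
    and step: "\<And>\<delta> e. cocycle_below \<delta> e \<Longrightarrow> \<forall>\<sigma><\<delta>. P \<sigma> (e \<sigma>) \<Longrightarrow> \<exists>b. is_row \<delta> e b \<and> P \<delta> b"
  shows "\<exists>e. cocycle e \<and> (\<forall>\<delta>. P \<delta> (e \<delta>))"
proof -
  define row where "row \<delta> e = (SOME b. is_row \<delta> e b \<and> P \<delta> b)" for \<delta> and e :: "om1 \<Rightarrow> om1 \<Rightarrow> 'a"
  define \<Phi> where "\<Phi> \<delta> e = (row \<delta> e)(\<delta> := 1)" for \<delta> and e :: "om1 \<Rightarrow> om1 \<Rightarrow> 'a"
  define cut where "cut E \<delta> = (\<lambda>\<sigma>. if \<sigma> < \<delta> then E \<sigma> else undefined)"
    for E :: "om1 \<Rightarrow> om1 \<Rightarrow> 'a" and \<delta>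
  obtain E where E: "\<And>\<delta>. E \<delta> = \<Phi> \<delta> (cut E \<delta>)"
    unfolding cut_def by (rule wfrec_om1[of \<Phi>]) blast
  have cut: "\<sigma> < \<delta> \<Longrightarrow> cut E \<delta> \<sigma> = E \<sigma>" for \<sigma> \<delta> by (simp add: cut_def)
  have good: "E \<delta> \<delta> = 1 \<and> is_row \<delta> E (E \<delta>) \<and> P \<delta> (E \<delta>)" for \<delta>
  proof (induction \<delta> rule: less_induct)
    case (less \<delta>)
    let ?b = "row \<delta> (cut E \<delta>)"
    have "cocycle_below \<delta> E" using less by (simp add: cocycle_below_def)
    then have "cocycle_below \<delta> (cut E \<delta>)"
      using cocycle_below_cong[of \<delta> "cut E \<delta>" E] cut by blast
    moreover have "\<forall>\<sigma><\<delta>. P \<sigma> (cut E \<delta> \<sigma>)" using less cut by simp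
    ultimately have "is_row \<delta> (cut E \<delta>) ?b \<and> P \<delta> ?b"
      unfolding row_def by (rule someI_ex[OF step])
    then have b: "is_row \<delta> E ?b" "P \<delta> ?b"
      using is_row_cong[of \<delta> "cut E \<delta>" E] cut by blast+
    have eq: "?b \<tau> = E \<delta> \<tau>" if "\<tau> < \<delta>" for \<tau>
      by (subst E) (use that in \<open>auto simp: \<Phi>_def\<close>)
    have "E \<delta> \<delta> = 1" by (subst E) (simp add: \<Phi>_def)
    moreover have "is_row \<delta> E (E \<delta>)" by (rule iffD1[OF is_row_cong_row b(1)]) (rule eq)
    moreover have "P \<delta> (E \<delta>)" by (rule iffD1[OF cong b(2)]) (rule eq)
    ultimately show ?case by blast
  qed
  then have "cocycle E" by (intro cocycleI) (simp add: cocycle_below_def)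
  then show ?thesis using good by blast
qed

text \<open>Among the continuum many twists of a row by the products \<open>\<Prod>k. 1 + a k\<close> over subsets of
  \<open>\<nat>\<close>, two would share the same unit \<open>u\<close>; at the first place where the subsets differ the quotient
  of the twists is \<open>1 + a n\<close>, which was chosen outside the countable set of quotients from \<open>S\<close>.\<close>

lemma irrational_row_exists:
  assumes nonunit: "\<forall>\<tau>. \<not> invertible (r \<tau>)"
    and big: "\<forall>\<sigma> S. countable S \<longrightarrow> (\<exists>a. (\<forall>\<tau><\<sigma>. r \<tau> dvd a) \<and> (\<forall>s\<in>S. \<not> eqm (r \<sigma>) a s))"
    and no_inj: "\<nexists>l :: nat set \<Rightarrow> 'a. inj l"
    and e: "cocycle_below \<delta> e" and \<delta>: "limit_om1 \<delta>" and S: "countable S"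
  shows "\<exists>b. is_row \<delta> e b \<and> (\<forall>u. invertible u \<longrightarrow> (\<exists>\<tau><\<delta>. \<forall>x\<in>S. \<not> eqm (r \<tau>) (u * b \<tau>) x))"
proof (rule ccontr)
  assume contra: "\<not> ?thesis"
  obtain b where b: "is_row \<delta> e b" using is_row_exists[OF e] by blast
  obtain d where lad: "ladder \<delta> d" using ladder_exists[OF \<delta>] by blast
  note d = ladderD[OF lad]
  \<comment> \<open>The elements \<open>y / x - 1\<close> for \<open>x\<close>, \<open>y\<close> in
    \<open>S\<close>; the chosen inverse is meaningful only for units \<open>x\<close>, the only
    ones to be used.\<close>
  define S' where "S' = (\<lambda>(x, y). y * (SOME v. x * v = 1) - 1) ` (S \<times> S)"
  have "countable S'" unfolding S'_def using S by blast
  then have "\<exists>a. (\<forall>\<tau><d (Suc n). r \<tau> dvd a) \<and> (\<forall>s\<in>S'. \<not> eqm (r (d (Suc n))) a s)" for n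
    using big by blast
  then obtain a where a: "\<And>n. (\<forall>\<tau><d (Suc n). r \<tau> dvd a n) \<and> (\<forall>s\<in>S'. \<not> eqm (r (d (Suc n))) (a n) s)"
    by metis
  have a_dvd: "r (d n) dvd a k" if "n \<le> k" for n k using a[of k] d that by simp
  define t where "t f k = 1 + (if k \<in> f then a k else 0)" for f k
  define V where "V f n = (\<Prod>k<n. t f k)" for f n
  have t_unit: "invertible (t f k)" for f k
  proof -
    have "\<not> invertible (a k)" using a_dvd[of k k] nonunit dvd_trans by blast
    then show ?thesis using unit_1_plus by (simp add: t_def)
  qed
  then have V_unit: "invertible (V f n)" for f n unfolding V_def by (rule invertible_prod)
  have V_coh: "eqm (r (d n)) (V f n) (V f m)" if "n \<le> m" for f n m
    using that
  proof (induction m rule: dec_induct)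
    case (step m)
    have "eqm (r (d n)) 1 (t f m)" using a_dvd[OF step(1)] by (simp add: t_def eqm_def)
    from eqm_mult[OF step(3) this] show ?case by (simp add: V_def)
  qed simp
  \<comment> \<open>Spreads the partial products from the rungs to all \<tau>: the first rung not
    below \<tau> decides, and rung \<open>d n\<close> itself gets exactly \<open>n\<close>
    factors.\<close>
  define N where "N \<tau> = (LEAST n. \<tau> \<le> d n)" for \<tau>
  have N: "\<tau> \<le> d (N \<tau>)" if "\<tau> < \<delta>" for \<tau>
    unfolding N_def using d(2)[OF that] by (metis LeastI_ex less_imp_le)
  have N_le: "N \<tau> \<le> n" if "\<tau> \<le> d n" for \<tau> n unfolding N_def using that by (rule Least_le)
  have N_d: "N (d n) = n" for n
    using N[of "d n"] N_le[of "d n" n] d by (simp add: antisym)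
  have "unit_net \<delta> (\<lambda>\<tau>. V f (N \<tau>))" for f
    unfolding unit_net_def
  proof (intro conjI allI impI V_unit)
    fix \<sigma> \<tau> assume st: "\<tau> \<le> \<sigma>" "\<sigma> < \<delta>"
    have "N \<tau> \<le> N \<sigma>" using N_le N st by (meson order_trans)
    then show "eqm (r \<tau>) (V f (N \<tau>)) (V f (N \<sigma>))"
      using eqm_mono[OF r_dvd V_coh, of \<tau> "N \<tau>" "N \<sigma>"] N[of \<tau>] st by simp
  qed
  then have row: "is_row \<delta> e (\<lambda>\<tau>. b \<tau> * V f (N \<tau>))" for f by (rule is_row_twist[OF b])
  have "\<exists>u. invertible u \<and> (\<forall>\<tau><\<delta>. \<exists>x\<in>S. eqm (r \<tau>) (u * (b \<tau> * V f (N \<tau>))) x)" for f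
  proof (rule ccontr)
    assume "\<not> ?thesis"
    then have "\<forall>u. invertible u \<longrightarrow> (\<exists>\<tau><\<delta>. \<forall>x\<in>S. \<not> eqm (r \<tau>) (u * (b \<tau> * V f (N \<tau>))) x)"
      by blast
    with row[of f] have "is_row \<delta> e (\<lambda>\<tau>. b \<tau> * V f (N \<tau>)) \<and>
        (\<forall>u. invertible u \<longrightarrow> (\<exists>\<tau><\<delta>. \<forall>x\<in>S. \<not> eqm (r \<tau>) (u * (b \<tau> * V f (N \<tau>))) x))" by (rule conjI)
    then show False by (rule notE[OF contra, OF exI])
  qed
  then obtain u where u: "\<And>f. invertible (u f)"
    and uS: "\<And>f \<tau>. \<tau> < \<delta> \<Longrightarrow> \<exists>x\<in>S. eqm (r \<tau>) (u f * (b \<tau> * V f (N \<tau>))) x" by metis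
  have "\<not> inj u" using no_inj by blast
  then obtain f f' where ff: "u f = u f'" "f \<noteq> f'" by (auto simp: inj_on_def)
  define n where "n = (LEAST n. (n \<in> f) \<noteq> (n \<in> f'))"
  have ex: "\<exists>n. (n \<in> f) \<noteq> (n \<in> f')" using ff(2) by blast
  have n: "(n \<in> f) \<noteq> (n \<in> f')" unfolding n_def using ex by (rule LeastI_ex)
  have below: "(k \<in> f) = (k \<in> f')" if "k < n" for k using that not_less_Least unfolding n_def by blast
  have key: False if ff: "u f = u f'" and n: "n \<notin> f" "n \<in> f'" and below: "\<And>k. k < n \<Longrightarrow> (k \<in> f) = (k \<in> f')"
    for f f' n
  proof -
    \<comment> \<open>The first rung whose product contains the n-th factor: there the twists for
      \<open>f\<close> and \<open>f'\<close> differ by exactly \<open>1 + a n\<close>, which would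
      be congruent to a quotient of elements of \<open>S\<close>.\<close>
    let ?\<tau> = "d (Suc n)" and ?r = "r (d (Suc n))"
    have "V f n = V f' n" unfolding V_def t_def using below by (intro prod.cong) auto
    then have V: "V f (Suc n) = V f n" "V f' (Suc n) = V f n * (1 + a n)"
      using n by (simp_all add: V_def t_def)
    obtain x y where x: "x \<in> S" "eqm ?r (u f * (b ?\<tau> * V f (Suc n))) x"
      and y: "y \<in> S" "eqm ?r (u f' * (b ?\<tau> * V f' (Suc n))) y"
      using uS[of ?\<tau> f] uS[of ?\<tau> f'] d(1) N_d by auto
    have "invertible (u f * (b ?\<tau> * V f (Suc n)))"
      using u V_unit b d(1) by (intro invertible_mult) (auto simp: is_row_def)
    then have "invertible x"
      using unit_cong[of ?r] nonunit eqm_sym[OF x(2)] unfolding eqm_def by blast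
    then have v: "x * (SOME v. x * v = 1) = 1" (is "x * ?v = 1") by (metis (mono_tags) dvdE someI)
    have "eqm ?r (x * (1 + a n)) (u f * (b ?\<tau> * V f (Suc n)) * (1 + a n))"
      by (rule eqm_mult[OF eqm_sym[OF x(2)] eqm_refl])
    moreover have "u f * (b ?\<tau> * V f (Suc n)) * (1 + a n) = u f' * (b ?\<tau> * V f' (Suc n))"
      by (simp add: V ff mult_ac)
    ultimately have "eqm ?r (x * (1 + a n)) y" using y(2) eqm_trans by metis
    from eqm_mult[OF this eqm_refl[of _ ?v]]
    have "eqm ?r ((x * ?v) * (1 + a n)) (y * ?v)" by (simp only: mult_ac)
    then have "eqm ?r (1 + a n) (y * ?v)" by (simp only: v mult_1)
    moreover have "1 + a n - y * ?v = a n - (y * ?v - 1)" by simp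
    ultimately have "eqm ?r (a n) (y * ?v - 1)" unfolding eqm_def by simp
    moreover have "y * ?v - 1 \<in> S'" unfolding S'_def using x(1) y(1) by auto
    ultimately show False using a by blast
  qed
  show False using key[of f f' n] key[of f' f n] n ff(1) below by auto
qed

text \<open>For a trivialization \<open>c\<close> choose a limit \<delta> closed under the index of
  \<open>c \<tau>\<close> in the filtration of R. Then \<open>c \<delta> * e \<delta> \<tau>\<close>
  is congruent to \<open>c \<tau>\<close>, a member of stage \<delta>, for every \<tau> < \<delta>;
  the row at \<delta> was built against exactly this.\<close>

lemma nontrivial_cocycle_uncountable:
  assumes nonunit: "\<forall>\<tau>. \<not> invertible (r \<tau>)"
    and big: "\<forall>\<sigma> S. countable S \<longrightarrow> (\<exists>a. (\<forall>\<tau><\<sigma>. r \<tau> dvd a) \<and> (\<forall>s\<in>S. \<not> eqm (r \<sigma>) a s))"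
    and no_inj: "\<nexists>l :: nat set \<Rightarrow> 'a. inj l" and i: "inj (i :: 'a \<Rightarrow> om1)"
  shows "\<exists>e. cocycle e \<and> (\<nexists>c. trivializes c e)"
proof -
  define P where "P \<delta> b \<longleftrightarrow> (limit_om1 \<delta> \<longrightarrow> (\<forall>u. invertible u \<longrightarrow>
      (\<exists>\<tau><\<delta>. \<forall>x\<in>{x. i x < \<delta>}. \<not> eqm (r \<tau>) (u * b \<tau>) x)))" for \<delta> and b :: "om1 \<Rightarrow> 'a"
  have "\<exists>e. cocycle e \<and> (\<forall>\<delta>. P \<delta> (e \<delta>))"
  proof (rule cocycle_recursion)
    show "P \<delta> b = P \<delta> b'" if "\<And>\<tau>. \<tau> < \<delta> \<Longrightarrow> b \<tau> = b' \<tau>" for \<delta> b b'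
    proof -
      have "(\<exists>\<tau><\<delta>. \<forall>x\<in>{x. i x < \<delta>}. \<not> eqm (r \<tau>) (u * b \<tau>) x) \<longleftrightarrow>
          (\<exists>\<tau><\<delta>. \<forall>x\<in>{x. i x < \<delta>}. \<not> eqm (r \<tau>) (u * b' \<tau>) x)" for u
        using that by auto
      then show ?thesis unfolding P_def by simp
    qed
    show "\<exists>b. is_row \<delta> e b \<and> P \<delta> b" if e: "cocycle_below \<delta> e" for \<delta> e
    proof (cases "limit_om1 \<delta>")
      case True
      have "countable (i ` {x. i x < \<delta>})"
        by (rule countable_subset[OF _ countable_lessThan_om1[of \<delta>]]) auto
      then have "countable {x. i x < \<delta>}"
        by (rule countable_image_inj_on) (use i in \<open>auto simp: inj_on_def\<close>)
      from irrational_row_exists[OF nonunit big no_inj e True this] show ?thesis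
        unfolding P_def by blast
    next
      case False
      then show ?thesis using is_row_exists[OF e] by (simp add: P_def)
    qed
  qed
  then obtain e where e: "cocycle e" "\<And>\<delta>. P \<delta> (e \<delta>)" by blast
  have "\<not> trivializes c e" for c
  proof
    assume c: "trivializes c e"
    obtain \<delta> where \<delta>: "limit_om1 \<delta>" "\<forall>\<tau><\<delta>. i (c \<tau>) < \<delta>"
      using limit_om1_closure[of "\<lambda>\<tau>. i (c \<tau>)"] by blast
    have "invertible (c \<delta>)" using c by (simp add: trivializes_def)
    then obtain \<tau> where \<tau>: "\<tau> < \<delta>" "\<forall>x\<in>{x. i x < \<delta>}. \<not> eqm (r \<tau>) (c \<delta> * e \<delta> \<tau>) x"
      using e(2)[of \<delta>] \<delta>(1) unfolding P_def by blast
    have "eqm (r \<tau>) (c \<delta> * e \<delta> \<tau>) (c \<tau>)"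
      using \<tau>(1) by (intro eqm_sym[OF trivializesD[OF c]]) simp
    then show False using \<tau> \<delta>(2) by blast
  qed
  then show ?thesis using e(1) by blast
qed

end

section \<open>Countable quotients: a special tree of units\<close>

text \<open>The tree is restricted to the unit group \<open>1 + z R\<close>, as only the quotients
  of \<open>z R\<close> are countable while the residue field may be large. \<open>q \<tau>\<close>
  lists the classes of that group modulo \<open>r \<tau>\<close>; \<open>big\<close> says that each
  level splits infinitely even after all lower levels are fixed.\<close>

locale countable_chain = valuation_chain r for r :: "om1 \<Rightarrow> 'a::idom" +
  fixes z :: 'a and q :: "om1 \<Rightarrow> nat \<Rightarrow> 'a"
  assumes z_nonunit: "\<not> invertible z" and z_dvd_r: "z dvd r \<tau>"
    and big: "finite S \<Longrightarrow> \<exists>a. z dvd a \<and> (\<forall>\<tau><\<sigma>. r \<tau> dvd a) \<and> (\<forall>s\<in>S. \<not> eqm (r \<sigma>) a s)"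
    and q_in: "eqm z (q \<tau> n) 1" and q_dense: "eqm z x 1 \<Longrightarrow> \<exists>n. eqm (r \<tau>) x (q \<tau> n)"
begin

definition G :: "'a set" where
  "G = {x. eqm z x 1}"

text \<open>The number of the class of \<open>x\<close> in the list for level \<tau>: an injection
  of that level of the tree into the naturals.\<close>

definition F :: "om1 \<Rightarrow> 'a \<Rightarrow> nat" where
  "F \<tau> x = (LEAST n. eqm (r \<tau>) x (q \<tau> n))"

lemma G_one [simp]: "1 \<in> G"
  by (simp add: G_def)

lemma G_q [simp]: "q \<tau> n \<in> G"
  by (simp add: G_def q_in)

lemma G_mult: "x \<in> G \<Longrightarrow> y \<in> G \<Longrightarrow> x * y \<in> G"
  unfolding G_def using eqm_mult[of z x 1 y 1] by simp

lemma G_unit: "x \<in> G \<Longrightarrow> invertible x"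
  using unit_cong[OF z_nonunit, of 1 x] by (simp add: G_def eqm_def)

lemma G_inverse: "x \<in> G \<Longrightarrow> \<exists>v\<in>G. x * v = 1"
proof -
  assume x: "x \<in> G"
  then obtain v where v: "x * v = 1" using G_unit by (metis dvdE)
  have "eqm z (x * v) (1 * v)" using x by (intro eqm_mult) (auto simp: G_def)
  then have "v \<in> G" using v eqm_sym by (auto simp: G_def)
  then show ?thesis using v by blast
qed

lemma G_1_plus: "z dvd a \<Longrightarrow> 1 + a \<in> G"
  by (simp add: G_def eqm_def)

lemma F_cong: "eqm (r \<tau>) x y \<Longrightarrow> F \<tau> x = F \<tau> y"
proof -
  assume xy: "eqm (r \<tau>) x y"
  have "eqm (r \<tau>) x (q \<tau> n) \<longleftrightarrow> eqm (r \<tau>) y (q \<tau> n)" for n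
    using eqm_trans[OF xy] eqm_trans[OF eqm_sym[OF xy]] by blast
  then show ?thesis by (simp add: F_def)
qed

lemma F_inject: "x \<in> G \<Longrightarrow> y \<in> G \<Longrightarrow> F \<tau> x = F \<tau> y \<Longrightarrow> eqm (r \<tau>) x y"
proof -
  assume x: "x \<in> G" and y: "y \<in> G" and eq: "F \<tau> x = F \<tau> y"
  have "eqm (r \<tau>) x (q \<tau> (F \<tau> x))"
    unfolding F_def using q_dense[of x \<tau>] x by (auto simp: G_def intro: LeastI_ex)
  moreover have "eqm (r \<tau>) y (q \<tau> (F \<tau> y))"
    unfolding F_def using q_dense[of y \<tau>] y by (auto simp: G_def intro: LeastI_ex)
  ultimately show ?thesis using eq eqm_trans eqm_sym by metis
qed

text \<open>\<open>F\<close> specialises the tree of units: along each \<open>u b\<close> with \<open>u \<in> G\<close> it is finite-to-one. The last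
  condition lets every node be extended to higher levels while keeping \<open>F\<close> large along finitely many
  translates, which is what keeps the recursion going at limits.\<close>

definition special_row :: "om1 \<Rightarrow> (om1 \<Rightarrow> 'a) \<Rightarrow> bool" where
  "special_row \<delta> b \<longleftrightarrow> (\<forall>\<tau><\<delta>. b \<tau> \<in> G) \<and>
     (\<forall>u\<in>G. \<forall>n. finite {\<tau>. \<tau> < \<delta> \<and> F \<tau> (u * b \<tau>) \<le> n}) \<and>
     (\<forall>\<tau><\<delta>. \<forall>X u n. finite X \<longrightarrow> X \<subseteq> G \<longrightarrow> u \<in> G \<longrightarrow>
        (\<exists>w\<in>G. eqm (r \<tau>) (w * b \<tau>) u \<and> (\<forall>x\<in>X. \<forall>\<nu>. \<tau> < \<nu> \<longrightarrow> \<nu> < \<delta> \<longrightarrow> n \<le> F \<nu> (x * w * b \<nu>))))"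

lemma special_row_cong:
  assumes "\<And>\<tau>. \<tau> < \<delta> \<Longrightarrow> b \<tau> = b' \<tau>"
  shows "special_row \<delta> b = special_row \<delta> b'"
proof -
  have "{\<tau>. \<tau> < \<delta> \<and> F \<tau> (u * b \<tau>) \<le> n} = {\<tau>. \<tau> < \<delta> \<and> F \<tau> (u * b' \<tau>) \<le> n}" for u n
    using assms by auto
  moreover have "(\<forall>x\<in>X. \<forall>\<nu>. \<tau> < \<nu> \<longrightarrow> \<nu> < \<delta> \<longrightarrow> n \<le> F \<nu> (x * w * b \<nu>)) \<longleftrightarrow>
      (\<forall>x\<in>X. \<forall>\<nu>. \<tau> < \<nu> \<longrightarrow> \<nu> < \<delta> \<longrightarrow> n \<le> F \<nu> (x * w * b' \<nu>))" for X w \<tau> n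
    using assms by auto
  ultimately show ?thesis unfolding special_row_def using assms by simp
qed

text \<open>A factor \<open>1 + a\<close> with \<open>a\<close> divisible by every lower
  \<open>r \<nu>\<close> changes level \<sigma> alone. For each \<open>x\<close> and each value
  below \<open>n\<close> just one class of \<open>a\<close> is bad, so finitely many are to be
  avoided.\<close>

lemma avoid_small:
  assumes X: "finite X" "X \<subseteq> G" and w: "w \<in> G"
  shows "\<exists>w'\<in>G. (\<forall>\<nu><\<sigma>. eqm (r \<nu>) w' w) \<and> (\<forall>x\<in>X. n \<le> F \<sigma> (x * w'))"
proof -
  \<comment> \<open>A representative of the bad class for \<open>x\<close> and \<open>k\<close>;
    arbitrary if there is none, which does no harm.\<close>
  define s where "s x k = (SOME s. z dvd s \<and> F \<sigma> (x * (w * (1 + s))) = k)" for x k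
  have "finite ((\<lambda>(x, k). s x k) ` (X \<times> {..<n}))" using X by simp
  from big[OF this, of \<sigma>] obtain a where a: "z dvd a" "\<forall>\<tau><\<sigma>. r \<tau> dvd a"
    "\<forall>x\<in>X. \<forall>k<n. \<not> eqm (r \<sigma>) a (s x k)" by auto
  have "n \<le> F \<sigma> (x * (w * (1 + a)))" if x: "x \<in> X" for x
  proof (rule ccontr)
    define k where "k = F \<sigma> (x * (w * (1 + a)))"
    assume "\<not> ?thesis"
    then have k: "k < n" by (simp add: k_def)
    have "z dvd s x k \<and> F \<sigma> (x * (w * (1 + s x k))) = k"
      unfolding s_def by (rule someI[of _ a]) (simp add: a k_def)
    then have "eqm (r \<sigma>) (x * (w * (1 + a))) (x * (w * (1 + s x k)))"
      using x X w a by (intro F_inject G_mult G_1_plus) (auto simp: k_def)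
    then have "eqm (r \<sigma>) (1 + a) (1 + s x k)"
      using eqm_cancel G_unit x X w by (metis subsetD)
    then have "eqm (r \<sigma>) a (s x k)" by (simp add: eqm_def)
    then show False using a(3) x k by blast
  qed
  moreover have "eqm (r \<nu>) (w * (1 + a)) w" if "\<nu> < \<sigma>" for \<nu>
    using a(2) that by (simp add: eqm_def algebra_simps)
  ultimately show ?thesis using G_mult[OF w G_1_plus[OF a(1)]] by blast
qed

text \<open>Specialness controls the levels strictly below \<sigma>; the top level, where the row is
  1, is repaired by \<open>avoid_small\<close> without disturbing them.\<close>

lemma special_row_extend:
  assumes b: "special_row \<sigma> b" "b \<sigma> = 1" and \<tau>: "\<tau> \<le> \<sigma>"
    and X: "finite X" "X \<subseteq> G" and u: "u \<in> G"
  shows "\<exists>w\<in>G. eqm (r \<tau>) (w * b \<tau>) u \<and>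
    (\<forall>x\<in>X. \<forall>\<nu>. \<tau> < \<nu> \<longrightarrow> \<nu> \<le> \<sigma> \<longrightarrow> n \<le> F \<nu> (x * w * b \<nu>))"
proof (cases "\<tau> = \<sigma>")
  case True
  then show ?thesis using b u by (intro bexI[of _ u]) auto
next
  case False
  then have \<tau>: "\<tau> < \<sigma>" using \<tau> by simp
  then obtain w where w: "w \<in> G" "eqm (r \<tau>) (w * b \<tau>) u"
    "\<forall>x\<in>X. \<forall>\<nu>. \<tau> < \<nu> \<longrightarrow> \<nu> < \<sigma> \<longrightarrow> n \<le> F \<nu> (x * w * b \<nu>)"
    using b(1) X u unfolding special_row_def by blast
  obtain w' where w': "w' \<in> G" "\<forall>\<nu><\<sigma>. eqm (r \<nu>) w' w" "\<forall>x\<in>X. n \<le> F \<sigma> (x * w')"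
    using avoid_small[OF X w(1)] by blast
  have "eqm (r \<tau>) (w' * b \<tau>) (w * b \<tau>)" using w'(2) \<tau> by (intro eqm_mult) auto
  then have "eqm (r \<tau>) (w' * b \<tau>) u" using w(2) eqm_trans by blast
  moreover have "n \<le> F \<nu> (x * w' * b \<nu>)" if "x \<in> X" "\<tau> < \<nu>" "\<nu> \<le> \<sigma>" for x \<nu>
  proof (cases "\<nu> = \<sigma>")
    case True
    then show ?thesis using w'(3) that b(2) by simp
  next
    case False
    then have \<nu>: "\<nu> < \<sigma>" using that by simp
    then have "eqm (r \<nu>) (x * w' * b \<nu>) (x * w * b \<nu>)" using w'(2) by (intro eqm_mult) auto
    then show ?thesis using F_cong w(3) that \<nu> by metis
  qed
  ultimately show ?thesis using w'(1) by blast
qed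

lemma special_row_succ:
  assumes e: "special_row \<beta> (e \<beta>)" "e \<beta> \<beta> = 1" and \<beta>: "\<beta> < \<delta>" "\<And>\<sigma>. \<sigma> < \<delta> \<longleftrightarrow> \<sigma> \<le> \<beta>"
  shows "special_row \<delta> (e \<beta>)"
  unfolding special_row_def
proof (intro conjI allI impI ballI)
  show "e \<beta> \<tau> \<in> G" if "\<tau> < \<delta>" for \<tau>
    using e that by (cases "\<tau> = \<beta>") (auto simp: special_row_def \<beta>(2))
  show "finite {\<tau>. \<tau> < \<delta> \<and> F \<tau> (u * e \<beta> \<tau>) \<le> n}" if "u \<in> G" for u n
  proof (rule finite_subset)
    show "{\<tau>. \<tau> < \<delta> \<and> F \<tau> (u * e \<beta> \<tau>) \<le> n} \<subseteq> insert \<beta> {\<tau>. \<tau> < \<beta> \<and> F \<tau> (u * e \<beta> \<tau>) \<le> n}"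
      by (auto simp: \<beta>(2))
    show "finite (insert \<beta> {\<tau>. \<tau> < \<beta> \<and> F \<tau> (u * e \<beta> \<tau>) \<le> n})"
      using e(1) that by (simp add: special_row_def)
  qed
  show "\<exists>w\<in>G. eqm (r \<tau>) (w * e \<beta> \<tau>) u \<and>
      (\<forall>x\<in>X. \<forall>\<nu>. \<tau> < \<nu> \<longrightarrow> \<nu> < \<delta> \<longrightarrow> n \<le> F \<nu> (x * w * e \<beta> \<nu>))"
    if "\<tau> < \<delta>" "finite X" "X \<subseteq> G" "u \<in> G" for \<tau> X u n
    unfolding \<beta>(2) using special_row_extend[OF e] that by (simp add: \<beta>(2))
qed

end

context countable_chain
begin

text \<open>One move of the limit construction. \<open>v\<close> meets the demand (\<alpha>,
  \<open>X\<close>, \<open>y\<close>, \<open>n\<close>) along \<open>e \<beta>\<close>, and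
  \<open>w = v / u\<close> carries it over to the row under construction. The translates
  \<open>x * w\<close> join the promises \<open>W'\<close>, and \<open>u'\<close> continues
  \<open>u\<close> to \<gamma> so that every promised translate has values at least \<open>j\<close>
  above \<beta>.\<close>

lemma commitment_step:
  assumes e: "cocycle_below \<delta> e" "\<forall>\<sigma><\<delta>. special_row \<sigma> (e \<sigma>)"
    and lt: "\<alpha> \<le> \<beta>" "\<beta> < \<gamma>" "\<gamma> < \<delta>" and u: "u \<in> G" and W: "finite W" "W \<subseteq> G"
    and X: "finite X" "X \<subseteq> G" and y: "y \<in> G"
  shows "\<exists>u' W'. u' \<in> G \<and> finite W' \<and> W' \<subseteq> G \<and> W \<subseteq> W' \<and>
    eqm (r \<beta>) u (u' * e \<gamma> \<beta>) \<and>
    (\<forall>x\<in>W'. \<forall>\<nu>. \<beta> < \<nu> \<longrightarrow> \<nu> \<le> \<gamma> \<longrightarrow> j \<le> F \<nu> (x * u' * e \<gamma> \<nu>)) \<and>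
    (\<exists>w\<in>G. eqm (r \<alpha>) (w * u * e \<beta> \<alpha>) y \<and> (\<forall>x\<in>X. x * w \<in> W' \<and>
      (\<forall>\<nu>. \<alpha> < \<nu> \<longrightarrow> \<nu> \<le> \<beta> \<longrightarrow> n \<le> F \<nu> (x * w * u * e \<beta> \<nu>))))"
proof -
  have spec: "special_row \<beta> (e \<beta>)" "special_row \<gamma> (e \<gamma>)" and one: "e \<beta> \<beta> = 1" "e \<gamma> \<gamma> = 1"
    using e cocycle_belowD(1)[OF e(1)] lt by auto
  obtain v where v: "v \<in> G" "eqm (r \<alpha>) (v * e \<beta> \<alpha>) y"
    "\<forall>x\<in>X. \<forall>\<nu>. \<alpha> < \<nu> \<longrightarrow> \<nu> \<le> \<beta> \<longrightarrow> n \<le> F \<nu> (x * v * e \<beta> \<nu>)"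
    using special_row_extend[OF spec(1) one(1) lt(1) X y] by blast
  obtain u'' where u'': "u'' \<in> G" "u * u'' = 1" using G_inverse[OF u] by blast
  define w where "w = v * u''"
  have w: "w \<in> G" unfolding w_def using v(1) u''(1) by (rule G_mult)
  have wu: "w * u = v" unfolding w_def using u''(2) by (simp add: mult.assoc mult.commute)
  define W' where "W' = W \<union> (\<lambda>x. x * w) ` X"
  have W': "finite W'" "W' \<subseteq> G" unfolding W'_def using W X w G_mult by auto
  obtain u' where u': "u' \<in> G" "eqm (r \<beta>) (u' * e \<gamma> \<beta>) u"
    "\<forall>x\<in>W'. \<forall>\<nu>. \<beta> < \<nu> \<longrightarrow> \<nu> \<le> \<gamma> \<longrightarrow> j \<le> F \<nu> (x * u' * e \<gamma> \<nu>)"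
    using special_row_extend[OF spec(2) one(2) less_imp_le[OF lt(2)] W' u] by blast
  have "eqm (r \<alpha>) (w * u * e \<beta> \<alpha>) y" using v(2) wu by simp
  moreover have "\<forall>x\<in>X. x * w \<in> W' \<and>
      (\<forall>\<nu>. \<alpha> < \<nu> \<longrightarrow> \<nu> \<le> \<beta> \<longrightarrow> n \<le> F \<nu> (x * w * u * e \<beta> \<nu>))"
    using v(3) by (auto simp: W'_def mult.assoc[of _ w u] wu)
  ultimately have "\<exists>w\<in>G. eqm (r \<alpha>) (w * u * e \<beta> \<alpha>) y \<and> (\<forall>x\<in>X. x * w \<in> W' \<and>
      (\<forall>\<nu>. \<alpha> < \<nu> \<longrightarrow> \<nu> \<le> \<beta> \<longrightarrow> n \<le> F \<nu> (x * w * u * e \<beta> \<nu>)))" using w by blast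
  moreover have "W \<subseteq> W'" by (simp add: W'_def)
  ultimately show ?thesis using u' eqm_sym[OF u'(2)] W'
    by (intro exI[of _ u'] exI[of _ W'] conjI)
qed

lemma special_row_limit:
  assumes e: "cocycle_below \<delta> e" and spec: "\<forall>\<sigma><\<delta>. special_row \<sigma> (e \<sigma>)" and \<delta>: "limit_om1 \<delta>"
  shows "\<exists>b. is_row \<delta> e b \<and> special_row \<delta> b"
proof -
  obtain d where lad: "ladder \<delta> d" using ladder_exists[OF \<delta>] by blast
  note d = ladderD[OF lad]
  note D = cocycle_belowD[OF e]
  define p where "p = q \<delta>"
  have p_in [simp]: "p n \<in> G" for n by (simp add: p_def)
  have p_dense: "\<exists>n. eqm (r \<delta>) x (p n)" if "x \<in> G" for x
    using q_dense[of x \<delta>] that by (simp add: p_def G_def)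
  \<comment> \<open>Discarding one component makes every demand recur at arbitrarily late steps, so
    it can be served once \<open>j\<close> exceeds both \<open>k\<close> and
    \<open>n\<close>.\<close>
  define dem :: "nat \<Rightarrow> nat \<times> nat list \<times> nat \<times> nat" where "dem j = from_nat (fst (prod_decode j))" for j
  define met where "met j u W \<longleftrightarrow> (\<forall>k L m n. dem j = (k, L, m, n) \<longrightarrow> k \<le> j \<longrightarrow>
      (\<exists>w\<in>G. eqm (r (d k)) (w * u * e (d j) (d k)) (p m) \<and> (\<forall>x\<in>p ` set L. x * w \<in> W \<and>
        (\<forall>\<nu>. d k < \<nu> \<longrightarrow> \<nu> \<le> d j \<longrightarrow> n \<le> F \<nu> (x * w * u * e (d j) \<nu>)))))" for j u W
  \<comment> \<open>Entering \<open>p j\<close> at step \<open>j\<close> puts every class of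
    \<open>G\<close> under promise eventually; this gives the finiteness clause.\<close>
  define ok where "ok j s \<longleftrightarrow> fst s \<in> G \<and> finite (snd s) \<and> snd s \<subseteq> G \<and> p j \<in> snd s"
    for j :: nat and s :: "'a \<times> 'a set"
  define succeeds where "succeeds j s s' \<longleftrightarrow> snd s \<subseteq> snd s' \<and> eqm (r (d j)) (fst s) (fst s' * e (d (Suc j)) (d j)) \<and>
      (\<forall>x\<in>snd s'. \<forall>\<nu>. d j < \<nu> \<longrightarrow> \<nu> \<le> d (Suc j) \<longrightarrow> j \<le> F \<nu> (x * fst s' * e (d (Suc j)) \<nu>)) \<and>
      met j (fst s) (snd s')" for j and s s' :: "'a \<times> 'a set"
  have "\<exists>st. \<forall>j. ok j (st j) \<and> succeeds j (st j) (st (Suc j))"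
  proof (rule dependent_nat_choice)
    show "\<exists>s. ok 0 s" by (rule exI[of _ "(1, {p 0})"]) (simp add: ok_def)
  next
    fix s j assume s: "ok j s"
    obtain k L m n where dem: "dem j = (k, L, m, n)" by (metis prod_cases4)
    \<comment> \<open>A demand with \<open>k > j\<close> comes too early and \<open>met\<close> is
      vacuous for it; the minimum merely keeps the step well formed.\<close>
    define k' where "k' = min k j"
    have "d k' \<le> d j" "d j < d (Suc j)" "d (Suc j) < \<delta>" using d by (auto simp: k'_def)
    moreover have "fst s \<in> G" "finite (insert (p (Suc j)) (snd s))" "insert (p (Suc j)) (snd s) \<subseteq> G"
      using s by (auto simp: ok_def)
    moreover have "finite (p ` set L)" "p ` set L \<subseteq> G" "p m \<in> G" by auto
    ultimately have "\<exists>u' W'. u' \<in> G \<and> finite W' \<and> W' \<subseteq> G \<and> insert (p (Suc j)) (snd s) \<subseteq> W' \<and>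
      eqm (r (d j)) (fst s) (u' * e (d (Suc j)) (d j)) \<and>
      (\<forall>x\<in>W'. \<forall>\<nu>. d j < \<nu> \<longrightarrow> \<nu> \<le> d (Suc j) \<longrightarrow> j \<le> F \<nu> (x * u' * e (d (Suc j)) \<nu>)) \<and>
      (\<exists>w\<in>G. eqm (r (d k')) (w * fst s * e (d j) (d k')) (p m) \<and> (\<forall>x\<in>p ` set L. x * w \<in> W' \<and>
        (\<forall>\<nu>. d k' < \<nu> \<longrightarrow> \<nu> \<le> d j \<longrightarrow> n \<le> F \<nu> (x * w * fst s * e (d j) \<nu>))))"
      by (rule commitment_step[OF e spec])
    then obtain u' W' where *: "u' \<in> G" "finite W'" "W' \<subseteq> G" "insert (p (Suc j)) (snd s) \<subseteq> W'"
      "eqm (r (d j)) (fst s) (u' * e (d (Suc j)) (d j))"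
      "\<forall>x\<in>W'. \<forall>\<nu>. d j < \<nu> \<longrightarrow> \<nu> \<le> d (Suc j) \<longrightarrow> j \<le> F \<nu> (x * u' * e (d (Suc j)) \<nu>)"
      "\<exists>w\<in>G. eqm (r (d k')) (w * fst s * e (d j) (d k')) (p m) \<and> (\<forall>x\<in>p ` set L. x * w \<in> W' \<and>
        (\<forall>\<nu>. d k' < \<nu> \<longrightarrow> \<nu> \<le> d j \<longrightarrow> n \<le> F \<nu> (x * w * fst s * e (d j) \<nu>)))"
      by (elim exE conjE)
    have "met j (fst s) W'"
      unfolding met_def
    proof (intro allI impI)
      fix k1 L1 m1 n1 assume "dem j = (k1, L1, m1, n1)" "k1 \<le> j"
      then have "k1 = k'" "L1 = L" "m1 = m" "n1 = n" using dem by (auto simp: k'_def)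
      then show "\<exists>w\<in>G. eqm (r (d k1)) (w * fst s * e (d j) (d k1)) (p m1) \<and>
          (\<forall>x\<in>p ` set L1. x * w \<in> W' \<and>
            (\<forall>\<nu>. d k1 < \<nu> \<longrightarrow> \<nu> \<le> d j \<longrightarrow> n1 \<le> F \<nu> (x * w * fst s * e (d j) \<nu>)))"
        using *(7) by simp
    qed
    then have "ok (Suc j) (u', W') \<and> succeeds j s (u', W')"
      using * by (simp add: ok_def succeeds_def)
    then show "\<exists>s'. ok (Suc j) s' \<and> succeeds j s s'" by blast
  qed
  then obtain st where st: "\<forall>j. ok j (st j) \<and> succeeds j (st j) (st (Suc j))" by blast
  define u where "u j = fst (st j)" for j
  define W where "W j = snd (st j)" for j
  have uG: "u j \<in> G" and pW: "p j \<in> W j" and W_Suc: "W j \<subseteq> W (Suc j)"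
    and u_Suc: "eqm (r (d j)) (u j) (u (Suc j) * e (d (Suc j)) (d j))"
    and high: "x \<in> W (Suc j) \<Longrightarrow> d j < \<nu> \<Longrightarrow> \<nu> \<le> d (Suc j) \<Longrightarrow> j \<le> F \<nu> (x * u (Suc j) * e (d (Suc j)) \<nu>)"
    and met: "met j (u j) (W (Suc j))" for j x \<nu>
    using st by (auto simp: ok_def succeeds_def u_def W_def)
  have W_mono: "W i \<subseteq> W j" if "i \<le> j" for i j using W_Suc that by (rule lift_Suc_mono_le)
  obtain b where row: "is_row \<delta> e b"
    and b: "\<forall>n \<tau>. \<tau> \<le> d n \<longrightarrow> eqm (r \<tau>) (b \<tau>) (u n * e (d n) \<tau>)"
    and b_ex: "\<forall>\<tau><\<delta>. \<exists>n. \<tau> \<le> d n \<and> b \<tau> = u n * e (d n) \<tau>"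
    using is_row_glue[OF e lad G_unit[OF uG] u_Suc] by (elim exE conjE)
  have eG: "e \<sigma> \<tau> \<in> G" if "\<sigma> < \<delta>" "\<tau> \<le> \<sigma>" for \<sigma> \<tau>
    using spec D(1) that by (cases "\<tau> = \<sigma>") (auto simp: special_row_def)
  have bG: "b \<tau> \<in> G" if "\<tau> < \<delta>" for \<tau>
    using b_ex that uG eG d(1) G_mult by metis
  have Fb: "F \<nu> (x * b \<nu>) = F \<nu> (x * u n * e (d n) \<nu>)" if "\<nu> \<le> d n" for x \<nu> n
    using eqm_mult[OF eqm_refl, of "r \<nu>" "b \<nu>" "u n * e (d n) \<nu>" x] b that
    by (intro F_cong) (simp add: mult.assoc)
  have high_b: "j \<le> F \<nu> (x * b \<nu>)" if x: "x \<in> W (Suc j)" and \<nu>: "d j < \<nu>" "\<nu> < \<delta>" for x j \<nu>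
  proof -
    \<comment> \<open>Locates the rung interval containing \<nu>. The promise kept there has bound
      \<open>i\<close>, and \<open>j \<le> i\<close>.\<close>
    define N where "N = (LEAST n. \<nu> \<le> d n)"
    have N: "\<nu> \<le> d N" unfolding N_def using d(2)[OF \<nu>(2)] by (metis LeastI_ex less_imp_le)
    have "j < N" using \<nu>(1) N d(4) by (metis less_le_trans)
    then obtain i where i: "N = Suc i" "j \<le> i" by (cases N) auto
    have "\<not> \<nu> \<le> d i" using not_less_Least[of i "\<lambda>n. \<nu> \<le> d n"] i by (simp add: N_def)
    then have "i \<le> F \<nu> (x * u (Suc i) * e (d (Suc i)) \<nu>)"
      using high[of x i \<nu>] N i W_mono[of "Suc j" "Suc i"] x by auto
    then show ?thesis using Fb[of \<nu> "Suc i" x] N i by simp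
  qed
  have F_rep: "F \<nu> (x * y) = F \<nu> (x' * y)" if "eqm (r \<delta>) x x'" "\<nu> < \<delta>" for x x' y \<nu>
    using eqm_mono[OF r_dvd[OF less_imp_le[OF that(2)]] that(1)] by (intro F_cong eqm_mult) auto
  have ext_d: "\<exists>w\<in>G. eqm (r (d k)) (w * b (d k)) v \<and>
      (\<forall>x\<in>X. \<forall>\<nu>. d k < \<nu> \<longrightarrow> \<nu> < \<delta> \<longrightarrow> n \<le> F \<nu> (x * w * b \<nu>))"
    if X: "finite X" "X \<subseteq> G" and v: "v \<in> G" for k X v n
  proof -
    obtain m where m: "eqm (r \<delta>) v (p m)" using p_dense[OF v] by blast
    have "\<forall>x\<in>X. \<exists>l. eqm (r \<delta>) x (p l)" using p_dense X by blast
    then obtain l where l: "\<forall>x\<in>X. eqm (r \<delta>) x (p (l x))" by metis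
    obtain L where L: "set L = l ` X" using finite_list[of "l ` X"] X by auto
    \<comment> \<open>The second component forces \<open>j\<close> above \<open>k\<close> and
      \<open>n\<close>: levels up to \<open>d j\<close> are settled by the demand, later ones by the
      promise with bound \<open>j\<close>.\<close>
    define j where "j = prod_encode (to_nat (k, L, m, n), max k n)"
    have j: "dem j = (k, L, m, n)" by (simp add: dem_def j_def)
    have "max k n \<le> j" unfolding j_def by (rule le_prod_encode_2)
    then have kj: "k \<le> j" "n \<le> j" by auto
    obtain w where w: "w \<in> G" "eqm (r (d k)) (w * u j * e (d j) (d k)) (p m)"
      "\<forall>x\<in>p ` set L. x * w \<in> W (Suc j) \<and>
        (\<forall>\<nu>. d k < \<nu> \<longrightarrow> \<nu> \<le> d j \<longrightarrow> n \<le> F \<nu> (x * w * u j * e (d j) \<nu>))"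
      using met[of j, unfolded met_def, rule_format, OF j kj(1)] by blast
    have "eqm (r (d k)) (w * b (d k)) (w * (u j * e (d j) (d k)))"
      by (rule eqm_mult[OF eqm_refl]) (use b d kj in auto)
    moreover have "eqm (r (d k)) (p m) v"
      using m eqm_mono[OF r_dvd eqm_sym] d(1) by (metis less_imp_le)
    ultimately have "eqm (r (d k)) (w * b (d k)) v"
      using w(2) eqm_trans by (metis mult.assoc)
    moreover have "n \<le> F \<nu> (x * w * b \<nu>)" if x: "x \<in> X" and \<nu>: "d k < \<nu>" "\<nu> < \<delta>" for x \<nu>
    proof -
      have lx: "p (l x) \<in> p ` set L" using x L by auto
      have "F \<nu> (x * w * b \<nu>) = F \<nu> (p (l x) * w * b \<nu>)"
        using F_rep[of x "p (l x)" \<nu> "w * b \<nu>"] l x \<nu> by (simp add: mult.assoc)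
      also have "n \<le> \<dots>"
      proof (cases "\<nu> \<le> d j")
        case True
        then show ?thesis using w(3) lx \<nu>(1) Fb[OF True, of "p (l x) * w"] by auto
      next
        case False
        then have "j \<le> F \<nu> (p (l x) * w * b \<nu>)" using high_b[of "p (l x) * w" j \<nu>] w(3) lx \<nu>(2) by auto
        then show ?thesis using kj(2) by simp
      qed
      finally show ?thesis .
    qed
    ultimately show ?thesis using w(1) by blast
  qed
  have "special_row \<delta> b"
    unfolding special_row_def
  proof (intro conjI allI impI ballI)
    show "b \<tau> \<in> G" if "\<tau> < \<delta>" for \<tau> using that by (rule bG)
    show "finite {\<tau>. \<tau> < \<delta> \<and> F \<tau> (x * b \<tau>) \<le> n}" if x: "x \<in> G" for x n
    proof -
      obtain m where m: "eqm (r \<delta>) x (p m)" using p_dense[OF x] by blast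
      \<comment> \<open>From this step on \<open>p m\<close> is promised with bound above
        \<open>n\<close>, so all small values lie at or below \<open>d j\<close>, where the special
        row \<open>e (d j)\<close> allows finitely many.\<close>
      define j where "j = max m (Suc n)"
      have "m \<le> Suc j" by (simp add: j_def)
      then have "p m \<in> W (Suc j)" using pW W_mono by blast
      then have hi: "Suc n \<le> F \<tau> (x * b \<tau>)" if "d j < \<tau>" "\<tau> < \<delta>" for \<tau>
        using high_b[of "p m" j \<tau>] F_rep[OF m, of \<tau> "b \<tau>"] that by (simp add: j_def)
      have "{\<tau>. \<tau> < \<delta> \<and> F \<tau> (x * b \<tau>) \<le> n} \<subseteq>
          insert (d j) {\<tau>. \<tau> < d j \<and> F \<tau> (x * u j * e (d j) \<tau>) \<le> n}"
      proof
        fix \<tau> assume "\<tau> \<in> {\<tau>. \<tau> < \<delta> \<and> F \<tau> (x * b \<tau>) \<le> n}"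
        then have \<tau>: "\<tau> < \<delta>" "F \<tau> (x * b \<tau>) \<le> n" by auto
        have "\<tau> \<le> d j" using hi[of \<tau>] \<tau> by (metis not_less not_less_eq_eq)
        then show "\<tau> \<in> insert (d j) {\<tau>. \<tau> < d j \<and> F \<tau> (x * u j * e (d j) \<tau>) \<le> n}"
          using \<tau>(2) Fb[of \<tau> j x] by auto
      qed
      moreover have "finite {\<tau>. \<tau> < d j \<and> F \<tau> (x * u j * e (d j) \<tau>) \<le> n}"
      proof -
        have "special_row (d j) (e (d j))" using spec d(1) by blast
        then show ?thesis using G_mult[OF x uG[of j]] by (simp add: special_row_def)
      qed
      ultimately show ?thesis using finite_subset by blast
    qed
    show "\<exists>w\<in>G. eqm (r \<tau>) (w * b \<tau>) v \<and>
        (\<forall>x\<in>X. \<forall>\<nu>. \<tau> < \<nu> \<longrightarrow> \<nu> < \<delta> \<longrightarrow> n \<le> F \<nu> (x * w * b \<nu>))"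
      if \<tau>: "\<tau> < \<delta>" and X: "finite X" "X \<subseteq> G" and v: "v \<in> G" for \<tau> X v n
    proof -
      \<comment> \<open>Off the ladder the target is first carried up to a rung by
        \<open>special_row_extend\<close>; the demand is then met from there.\<close>
      obtain k where k: "\<tau> < d k" using d(2)[OF \<tau>] by blast
      have "special_row (d k) (e (d k))" "e (d k) (d k) = 1" using spec D(1) d(1) by auto
      from special_row_extend[OF this less_imp_le[OF k] X v]
      obtain w' where w': "w' \<in> G" "eqm (r \<tau>) (w' * e (d k) \<tau>) v"
        "\<forall>x\<in>X. \<forall>\<nu>. \<tau> < \<nu> \<longrightarrow> \<nu> \<le> d k \<longrightarrow> n \<le> F \<nu> (x * w' * e (d k) \<nu>)" by blast
      obtain w where w: "w \<in> G" "eqm (r (d k)) (w * b (d k)) w'"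
        "\<forall>x\<in>X. \<forall>\<nu>. d k < \<nu> \<longrightarrow> \<nu> < \<delta> \<longrightarrow> n \<le> F \<nu> (x * w * b \<nu>)"
        using ext_d[OF X w'(1)] by blast
      have low: "eqm (r \<nu>) (w * b \<nu>) (w' * e (d k) \<nu>)" if "\<nu> \<le> d k" for \<nu>
      proof -
        have "eqm (r \<nu>) (w * b \<nu>) (w * (b (d k) * e (d k) \<nu>))"
          using row that d(1) by (intro eqm_mult[OF eqm_refl]) (auto simp: is_row_def)
        moreover have "eqm (r \<nu>) (w * b (d k) * e (d k) \<nu>) (w' * e (d k) \<nu>)"
          using eqm_mono[OF r_dvd[OF that] w(2)] by (intro eqm_mult) auto
        ultimately show ?thesis using eqm_trans by (metis mult.assoc)
      qed
      have "eqm (r \<tau>) (w * b \<tau>) v" using low[of \<tau>] k w'(2) eqm_trans by (metis less_imp_le)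
      moreover have "n \<le> F \<nu> (x * w * b \<nu>)" if "x \<in> X" "\<tau> < \<nu>" "\<nu> < \<delta>" for x \<nu>
      proof (cases "\<nu> \<le> d k")
        case True
        have "eqm (r \<nu>) (x * w * b \<nu>) (x * w' * e (d k) \<nu>)"
          using eqm_mult[OF eqm_refl low[OF True], of x] by (simp add: mult.assoc)
        then show ?thesis using F_cong w'(3) that True by metis
      next
        case False
        then show ?thesis using w(3) that by simp
      qed
      ultimately show ?thesis using w(1) by blast
    qed
  qed
  then show ?thesis using row by blast
qed

text \<open>A trivialization is an uncountable branch. Some value \<open>n\<close> of
  \<open>F\<close> occurs uncountably often along it; a countably infinite set of such levels lies
  below one \<delta>, and there the branch agrees with a unit multiple of the special row
  \<open>e \<delta>\<close>, on which \<open>n\<close> occurs only finitely often.\<close>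

lemma nontrivial_cocycle_countable: "\<exists>e. cocycle e \<and> (\<nexists>c. trivializes c e)"
proof -
  have "\<exists>e. cocycle e \<and> (\<forall>\<delta>. special_row \<delta> (e \<delta>))"
  proof (rule cocycle_recursion)
    show "special_row \<delta> b = special_row \<delta> b'" if "\<And>\<tau>. \<tau> < \<delta> \<Longrightarrow> b \<tau> = b' \<tau>" for \<delta> b b'
      using that by (rule special_row_cong)
    show "\<exists>b. is_row \<delta> e b \<and> special_row \<delta> b"
      if e: "cocycle_below \<delta> e" and spec: "\<forall>\<sigma><\<delta>. special_row \<sigma> (e \<sigma>)" for \<delta> e
    proof (cases \<delta> rule: om1_cases)
      case least
      then show ?thesis by (simp add: is_row_def special_row_def)
    next
      case (succ \<beta>)
      then have "special_row \<delta> (e \<beta>)"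
        using special_row_succ[of \<beta> e \<delta>] spec cocycle_belowD(1)[OF e] by blast
      then show ?thesis using is_row_succ[OF e] succ by blast
    next
      case limit
      then show ?thesis by (rule special_row_limit[OF e spec])
    qed
  qed
  then obtain e where e: "cocycle e" "\<And>\<delta>. special_row \<delta> (e \<delta>)" by blast
  have "\<not> trivializes c e" for c
  proof
    assume c: "trivializes c e"
    define \<alpha> :: om1 where "\<alpha> = (LEAST \<alpha>. True)"
    have \<alpha>: "\<alpha> \<le> \<tau>" for \<tau> unfolding \<alpha>_def by (rule Least_le) simp
    have eG: "e \<sigma> \<tau> \<in> G" if "\<tau> \<le> \<sigma>" for \<sigma> \<tau>
      using e that by (cases "\<tau> = \<sigma>") (auto simp: special_row_def cocycle_def)
    obtain v where v: "c \<alpha> * v = 1" using c unfolding trivializes_def by (metis dvdE)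
    \<comment> \<open>Dividing by the value at the least ordinal moves the trivialization into
      \<open>G\<close>, since the entries of \<open>e\<close> are 1 modulo \<open>z\<close>.\<close>
    define g where "g \<tau> = c \<tau> * v" for \<tau>
    have gG: "g \<tau> \<in> G" for \<tau>
    proof -
      have "eqm z (c \<alpha>) (c \<tau> * e \<tau> \<alpha>)"
        using eqm_mono[OF z_dvd_r trivializesD[OF c \<alpha>]] .
      moreover have "eqm z (c \<tau> * e \<tau> \<alpha>) (c \<tau> * 1)"
        using eG[OF \<alpha>] by (intro eqm_mult[OF eqm_refl]) (simp add: G_def)
      ultimately have "eqm z (c \<tau>) (c \<alpha>)" using eqm_trans eqm_sym by (metis mult_1_right)
      then have "eqm z (c \<tau> * v) (c \<alpha> * v)" by (rule eqm_mult[OF _ eqm_refl])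
      then show ?thesis using v by (simp add: g_def G_def)
    qed
    have g: "F \<tau> (g \<tau>) = F \<tau> (g \<delta> * e \<delta> \<tau>)" if "\<tau> \<le> \<delta>" for \<tau> \<delta>
    proof (rule F_cong)
      have "eqm (r \<tau>) (c \<tau> * v) (c \<delta> * e \<delta> \<tau> * v)"
        by (rule eqm_mult[OF trivializesD[OF c that] eqm_refl])
      then show "eqm (r \<tau>) (g \<tau>) (g \<delta> * e \<delta> \<tau>)" by (simp add: g_def mult_ac)
    qed
    have "\<exists>n. uncountable {\<tau>. F \<tau> (g \<tau>) = n}"
    proof (rule ccontr)
      assume "\<not> ?thesis"
      then have "countable (\<Union>n. {\<tau>. F \<tau> (g \<tau>) = n})" by (intro countable_UN) auto
      moreover have "(\<Union>n. {\<tau>. F \<tau> (g \<tau>) = n}) = UNIV" by auto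
      ultimately show False using uncountable_om1 by simp
    qed
    then obtain n where "infinite {\<tau>. F \<tau> (g \<tau>) = n}" using uncountable_infinite by blast
    then obtain A where A: "A \<subseteq> {\<tau>. F \<tau> (g \<tau>) = n}" "infinite A" "countable A"
      using infinite_countable_subset'[of "{\<tau>. F \<tau> (g \<tau>) = n}"] by blast
    obtain \<delta> where \<delta>: "\<forall>a\<in>A. a < \<delta>" using countable_bounded_om1[OF A(3)] by blast
    have "A \<subseteq> {\<tau>. \<tau> < \<delta> \<and> F \<tau> (g \<delta> * e \<delta> \<tau>) \<le> n}" 
    proof
      fix \<tau> assume "\<tau> \<in> A"
      then have "F \<tau> (g \<tau>) = n" "\<tau> < \<delta>" using A(1) \<delta> by auto
      then show "\<tau> \<in> {\<tau>. \<tau> < \<delta> \<and> F \<tau> (g \<delta> * e \<delta> \<tau>) \<le> n}" using g[of \<tau> \<delta>] by simp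
    qed
    moreover have "finite {\<tau>. \<tau> < \<delta> \<and> F \<tau> (g \<delta> * e \<delta> \<tau>) \<le> n}"
      using e(2)[of \<delta>] gG unfolding special_row_def by blast
    ultimately show False using A(2) finite_subset by blast
  qed
  then show ?thesis using e(1) by blast
qed

end

section \<open>Reduction to the three cases\<close>

definition incomplete_at :: "(om1 \<Rightarrow> 'a::idom) \<Rightarrow> om1 \<Rightarrow> bool" where
  "incomplete_at r \<delta> \<longleftrightarrow> (\<exists>x :: nat \<Rightarrow> 'a. (\<forall>\<sigma><\<delta>. \<exists>N. \<forall>m\<ge>N. \<forall>n\<ge>N. r \<sigma> dvd x m - x n) \<and>
     (\<nexists>y. \<forall>\<sigma><\<delta>. \<exists>N. \<forall>n\<ge>N. r \<sigma> dvd x n - y))"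

lemma olt_Rep_iff: "olt s (Rep_om1 \<delta>) \<longleftrightarrow> (\<exists>\<sigma><\<delta>. s = Rep_om1 \<sigma>)"
proof
  assume o: "olt s (Rep_om1 \<delta>)"
  then have "s \<in> Field omega1" by (auto simp: olt_def Field_def)
  then have "s = Rep_om1 (Abs_om1 s)" by (simp add: Abs_om1_inverse)
  then show "\<exists>\<sigma><\<delta>. s = Rep_om1 \<sigma>" using o by (metis less_om1_def)
qed (auto simp: less_om1_def)

lemma is_limit_Rep: "limit_om1 \<delta> \<Longrightarrow> is_limit (Rep_om1 \<delta>)"
  unfolding is_limit_def limit_om1_def olt_Rep_iff
  using Rep_om1 less_om1_def by blast

lemma cub_imp_club_om1:
  assumes "cub C"
  shows "club_om1 {\<sigma>. Rep_om1 \<sigma> \<in> C}"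
  unfolding club_om1_def
proof (intro conjI allI impI)
  fix \<sigma>
  obtain t where t: "t \<in> C" "olt (Rep_om1 \<sigma>) t" using assms Rep_om1 unfolding cub_def by blast
  then have "t = Rep_om1 (Abs_om1 t)" using assms by (auto simp: cub_def Abs_om1_inverse)
  then show "\<exists>\<tau>\<in>{\<sigma>. Rep_om1 \<sigma> \<in> C}. \<sigma> < \<tau>" using t by (metis less_om1_def mem_Collect_eq)
next
  fix \<delta> assume lim: "limit_om1 \<delta>" and cof: "\<forall>\<sigma><\<delta>. \<exists>\<tau>\<in>{\<sigma>. Rep_om1 \<sigma> \<in> C}. \<sigma> < \<tau> \<and> \<tau> < \<delta>"
  have "\<exists>t\<in>C. olt s t \<and> olt t (Rep_om1 \<delta>)" if "olt s (Rep_om1 \<delta>)" for s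
  proof -
    obtain \<sigma> where \<sigma>: "\<sigma> < \<delta>" "s = Rep_om1 \<sigma>" using \<open>olt s (Rep_om1 \<delta>)\<close> olt_Rep_iff by blast
    then show ?thesis using cof less_om1_def by blast
  qed
  then show "\<delta> \<in> {\<sigma>. Rep_om1 \<sigma> \<in> C}" using assms is_limit_Rep[OF lim] unfolding cub_def by blast
qed

lemma incomplete_at_Gamma_set:
  assumes "Rep_om1 \<delta> \<in> Gamma_set r"
  shows "incomplete_at (\<lambda>\<sigma>. r (Rep_om1 \<sigma>)) \<delta>"
proof -
  have *: "(\<forall>s. olt s (Rep_om1 \<delta>) \<longrightarrow> Q s) \<longleftrightarrow> (\<forall>\<sigma><\<delta>. Q (Rep_om1 \<sigma>))" for Q
    by (auto simp: olt_Rep_iff)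
  have "\<not> quot_complete r (Rep_om1 \<delta>)" using assms by (simp add: Gamma_set_def)
  then show ?thesis unfolding quot_complete_def incomplete_at_def * by blast
qed

lemma rep_of_om1:
  assumes "rep_of J r"
  shows "r (Rep_om1 \<sigma>) \<noteq> 0" and "\<tau> \<le> \<sigma> \<Longrightarrow> r (Rep_om1 \<tau>) dvd r (Rep_om1 \<sigma>)"
    and "J = (\<Union>\<sigma>. {emb x / emb (r (Rep_om1 \<sigma>)) | x. True})"
proof -
  show "r (Rep_om1 \<sigma>) \<noteq> 0" using assms Rep_om1 by (auto simp: rep_of_def)
  show "r (Rep_om1 \<tau>) dvd r (Rep_om1 \<sigma>)" if "\<tau> \<le> \<sigma>"
  proof (cases "\<tau> = \<sigma>")
    case False
    then have "olt (Rep_om1 \<tau>) (Rep_om1 \<sigma>)" using that by (simp add: less_om1_def[symmetric])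
    then show ?thesis using assms Rep_om1 unfolding rep_of_def by blast
  qed simp
  have "J = (\<Union>s\<in>range Rep_om1. {emb x / emb (r s) | x. True})"
    using assms bij_betw_imp_surj_on[OF om1_bij] by (simp add: rep_of_def Fract_eq_emb_divide)
  then show "J = (\<Union>\<sigma>. {emb x / emb (r (Rep_om1 \<sigma>)) | x. True})" by simp
qed

lemma valuation_domain_dvd_total:
  assumes "valuation_domain TYPE('a::idom)"
  shows "(a :: 'a) dvd b \<or> b dvd a"
proof -
  have ideal: "is_ideal {x. c dvd x}" for c :: 'a by (auto simp: is_ideal_def)
  then have "{x. a dvd x} \<subseteq> {x. b dvd x} \<or> {x. b dvd x} \<subseteq> {x. a dvd x}"
    using assms unfolding valuation_domain_def by simp
  then show ?thesis using dvd_refl[of a] dvd_refl[of b] by (metis mem_Collect_eq subsetD)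
qed

section \<open>Consequences of incompleteness, and thinning the chain\<close>

context valuation_chain
begin

text \<open>If all \<open>r \<tau>\<close> are units, everything converges to everything; if the
  ideals stabilise below \<delta>, a Cauchy sequence converges to one of its own late terms.\<close>

lemma incomplete_imp_strict:
  assumes inc: "incomplete_at r \<delta>"
  shows "(\<exists>\<tau><\<delta>. \<not> invertible (r \<tau>))" and "\<sigma> < \<delta> \<Longrightarrow> \<exists>\<tau><\<delta>. \<not> r \<tau> dvd r \<sigma>"
proof -
  obtain x :: "nat \<Rightarrow> 'a" where cau: "\<forall>\<sigma><\<delta>. \<exists>N. \<forall>m\<ge>N. \<forall>n\<ge>N. r \<sigma> dvd x m - x n"
    and nolim: "\<nexists>y. \<forall>\<sigma><\<delta>. \<exists>N. \<forall>n\<ge>N. r \<sigma> dvd x n - y"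
    using inc unfolding incomplete_at_def by blast
  show "\<exists>\<tau><\<delta>. \<not> invertible (r \<tau>)"
  proof (rule ccontr)
    assume "\<not> ?thesis"
    then have "r \<tau> dvd y" if "\<tau> < \<delta>" for \<tau> y using that dvd_trans[OF _ one_dvd] by blast
    then show False using nolim by blast
  qed
  show "\<exists>\<tau><\<delta>. \<not> r \<tau> dvd r \<sigma>" if "\<sigma> < \<delta>"
  proof (rule ccontr)
    assume "\<not> ?thesis"
    then have dv: "r \<tau> dvd r \<sigma>" if "\<tau> < \<delta>" for \<tau> using that by blast
    obtain N where N: "\<forall>m\<ge>N. \<forall>n\<ge>N. r \<sigma> dvd x m - x n" using cau \<open>\<sigma> < \<delta>\<close> by blast
    have "\<forall>n\<ge>N. r \<tau> dvd x n - x N" if "\<tau> < \<delta>" for \<tau>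
      using N dvd_trans[OF dv[OF that]] by blast
    then show False using nolim by blast
  qed
qed

text \<open>A Cauchy sequence without limit, normalised at \<theta> to be congruent to 1 modulo a
  nonunit, becomes a net of units; undoing the shift turns a limit of the net into one of the
  sequence.\<close>

lemma incomplete_imp_unit_net:
  assumes inc: "incomplete_at r \<delta>"
  shows "\<exists>w. unit_net \<delta> w \<and> (\<forall>u. \<exists>\<tau><\<delta>. \<not> eqm (r \<tau>) u (w \<tau>))"
proof -
  obtain x :: "nat \<Rightarrow> 'a" where cau: "\<forall>\<sigma><\<delta>. \<exists>N. \<forall>m\<ge>N. \<forall>n\<ge>N. r \<sigma> dvd x m - x n"
    and nolim: "\<nexists>y. \<forall>\<sigma><\<delta>. \<exists>N. \<forall>n\<ge>N. r \<sigma> dvd x n - y"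
    using inc unfolding incomplete_at_def by blast
  obtain \<theta> where \<theta>: "\<theta> < \<delta>" "\<not> invertible (r \<theta>)" using incomplete_imp_strict(1)[OF inc] by blast
  define N where "N \<sigma> = (SOME N. \<forall>m\<ge>N. \<forall>n\<ge>N. r \<sigma> dvd x m - x n)" for \<sigma>
  have N: "eqm (r \<sigma>) (x m) (x n)" if "\<sigma> < \<delta>" "N \<sigma> \<le> m" "N \<sigma> \<le> n" for \<sigma> m n
  proof -
    have "\<forall>m\<ge>N \<sigma>. \<forall>n\<ge>N \<sigma>. r \<sigma> dvd x m - x n"
      unfolding N_def by (rule someI_ex) (use cau that(1) in blast)
    then show ?thesis using that by (simp add: eqm_def)
  qed
  have coh: "eqm (r \<tau>) (x (N \<tau>)) (x (N \<sigma>))" if st: "\<tau> \<le> \<sigma>" "\<sigma> < \<delta>" for \<tau> \<sigma>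
  proof -
    let ?m = "max (N \<tau>) (N \<sigma>)"
    have "eqm (r \<tau>) (x (N \<tau>)) (x ?m)" using N[of \<tau> "N \<tau>" ?m] st by simp
    moreover have "eqm (r \<tau>) (x ?m) (x (N \<sigma>))"
      using eqm_mono[OF r_dvd[OF st(1)] N[of \<sigma> ?m "N \<sigma>"]] st by simp
    ultimately show ?thesis by (rule eqm_trans)
  qed
  \<comment> \<open>The constant 1 below \<theta> is still coherent, as all later values are 1
    modulo \<open>r \<theta>\<close>.\<close>
  define w where "w \<tau> = (if \<theta> \<le> \<tau> then 1 + (x (N \<tau>) - x (N \<theta>)) else 1)" for \<tau>
  have w1: "eqm (r \<theta>) (w \<tau>) 1" if "\<tau> < \<delta>" for \<tau>
    using eqm_sym[OF coh[of \<theta> \<tau>]] that by (auto simp: w_def eqm_def)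
  have "unit_net \<delta> w"
    unfolding unit_net_def
  proof (intro conjI allI impI)
    show "invertible (w \<tau>)" if "\<tau> < \<delta>" for \<tau>
      using unit_cong[OF \<theta>(2), of 1 "w \<tau>"] w1[OF that] by (simp add: eqm_def)
    show "eqm (r \<tau>) (w \<tau>) (w \<sigma>)" if st: "\<tau> \<le> \<sigma>" "\<sigma> < \<delta>" for \<tau> \<sigma>
    proof (cases "\<theta> \<le> \<tau>")
      case True
      then show ?thesis using coh[OF st] st by (simp add: w_def eqm_def)
    next
      case False
      then have "eqm (r \<tau>) (w \<sigma>) 1" using eqm_mono[OF r_dvd w1[OF st(2)]] by simp
      then have "eqm (r \<tau>) 1 (w \<sigma>)" by (rule eqm_sym)
      then show ?thesis using False by (simp add: w_def)
    qed
  qed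
  moreover have "\<exists>\<tau><\<delta>. \<not> eqm (r \<tau>) u (w \<tau>)" for u
  proof (rule ccontr)
    assume "\<not> ?thesis"
    then have u: "eqm (r \<tau>) u (w \<tau>)" if "\<tau> < \<delta>" for \<tau> using that by blast
    define y where "y = u - 1 + x (N \<theta>)"
    have y: "eqm (r \<tau>) (x (N \<tau>)) y" if "\<tau> < \<delta>" for \<tau>
    proof (cases "\<theta> \<le> \<tau>")
      case True
      then have "eqm (r \<tau>) u (1 + (x (N \<tau>) - x (N \<theta>)))" using u[OF that] by (simp add: w_def)
      then have "r \<tau> dvd u - (1 + (x (N \<tau>) - x (N \<theta>)))" by (simp add: eqm_def)
      also have "u - (1 + (x (N \<tau>) - x (N \<theta>))) = y - x (N \<tau>)" by (simp add: y_def)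
      finally have "eqm (r \<tau>) y (x (N \<tau>))" by (simp add: eqm_def)
      then show ?thesis by (rule eqm_sym)
    next
      case False
      then have le: "\<tau> \<le> \<theta>" by simp
      have "eqm (r \<theta>) u 1" using u[OF \<theta>(1)] by (simp add: w_def)
      then have "eqm (r \<theta>) y (x (N \<theta>))" by (simp add: eqm_def y_def)
      then have "eqm (r \<theta>) (x (N \<theta>)) y" by (rule eqm_sym)
      from eqm_trans[OF coh[OF le \<theta>(1)] eqm_mono[OF r_dvd[OF le] this]] show ?thesis .
    qed
    have "\<forall>n\<ge>N \<tau>. r \<tau> dvd x n - y" if "\<tau> < \<delta>" for \<tau>
    proof (intro allI impI)
      fix n assume "N \<tau> \<le> n"
      from eqm_trans[OF N[OF that this order_refl] y[OF that]]
      show "r \<tau> dvd x n - y" by (simp add: eqm_def)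
    qed
    then have "\<forall>\<tau><\<delta>. \<exists>M. \<forall>n\<ge>M. r \<tau> dvd x n - y" by blast
    then show False using nolim by blast
  qed
  ultimately show ?thesis by blast
qed

text \<open>Generators of a strictly decreasing sequence of ideals are pairwise incongruent modulo
  any \<open>r \<sigma>\<close> beyond all of them.\<close>

lemma infinite_quotient_step:
  assumes strict: "\<forall>\<sigma>. \<exists>\<tau>>\<sigma>. \<not> r \<tau> dvd r \<sigma>"
  shows "\<exists>\<sigma>>\<tau>. \<forall>S. finite S \<longrightarrow> (\<exists>a. r \<tau> dvd a \<and> (\<forall>s\<in>S. \<not> eqm (r \<sigma>) a s))"
proof -
  have "\<exists>d. \<forall>n. \<tau> \<le> d n \<and> d n < d (Suc n) \<and> \<not> r (d (Suc n)) dvd r (d n)"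
  proof -
    have "\<exists>d. \<forall>n::nat. \<tau> \<le> d n \<and> (d n < d (Suc n) \<and> \<not> r (d (Suc n)) dvd r (d n))"
    proof (rule dependent_nat_choice)
      show "\<exists>y. \<tau> \<le> y \<and> (x < y \<and> \<not> r y dvd r x)" if "\<tau> \<le> x" for x
        using strict that by (meson le_less_trans less_imp_le)
    qed auto
    then show ?thesis by blast
  qed
  then obtain d where d: "\<And>n. \<tau> \<le> d n" "\<And>n. d n < d (Suc n)" "\<And>n. \<not> r (d (Suc n)) dvd r (d n)"
    by blast
  have mono: "strict_mono d" using d(2) by (simp add: strict_mono_Suc_iff)
  obtain \<sigma> where \<sigma>: "\<And>n. d n < \<sigma>" using countable_bounded_om1[of "range d"] by auto
  have distinct: "\<not> eqm (r \<sigma>) (r (d m)) (r (d n))" if mn: "m < n" for m n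
  proof
    assume *: "eqm (r \<sigma>) (r (d m)) (r (d n))"
    have "eqm (r (d (Suc m))) (r (d m)) (r (d n))"
      using eqm_mono[OF r_dvd *] \<sigma> by (simp add: less_imp_le)
    moreover have "r (d (Suc m)) dvd r (d n)"
      using mono mn by (intro r_dvd) (simp add: strict_mono_less_eq)
    ultimately have "r (d (Suc m)) dvd (r (d m) - r (d n)) + r (d n)"
      unfolding eqm_def by (rule dvd_add)
    then show False using d(3) by simp
  qed
  have "\<exists>a. r \<tau> dvd a \<and> (\<forall>s\<in>S. \<not> eqm (r \<sigma>) a s)" if S: "finite S" for S
  proof (rule ccontr)
    assume "\<not> ?thesis"
    then have "\<forall>n. \<exists>s\<in>S. eqm (r \<sigma>) (r (d n)) s" using r_dvd[OF d(1)] by blast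
    then obtain s where s: "\<And>n. s n \<in> S" "\<And>n. eqm (r \<sigma>) (r (d n)) (s n)" by metis
    have "finite (range s)" using s(1) S by (meson finite_subset image_subsetI)
    then have "\<not> inj s" using finite_imageD[of s UNIV] by auto
    then obtain m n where "m \<noteq> n" "s m = s n" by (auto simp: inj_on_def)
    then obtain m n where mn: "m < n" "s m = s n" by (metis nat_neq_iff)
    have "eqm (r \<sigma>) (r (d m)) (r (d n))" using eqm_trans[OF s(2)[of m] eqm_sym] s(2)[of n] mn by simp
    then show False using distinct mn by blast
  qed
  moreover have "\<tau> < \<sigma>" using d(1)[of 0] \<sigma>[of 0] by simp
  ultimately show ?thesis by blast
qed

text \<open>\<open>K\<close> stands for finite or for countable sets. Each \<open>g \<sigma>\<close>
  lies one large step above a bound of all earlier values; an element divisible at that bound is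
  divisible by every earlier \<open>r (g \<tau>)\<close>.\<close>

lemma thinning:
  assumes step: "\<forall>\<tau>. \<exists>\<sigma>>\<tau>. \<forall>S. K S \<longrightarrow> (\<exists>a. r \<tau> dvd a \<and> (\<forall>s\<in>S. \<not> eqm (r \<sigma>) a s))"
  shows "\<exists>g :: om1 \<Rightarrow> om1. strict_mono g \<and> (\<forall>\<sigma>. \<theta> < g \<sigma> \<and> (\<forall>S. K S \<longrightarrow>
    (\<exists>a. r \<theta> dvd a \<and> (\<forall>\<tau><\<sigma>. r (g \<tau>) dvd a) \<and> (\<forall>s\<in>S. \<not> eqm (r (g \<sigma>)) a s))))"
proof -
  obtain nx where nx: "\<And>\<tau>. \<tau> < nx \<tau>"
    "\<And>\<tau> S. K S \<Longrightarrow> \<exists>a. r \<tau> dvd a \<and> (\<forall>s\<in>S. \<not> eqm (r (nx \<tau>)) a s)" using step by metis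
  define ub where "ub \<sigma> g = (SOME b. \<theta> \<le> b \<and> (\<forall>\<tau><\<sigma>. g \<tau> < b))" for \<sigma> and g :: "om1 \<Rightarrow> om1"
  have ub: "\<theta> \<le> ub \<sigma> g \<and> (\<forall>\<tau><\<sigma>. g \<tau> < ub \<sigma> g)" for \<sigma> g
  proof -
    have "countable (insert \<theta> (g ` {..<\<sigma>}))" using countable_lessThan_om1 by blast
    from countable_bounded_om1[OF this] have "\<exists>b. \<theta> \<le> b \<and> (\<forall>\<tau><\<sigma>. g \<tau> < b)"
      by (auto intro: less_imp_le)
    then show ?thesis unfolding ub_def by (rule someI_ex)
  qed
  obtain g where g: "\<And>\<sigma>. g \<sigma> = nx (ub \<sigma> (\<lambda>\<tau>. if \<tau> < \<sigma> then g \<tau> else undefined))"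
    by (rule wfrec_om1[of "\<lambda>\<sigma> g. nx (ub \<sigma> g)"]) blast
  define h where "h \<sigma> = ub \<sigma> (\<lambda>\<tau>. if \<tau> < \<sigma> then g \<tau> else undefined)" for \<sigma>
  have g_h: "g \<sigma> = nx (h \<sigma>)" for \<sigma> unfolding h_def by (rule g)
  have h: "\<theta> \<le> h \<sigma>" "\<tau> < \<sigma> \<Longrightarrow> g \<tau> < h \<sigma>" for \<sigma> \<tau>
    using ub[of \<sigma> "\<lambda>\<tau>. if \<tau> < \<sigma> then g \<tau> else undefined"] by (auto simp: h_def)
  have hg: "h \<sigma> < g \<sigma>" for \<sigma> unfolding g_h by (rule nx)
  have "strict_mono g" using h(2) hg by (meson less_trans strict_monoI)
  moreover have "\<theta> < g \<sigma>" for \<sigma> using h(1) hg by (meson le_less_trans)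
  moreover have "\<exists>a. r \<theta> dvd a \<and> (\<forall>\<tau><\<sigma>. r (g \<tau>) dvd a) \<and> (\<forall>s\<in>S. \<not> eqm (r (g \<sigma>)) a s)"
    if "K S" for S \<sigma>
  proof -
    obtain a where a: "r (h \<sigma>) dvd a" "\<forall>s\<in>S. \<not> eqm (r (g \<sigma>)) a s"
      using nx(2)[OF \<open>K S\<close>] unfolding g_h by blast
    have "r \<tau> dvd a" if "\<tau> \<le> h \<sigma>" for \<tau> using dvd_trans[OF r_dvd[OF that] a(1)] .
    then show ?thesis using a(2) h by (metis less_imp_le)
  qed
  ultimately show ?thesis by blast
qed

lemma valuation_chain_subsequence: "strict_mono (g :: om1 \<Rightarrow> om1) \<Longrightarrow> valuation_chain (\<lambda>\<sigma>. r (g \<sigma>))"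
  by unfold_locales (auto simp: dvd_total strict_mono_less_eq intro: r_dvd)

end

lemma strict_mono_om1_ge:
  fixes g :: "om1 \<Rightarrow> om1"
  assumes "strict_mono g"
  shows "\<sigma> \<le> g \<sigma>"
proof (induction \<sigma> rule: less_induct)
  case (less \<sigma>)
  show ?case
  proof (rule ccontr)
    assume "\<not> ?thesis"
    then have "g \<sigma> < \<sigma>" by simp
    then show False using less[of "g \<sigma>"] strict_monoD[OF assms, of "g \<sigma>" \<sigma>] by simp
  qed
qed

text \<open>A strictly increasing map of \<omega>1 is cofinal, so no denominators are lost.\<close>

lemma (in valuation_chain) union_subsequence:
  assumes g: "strict_mono (g :: om1 \<Rightarrow> om1)"
  shows "(\<Union>\<sigma>. {emb x / emb (r \<sigma>) | x. True}) = (\<Union>\<sigma>. {emb x / emb (r (g \<sigma>)) | x. True})"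
proof
  show "(\<Union>\<sigma>. {emb x / emb (r \<sigma>) | x. True}) \<subseteq> (\<Union>\<sigma>. {emb x / emb (r (g \<sigma>)) | x. True})"
  proof
    fix p assume "p \<in> (\<Union>\<sigma>. {emb x / emb (r \<sigma>) | x. True})"
    then obtain \<sigma> x where p: "p = emb x / emb (r \<sigma>)" by blast
    obtain k where k: "r (g \<sigma>) = r \<sigma> * k"
      using r_dvd[OF strict_mono_om1_ge[OF g, of \<sigma>]] by (metis dvdE)
    then have "k \<noteq> 0" using r_nonzero[of "g \<sigma>"] by auto
    then have "p = emb (x * k) / emb (r (g \<sigma>))" by (simp add: p k)
    then show "p \<in> (\<Union>\<sigma>. {emb x / emb (r (g \<sigma>)) | x. True})" by blast
  qed
qed blast

lemma card_omega1_injections: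
  assumes "(card_of (UNIV :: 'a set), cardSuc natLeq) \<in> ordIso"
  shows "\<exists>i :: 'a \<Rightarrow> om1. inj i" and "\<exists>\<kappa> :: om1 \<times> 'a \<Rightarrow> 'a. inj \<kappa>"
proof -
  have iso: "(card_of (UNIV :: 'a set), card_of (UNIV :: om1 set)) \<in> ordIso"
    using assms om1_card ordIso_symmetric ordIso_transitive by blast
  then obtain i where i: "bij (i :: 'a \<Rightarrow> om1)" using card_of_ordIso by blast
  then show "\<exists>i :: 'a \<Rightarrow> om1. inj i" using bij_is_inj by blast
  have "infinite (UNIV :: om1 set)" using uncountable_infinite[OF uncountable_om1] .
  then have "infinite (UNIV :: 'a set)" using i bij_betw_finite by blast
  then have "(card_of ((UNIV :: 'a set) \<times> (UNIV :: 'a set)), card_of (UNIV :: 'a set)) \<in> ordIso"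
    by (rule card_of_Times_same_infinite)
  then obtain \<pi> where \<pi>: "bij_betw \<pi> ((UNIV :: 'a set) \<times> (UNIV :: 'a set)) (UNIV :: 'a set)"
    using card_of_ordIso by blast
  have "inj (\<lambda>p. \<pi> (inv i (fst p), snd p))"
  proof (rule injI)
    fix p p' assume "\<pi> (inv i (fst p), snd p) = \<pi> (inv i (fst p'), snd p')"
    then have "(inv i (fst p), snd p) = (inv i (fst p'), snd p')"
      using \<pi> by (auto simp: bij_betw_def dest: inj_onD)
    then show "p = p'" using i by (metis bij_inv_eq_iff prod.collapse prod.inject)
  qed
  then show "\<exists>\<kappa> :: om1 \<times> 'a \<Rightarrow> 'a. inj \<kappa>" by blast
qed

text \<open>\<open>small \<tau> \<sigma>\<close> says that \<open>r \<tau> R / r \<sigma> R\<close>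
  is countable. Either some \<tau> has only such quotients above it, or every \<tau> has an
  uncountable one; thinning turns these into the hypotheses of the special tree and of the
  closing-off argument, respectively.\<close>

lemma (in valuation_chain) nontrivial_cocycle_subsequence:
  assumes strict: "\<forall>\<sigma>. \<exists>\<tau>>\<sigma>. \<not> r \<tau> dvd r \<sigma>" and \<theta>: "\<not> invertible (r \<theta>)"
    and i: "inj (i :: 'a \<Rightarrow> om1)" and no_inj: "\<nexists>l :: nat set \<Rightarrow> 'a. inj l"
  shows "\<exists>g :: om1 \<Rightarrow> om1. strict_mono g \<and> (\<forall>\<sigma>. \<not> invertible (r (g \<sigma>))) \<and>
    (\<exists>e. valuation_chain.cocycle (\<lambda>\<sigma>. r (g \<sigma>)) e \<and> (\<nexists>c. valuation_chain.trivializes (\<lambda>\<sigma>. r (g \<sigma>)) c e))"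
proof -
  have nonunit: "\<not> invertible (r \<sigma>)" if "\<theta> \<le> \<sigma>" for \<sigma>
    using \<theta> dvd_trans[OF r_dvd[OF that]] by blast
  define small where
    "small \<tau> \<sigma> \<longleftrightarrow> (\<exists>S. countable S \<and> (\<forall>a. r \<tau> dvd a \<longrightarrow> (\<exists>s\<in>S. eqm (r \<sigma>) a s)))" for \<tau> \<sigma>
  show ?thesis
  proof (cases "\<exists>\<tau>1. \<forall>\<sigma>>\<tau>1. small \<tau>1 \<sigma>")
    case True
    then obtain \<tau>1 where \<tau>1: "\<forall>\<sigma>>\<tau>1. small \<tau>1 \<sigma>" by blast
    \<comment> \<open>High enough that \<open>r \<eta>\<close> is a nonunit and that its quotients
      are countable.\<close>
    define \<eta> where "\<eta> = max \<theta> \<tau>1"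
    define z where "z = r \<eta>"
    have "\<forall>\<tau>. \<exists>\<sigma>>\<tau>. \<forall>S. finite S \<longrightarrow> (\<exists>a. r \<tau> dvd a \<and> (\<forall>s\<in>S. \<not> eqm (r \<sigma>) a s))"
      using infinite_quotient_step[OF strict] by blast
    from thinning[OF this, of \<eta>]
    obtain g :: "om1 \<Rightarrow> om1" where g: "strict_mono g" "\<forall>\<sigma>. \<eta> < g \<sigma> \<and> (\<forall>S. finite S \<longrightarrow>
        (\<exists>a. r \<eta> dvd a \<and> (\<forall>\<tau><\<sigma>. r (g \<tau>) dvd a) \<and> (\<forall>s\<in>S. \<not> eqm (r (g \<sigma>)) a s)))"
      by (elim exE conjE)
    have z_dvd: "z dvd r (g \<sigma>)" for \<sigma> unfolding z_def using g(2) by (simp add: r_dvd less_imp_le)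
    have "\<exists>q :: nat \<Rightarrow> 'a. (\<forall>n. eqm z (q n) 1) \<and> (\<forall>x. eqm z x 1 \<longrightarrow> (\<exists>n. eqm (r (g \<sigma>)) x (q n)))" for \<sigma>
    proof -
      have "\<tau>1 < g \<sigma>" using g(2) by (auto simp: \<eta>_def)
      then obtain S where S: "countable S" "\<forall>a. r \<tau>1 dvd a \<longrightarrow> (\<exists>s\<in>S. eqm (r (g \<sigma>)) a s)"
        using \<tau>1 unfolding small_def by blast
      have z1: "r \<tau>1 dvd z" unfolding z_def \<eta>_def by (simp add: r_dvd)
      \<comment> \<open>Countability is known for multiples of \<open>r \<tau>1\<close>. A
        representative of a multiple of \<open>z\<close> is itself a multiple of \<open>z\<close>,
        because \<open>z\<close> divides the modulus; so restricting to such representatives keeps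
        the list dense.\<close>
      define T where "T = (\<lambda>s. 1 + s) ` {s \<in> S. z dvd s}"
      have dense: "\<exists>t\<in>T. eqm (r (g \<sigma>)) x t" if x: "eqm z x 1" for x
      proof -
        have zx: "z dvd x - 1" using x by (simp add: eqm_def)
        then obtain s where s: "s \<in> S" "eqm (r (g \<sigma>)) (x - 1) s" using S(2) dvd_trans[OF z1] by blast
        have "z dvd (x - 1) - s" using dvd_trans[OF z_dvd] s(2) unfolding eqm_def by blast
        from dvd_diff[OF zx this] have "z dvd s" by simp
        then have "1 + s \<in> T" using s(1) by (simp add: T_def)
        moreover have "eqm (r (g \<sigma>)) x (1 + s)" using s(2) by (simp add: eqm_def algebra_simps)
        ultimately show ?thesis by blast
      qed
      have "T \<noteq> {}" using dense[of 1] by auto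
      moreover have "countable T" unfolding T_def using S(1) by auto
      ultimately have range: "range (from_nat_into T) = T" by (rule range_from_nat_into)
      have "eqm z (from_nat_into T n) 1" for n
      proof -
        have "from_nat_into T n \<in> T" using range by blast
        then show ?thesis by (auto simp: T_def eqm_def)
      qed
      moreover have "\<exists>n. eqm (r (g \<sigma>)) x (from_nat_into T n)" if "eqm z x 1" for x
        using dense[OF that] range by (metis rangeE)
      ultimately show ?thesis by blast
    qed
    then have "\<exists>q. \<forall>\<sigma>. (\<forall>n :: nat. eqm z (q \<sigma> n) 1) \<and> (\<forall>x. eqm z x 1 \<longrightarrow> (\<exists>n. eqm (r (g \<sigma>)) x (q \<sigma> n)))"
      by (intro choice allI)
    then obtain q :: "om1 \<Rightarrow> nat \<Rightarrow> 'a" where q: "\<forall>\<sigma>. (\<forall>n. eqm z (q \<sigma> n) 1) \<and>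
        (\<forall>x. eqm z x 1 \<longrightarrow> (\<exists>n. eqm (r (g \<sigma>)) x (q \<sigma> n)))" by blast
    have "countable_chain (\<lambda>\<sigma>. r (g \<sigma>)) z q"
    proof (intro countable_chain.intro valuation_chain_subsequence[OF g(1)] countable_chain_axioms.intro)
      show "\<not> invertible z" unfolding z_def by (rule nonunit) (simp add: \<eta>_def)
      show "z dvd r (g \<tau>)" for \<tau> by (rule z_dvd)
      show "\<exists>a. z dvd a \<and> (\<forall>\<tau><\<sigma>. r (g \<tau>) dvd a) \<and> (\<forall>s\<in>S. \<not> eqm (r (g \<sigma>)) a s)" if "finite S" for S \<sigma>
        unfolding z_def by (rule g(2)[rule_format, THEN conjunct2, rule_format, OF that])
      show "eqm z (q \<tau> n) 1" for \<tau> n using q by simp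
      show "\<exists>n. eqm (r (g \<tau>)) x (q \<tau> n)" if "eqm z x 1" for x \<tau> using q that by simp
    qed
    from countable_chain.nontrivial_cocycle_countable[OF this]
    have "\<exists>e. valuation_chain.cocycle (\<lambda>\<sigma>. r (g \<sigma>)) e \<and>
      (\<nexists>c. valuation_chain.trivializes (\<lambda>\<sigma>. r (g \<sigma>)) c e)" .
    moreover have "\<forall>\<sigma>. \<not> invertible (r (g \<sigma>))"
    proof
      fix \<sigma>
      have "\<theta> \<le> g \<sigma>" using g(2) by (auto simp: \<eta>_def less_imp_le)
      then show "\<not> invertible (r (g \<sigma>))" by (rule nonunit)
    qed
    ultimately show ?thesis by (intro exI[of _ g] conjI g(1))
  next
    case False
    have "\<forall>\<tau>. \<exists>\<sigma>>\<tau>. \<forall>S. countable S \<longrightarrow> (\<exists>a. r \<tau> dvd a \<and> (\<forall>s\<in>S. \<not> eqm (r \<sigma>) a s))"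
    proof
      fix \<tau>
      obtain \<sigma> where \<sigma>: "\<tau> < \<sigma>" "\<not> small \<tau> \<sigma>" using False by blast
      have "\<exists>a. r \<tau> dvd a \<and> (\<forall>s\<in>S. \<not> eqm (r \<sigma>) a s)" if "countable S" for S
      proof (rule ccontr)
        assume "\<not> ?thesis"
        then have "\<forall>a. r \<tau> dvd a \<longrightarrow> (\<exists>s\<in>S. eqm (r \<sigma>) a s)" by simp
        with that have "small \<tau> \<sigma>" unfolding small_def by (intro exI[of _ S] conjI)
        then show False using \<sigma>(2) by simp
      qed
      then show "\<exists>\<sigma>>\<tau>. \<forall>S. countable S \<longrightarrow> (\<exists>a. r \<tau> dvd a \<and> (\<forall>s\<in>S. \<not> eqm (r \<sigma>) a s))"
        using \<sigma>(1) by (intro exI[of _ \<sigma>] conjI allI impI)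
    qed
    from thinning[OF this, of \<theta>]
    obtain g :: "om1 \<Rightarrow> om1" where g: "strict_mono g" "\<forall>\<sigma>. \<theta> < g \<sigma> \<and> (\<forall>S. countable S \<longrightarrow>
        (\<exists>a. r \<theta> dvd a \<and> (\<forall>\<tau><\<sigma>. r (g \<tau>) dvd a) \<and> (\<forall>s\<in>S. \<not> eqm (r (g \<sigma>)) a s)))"
      by (elim exE conjE)
    have nu: "\<forall>\<sigma>. \<not> invertible (r (g \<sigma>))" 
      using g(2) nonunit[OF less_imp_le] by simp
    have "\<forall>\<sigma> S. countable S \<longrightarrow> (\<exists>a. (\<forall>\<tau><\<sigma>. r (g \<tau>) dvd a) \<and> (\<forall>s\<in>S. \<not> eqm (r (g \<sigma>)) a s))"
    proof (intro allI impI)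
      fix \<sigma> and S :: "'a set" assume "countable S"
      from g(2)[rule_format, THEN conjunct2, rule_format, OF this]
      show "\<exists>a. (\<forall>\<tau><\<sigma>. r (g \<tau>) dvd a) \<and> (\<forall>s\<in>S. \<not> eqm (r (g \<sigma>)) a s)" by blast
    qed
    from valuation_chain.nontrivial_cocycle_uncountable[OF valuation_chain_subsequence[OF g(1)] nu this no_inj i]
    show ?thesis by (intro exI[of _ g] conjI g(1) nu)
  qed
qed

theorem mainTheorem12:
  fixes J :: "'a::idom fract set"
  assumes "valuation_domain TYPE('a)"
    and "(card_of (UNIV :: 'a set), cardSuc natLeq) \<in> ordIso"
    and "submodQ J" and "range emb \<subseteq> J"
    and "Gamma_is_one J"
  shows "\<exists>(U :: 'a set) add z (smul :: 'a \<Rightarrow> 'a \<Rightarrow> 'a).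
           rmodule U add z smul \<and> uniserial U add z smul \<and>
           \<not> standard U add z smul \<and> has_type U add z smul J (range emb)"
proof -
  obtain r0 C0 where r0: "rep_of J r0" and C0: "cub C0" "C0 \<subseteq> Gamma_set r0"
    using assms(5) unfolding Gamma_is_one_def by blast
  define r :: "om1 \<Rightarrow> 'a" where "r \<sigma> = r0 (Rep_om1 \<sigma>)" for \<sigma>
  define C where "C = {\<sigma>. Rep_om1 \<sigma> \<in> C0}"
  have C: "club_om1 C" unfolding C_def by (rule cub_imp_club_om1[OF C0(1)])
  have inc: "incomplete_at r \<delta>" if "\<delta> \<in> C" for \<delta>
    using incomplete_at_Gamma_set[of \<delta> r0] that C0(2) by (auto simp: C_def r_def[abs_def])
  have J: "J = (\<Union>\<sigma>. {emb x / emb (r \<sigma>) | x. True})"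
    unfolding r_def by (rule rep_of_om1(3)[OF r0])
  interpret valuation_chain r
    by unfold_locales (auto simp: r_def valuation_domain_dvd_total[OF assms(1)] rep_of_om1[OF r0])
  obtain i :: "'a \<Rightarrow> om1" where i: "inj i" using card_omega1_injections(1)[OF assms(2)] by blast
  obtain \<kappa> :: "om1 \<times> 'a \<Rightarrow> 'a" where \<kappa>: "inj \<kappa>" using card_omega1_injections(2)[OF assms(2)] by blast
  have unb: "\<exists>\<delta>\<in>C. \<sigma> < \<delta>" for \<sigma> using C unfolding club_om1_def by blast
  obtain \<theta> where \<theta>: "\<not> invertible (r \<theta>)" using unb incomplete_imp_strict(1)[OF inc] by blast
  have strict: "\<forall>\<sigma>. \<exists>\<tau>>\<sigma>. \<not> r \<tau> dvd r \<sigma>"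
  proof
    fix \<sigma>
    obtain \<delta> where \<delta>: "\<delta> \<in> C" "\<sigma> < \<delta>" using unb by blast
    obtain \<tau> where \<tau>: "\<not> r \<tau> dvd r \<sigma>" using incomplete_imp_strict(2)[OF inc[OF \<delta>(1)] \<delta>(2)] by blast
    then have "\<sigma> < \<tau>" using r_dvd[of \<tau> \<sigma>] by (meson not_less)
    then show "\<exists>\<tau>>\<sigma>. \<not> r \<tau> dvd r \<sigma>" using \<tau> by blast
  qed
  show ?thesis
  \<comment> \<open>Since R has cardinality \<aleph>1, this asks whether the continuum hypothesis
    holds.\<close>
  proof (cases "\<exists>l :: nat set \<Rightarrow> 'a. inj l")
    case True
    then obtain l :: "nat set \<Rightarrow> 'a" where l: "inj l" by blast
    have "\<forall>\<delta>. \<exists>w. \<delta> \<in> C \<longrightarrow> unit_net \<delta> w \<and> (\<forall>u. \<exists>\<tau><\<delta>. \<not> eqm (r \<tau>) u (w \<tau>))"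
      using incomplete_imp_unit_net inc by blast
    then obtain w where w: "\<forall>\<delta>. \<delta> \<in> C \<longrightarrow> unit_net \<delta> (w \<delta>) \<and> (\<forall>u. \<exists>\<tau><\<delta>. \<not> eqm (r \<tau>) u (w \<delta> \<tau>))"
      by metis
    then have w1: "\<forall>\<delta>\<in>C. unit_net \<delta> (w \<delta>)" and w2: "\<forall>\<delta>\<in>C. \<forall>u. \<exists>\<tau><\<delta>. \<not> eqm (r \<tau>) u (w \<delta> \<tau>)"
      by blast+
    obtain e where "cocycle e" "\<nexists>c. trivializes c e"
      using nontrivial_cocycle_CH[OF C w1 w2 i l] by blast
    then show ?thesis by (rule nonstandard_uniserial_of_cocycle[OF _ _ \<theta> \<kappa> J])
  next
    case False
    obtain g :: "om1 \<Rightarrow> om1" and e where g: "strict_mono g" and nu: "\<forall>\<sigma>. \<not> invertible (r (g \<sigma>))"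
      and e: "valuation_chain.cocycle (\<lambda>\<sigma>. r (g \<sigma>)) e"
        "\<nexists>c. valuation_chain.trivializes (\<lambda>\<sigma>. r (g \<sigma>)) c e"
      using nontrivial_cocycle_subsequence[OF strict \<theta> i False] by blast
    show ?thesis
      by (rule valuation_chain.nonstandard_uniserial_of_cocycle[OF valuation_chain_subsequence[OF g] e
            nu[rule_format] \<kappa> J[unfolded union_subsequence[OF g]]])
  qed
qed

end
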